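(* Let $\gamma\in\mathbb{R}\setminus\{0\}$. Then there exist $\lambda>0$ and $\varepsilon_0>0$ such that for any $0<\varepsilon\le\varepsilon_0$ there exist analytic, non-zonal and non-trivial travelling wave solutions $\overline\Psi_\varepsilon$, with wave velocity $c=\sqrt{\frac3\pi}\,\gamma$, to the non-rotating Euler equation on $\mathbb{S}^2$ such that $$\|3\gamma Y_1^0-\overline\Psi_\varepsilon\|_{\mathcal{G}_\lambda(\mathbb{S}^2)}=O(\varepsilon).$$
   Context: $\mathbb{S}^2$ is the unit sphere with colatitude $\theta$ and longitude $\varphi$, coordinates $(\sin\theta\cos\varphi,\sin\theta\sin\varphi,\cos\theta)$; $\mathbf{e}_\theta=\partial_\theta$, $\mathbf{e}_\varphi=\frac{1}{\sin\theta}\partial_\varphi$; $\nabla f=\partial_\theta f\,\mathbf{e}_\theta+\frac1{\sin\theta}\partial_\varphi f\,\mathbf{e}_\varphi$, $\nabla^\perp f=J\nabla f$ with $J\mathbf{e}_\theta=-\mathbf{e}_\varphi$, $J\mathbf{e}_\varphi=\mathbf{e}_\theta$; $\Delta$ is the Laplace-Beltrami operator. The non-rotating Euler equation is $\partial_t\overline\Omega+\overline U\cdot\nabla\overline\Omega=0$, $\overline U=\nabla^\perp\overline\Psi$, $\Delta\overline\Psi=\overline\Omega$. A travelling wave with wave velocity $c$ is a solution whose stream function has the form $\overline\Psi(t,\theta,\varphi)=\Phi(\theta,\varphi-ct)$. Let $\{Y_n^m:n\ge0,|m|\le n\}$ be the $L^2(\mathbb{S}^2)$-orthonormal basis of real spherical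 harmonics, $-\Delta Y_n^m=\lambda_nY_n^m$, $\lambda_n=n(n+1)$, $\mu_n=\lambda_n+1$; $Y_1^0=\frac12\sqrt{\frac3\pi}\cos\theta$. For $u=\sum u_n^mY_n^m$, the Gevrey norm is $\|u\|_{\mathcal{G}_\lambda}^2=\sum_{n\ge0}\sum_{|m|\le n}\mu_n^2e^{2\lambda\mu_n^{1/2}}|u_n^m|^2$ (applied to $\overline\Psi_\varepsilon$ at each time $t$). The $O(\varepsilon)$ is as $\varepsilon\to0$ with constant independent of $\varepsilon$ and $t$. A function on $\mathbb{S}^2$ is zonal if it depends only on $\theta$. Non-trivial means not the sum of a zonal function and an element of $\mathbf{Y}_2=\mathrm{span}\{Y_2^m:|m|\le2\}$. *)

theory Defs
  imports "HOL-Analysis.Analysis" "HOL-Computational_Algebra.Polynomial"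
begin

text \<open>
  A function on the unit sphere is written in terms of colatitude and longitude. Only its values
  on \<open>{0..pi} \<times> \<real>\<close> are ever used. The coordinates cover the sphere redundantly
  (periodicity in the longitude, degeneration at the poles); that a coordinate expression really
  comes from a function on the sphere is part of \<open>analytic_S2\<close> below.
\<close>

type_synonym S2_fun = "real \<Rightarrow> real \<Rightarrow> real"

definition S2_point :: "real \<Rightarrow> real \<Rightarrow> real ^ 3" where
  "S2_point \<theta> \<phi> = vector [sin \<theta> * cos \<phi>, sin \<theta> * sin \<phi>, cos \<theta>]"

text \<open>The index \<open>\<alpha>\<close> below is a multi-index, so this is local expandability into a power series.\<close>

definition real_analytic_at :: "(real ^ 'n \<Rightarrow> real) \<Rightarrow> real ^ 'n \<Rightarrow> bool" where
  "real_analytic_at F x \<longleftrightarrow>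
     (\<exists>a. \<exists>r>0. \<forall>y\<in>ball x r.
        ((\<lambda>\<alpha>::'n \<Rightarrow> nat. a \<alpha> * (\<Prod>i\<in>UNIV. (y $ i - x $ i) ^ \<alpha> i)) has_sum F y) UNIV)"

text \<open>
  Analyticity on the sphere as an embedded analytic submanifold: the function is the restriction
  of a real analytic function on a neighbourhood of the sphere. Nothing is lost against
  analyticity in charts, since then \<open>x \<mapsto> f (x / norm x)\<close> is such an extension.
\<close>

definition analytic_S2 :: "S2_fun \<Rightarrow> bool" where
  "analytic_S2 f \<longleftrightarrow>
     (\<exists>F. (\<forall>x\<in>sphere 0 1. real_analytic_at F x) \<and>
          (\<forall>\<theta>\<in>{0..pi}. \<forall>\<phi>. f \<theta> \<phi> = F (S2_point \<theta> \<phi>)))"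

text \<open>
  The tangent vector \<open>a e\<^sub>\<theta> + b e\<^sub>\<phi>\<close> is represented by the pair \<open>(a, b)\<close>. The frame is
  orthonormal, so the inner product of tangent vectors is that of \<open>real \<times> real\<close>.
\<close>

definition grad_S2 :: "S2_fun \<Rightarrow> real \<Rightarrow> real \<Rightarrow> real \<times> real" where
  "grad_S2 f \<theta> \<phi> =
     (deriv (\<lambda>s. f s \<phi>) \<theta>, 1 / sin \<theta> * deriv (\<lambda>s. f \<theta> s) \<phi>)"

text \<open>\<open>J e\<^sub>\<theta> = - e\<^sub>\<phi>\<close> and \<open>J e\<^sub>\<phi> = e\<^sub>\<theta>\<close>, extended linearly.\<close>

definition J_S2 :: "real \<times> real \<Rightarrow> real \<times> real" where
  "J_S2 v = fst v *\<^sub>R (0, -1) + snd v *\<^sub>R (1, 0)"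

definition grad_perp_S2 :: "S2_fun \<Rightarrow> real \<Rightarrow> real \<Rightarrow> real \<times> real" where
  "grad_perp_S2 f \<theta> \<phi> = J_S2 (grad_S2 f \<theta> \<phi>)"

definition laplace_S2 :: "S2_fun \<Rightarrow> S2_fun" where
  "laplace_S2 f \<theta> \<phi> =
     1 / sin \<theta> * deriv (\<lambda>s. sin s * deriv (\<lambda>r. f r \<phi>) s) \<theta>
     + 1 / (sin \<theta>)\<^sup>2 * deriv (\<lambda>s. deriv (\<lambda>r. f \<theta> r) s) \<phi>"

text \<open>
  The vorticity equation for the stream function \<open>\<Psi> t\<close> at time \<open>t\<close>, away from the two coordinate
  singularities \<open>\<theta> = 0\<close> and \<open>\<theta> = pi\<close>. For the smooth stream functions it is used with,
  the equation at the poles follows by continuity.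
\<close>

definition euler_solution :: "(real \<Rightarrow> S2_fun) \<Rightarrow> bool" where
  "euler_solution \<Psi> \<longleftrightarrow>
     (let \<Omega> = (\<lambda>t. laplace_S2 (\<Psi> t)); U = (\<lambda>t. grad_perp_S2 (\<Psi> t)) in
      \<forall>t. \<forall>\<theta>\<in>{0<..<pi}. \<forall>\<phi>.
        ((\<lambda>s. \<Omega> s \<theta> \<phi>) has_real_derivative - (U t \<theta> \<phi> \<bullet> grad_S2 (\<Omega> t) \<theta> \<phi>)) (at t))"

definition travelling_wave :: "real \<Rightarrow> (real \<Rightarrow> S2_fun) \<Rightarrow> bool" where
  "travelling_wave c \<Psi> \<longleftrightarrow>
     euler_solution \<Psi> \<and>
     (\<exists>\<Phi>. \<forall>t. \<forall>\<theta>\<in>{0..pi}. \<forall>\<phi>. \<Psi> t \<theta> \<phi> = \<Phi> \<theta> (\<phi> - c * t))"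

text \<open>
  Real spherical harmonics, from Rodrigues' formula and
  \<open>P\<^sub>n\<^sup>m(cos \<theta>) = sin\<^sup>m \<theta> (d\<^sup>m P\<^sub>n / dx\<^sup>m)(cos \<theta>)\<close> (no Condon-Shortley sign).
\<close>

definition legendre_poly :: "nat \<Rightarrow> real poly" where
  "legendre_poly n = smult (1 / (2 ^ n * fact n)) ((pderiv ^^ n) ([:-1, 0, 1:] ^ n))"

definition legendre_assoc :: "nat \<Rightarrow> nat \<Rightarrow> real \<Rightarrow> real" where
  "legendre_assoc n m \<theta> = sin \<theta> ^ m * poly ((pderiv ^^ m) (legendre_poly n)) (cos \<theta>)"

definition sph_harm :: "nat \<Rightarrow> int \<Rightarrow> S2_fun" where
  "sph_harm n m \<theta> \<phi> =
     sqrt ((2 * real n + 1) / (4 * pi) * fact (n - nat \<bar>m\<bar>) / fact (n + nat \<bar>m\<bar>))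
     * legendre_assoc n (nat \<bar>m\<bar>) \<theta>
     * (if m = 0 then 1
        else if m > 0 then sqrt 2 * cos (real_of_int m * \<phi>)
        else sqrt 2 * sin (real_of_int \<bar>m\<bar> * \<phi>))"

lemma sph_harm_1_0: "sph_harm 1 0 \<theta> \<phi> = 1 / 2 * sqrt (3 / pi) * cos \<theta>"
proof -
  have "sqrt (3 / (4 * pi)) = 1 / 2 * sqrt (3 / pi)"
    by (simp add: real_sqrt_divide real_sqrt_mult)
  then show ?thesis
    by (simp add: sph_harm_def legendre_assoc_def legendre_poly_def pderiv_pCons)
qed

definition sph_coeff :: "S2_fun \<Rightarrow> nat \<Rightarrow> int \<Rightarrow> real" where
  "sph_coeff u n m =
     integral ({0..pi} \<times> {0..2 * pi}) (\<lambda>(\<theta>, \<phi>). u \<theta> \<phi> * sph_harm n m \<theta> \<phi> * sin \<theta>)"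

definition eigval :: "nat \<Rightarrow> real" where
  "eigval n = real n * (real n + 1)"

definition mu :: "nat \<Rightarrow> real" where
  "mu n = eigval n + 1"

definition gevrey_term :: "real \<Rightarrow> S2_fun \<Rightarrow> nat \<times> int \<Rightarrow> real" where
  "gevrey_term l u = (\<lambda>(n, m). (mu n)\<^sup>2 * exp (2 * l * sqrt (mu n)) * \<bar>sph_coeff u n m\<bar>\<^sup>2)"

definition gevrey_norm :: "real \<Rightarrow> S2_fun \<Rightarrow> ereal" where
  "gevrey_norm l u =
     (let I = (SIGMA n:UNIV. {- int n..int n}) in
      if gevrey_term l u summable_on I then ereal (sqrt (\<Sum>\<^sub>\<infinity>i\<in>I. gevrey_term l u i)) else \<infinity>)"

definition zonal :: "S2_fun \<Rightarrow> bool" where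
  "zonal f \<longleftrightarrow> (\<exists>g. \<forall>\<theta>\<in>{0..pi}. \<forall>\<phi>. f \<theta> \<phi> = g \<theta>)"

definition in_Y2 :: "S2_fun \<Rightarrow> bool" where
  "in_Y2 f \<longleftrightarrow>
     (\<exists>a. \<forall>\<theta>\<in>{0..pi}. \<forall>\<phi>. f \<theta> \<phi> = (\<Sum>m\<in>{-2..2}. a m * sph_harm 2 m \<theta> \<phi>))"

definition trivial_S2 :: "S2_fun \<Rightarrow> bool" where
  "trivial_S2 f \<longleftrightarrow>
     (\<exists>z y. zonal z \<and> in_Y2 y \<and> (\<forall>\<theta>\<in>{0..pi}. \<forall>\<phi>. f \<theta> \<phi> = z \<theta> \<phi> + y \<theta> \<phi>))"

end

theory Submission
  imports Defs "HOL-Library.Function_Algebras" "HOL-Real_Asymp.Real_Asymp"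
begin

text \<open>
  Write \<open>x = sin \<theta> cos \<phi>\<close> and \<open>z = cos \<theta>\<close>. For \<open>\<Psi>(t, \<theta>, \<phi>) = c z + (c/2) s(\<theta>, \<phi> - c t)\<close> the vorticity
  is \<open>(c/2) (\<Delta> s - 4 z)\<close>, and \<open>\<Psi>\<close> solves the Euler equation as soon as \<open>\<Delta> s - 4 z\<close> is a function of
  \<open>s\<close>. The choice \<open>s = z\<close> gives \<open>3 \<gamma> Y\<^sub>1\<^sup>0\<close>. Nearby solutions \<open>s = z + \<epsilon> z Y\<close> are sought in the form
  \<open>(\<Delta> + 6) s - 4 z = \<epsilon>\<^sup>2 (s\<^sup>3 + \<beta> s)\<close>, odd in \<open>z\<close> and even in the third coordinate: on this class the kernel
  of \<open>\<Delta> + 6\<close> is spanned by \<open>x z\<close>, and the number \<open>\<beta>\<close> absorbs the single solvability condition.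
  In the monomials \<open>z x\<^sup>i z\<^sup>2\<^sup>j\<close> the Laplacian is triangular with respect to the degree, and with the
  geometric weight \<open>16\<close> per degree its off-diagonal part is small, so that the equation becomes a
  fixed point problem for a contraction of \<open>\<ell>\<^sup>1\<close>. The weight also yields the analyticity of the
  solution and the exponential decay of its spherical harmonic coefficients. Finally, if \<open>s\<close> were
  a zonal function plus an element of \<open>Y\<^sub>2\<close>, then \<open>(\<Delta> + 6) s - 4 z\<close> would be zonal whereas
  \<open>s\<^sup>3 + \<beta> s\<close> is not.
\<close>

text \<open>The part \<open>c z\<close> is the stream function of a rigid rotation with angular
  velocity c, so its advection cancels the time derivative of a profile in \<phi> - c t; the
  remaining advection is that of the vorticity by s, which vanishes if the vorticity is a function
  of s. At s = z the relation is linear, \<Delta> s - 4 z = -6 s, and adding a degree 2 harmonic to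
  s preserves it but yields only trivial waves. The obstacle is thus to leave the linear relation
  near a point where the linearisation \<Delta> + 6 is singular. The kernel direction x z enters s
  with amplitude \<epsilon> and the nonlinearity has size \<epsilon>^2, so after division by
  \<epsilon> z a regular problem remains for Y, with leading term x. Working with coefficients of
  monomials replaces elliptic theory: inverse, products, analyticity and decay all become estimates
  of absolutely convergent series. The weight 16 also has to outgrow the harmonics: their crude
  bound costs 4^n against a gain of 16^-n, and the remaining 4^-n still beats the factor of order
  exp (n / 2) in the Gevrey norm with \<lambda> = 1 / 2.\<close>

section \<open>Absolutely summable families\<close>

text \<open>The index type is arbitrary because the same space holds the coefficients of the
  solution, power series in multi-indices for analyticity, and single rows of coefficients for
  non-triviality. Being a type, it can be an instance of \<open>banach\<close>, with the fixed point
  theorem and infinite sums at hand.\<close>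

typedef 'i l1 = "{a :: 'i \<Rightarrow> real. a summable_on UNIV}"
  morphisms coef Abs_l1
  by (rule exI[of _ "\<lambda>_. 0"]) simp

setup_lifting type_definition_l1

lemma summable_on_diff_real:
  fixes f g :: "'i \<Rightarrow> real"
  assumes "f summable_on A" "g summable_on A"
  shows "(\<lambda>k. f k - g k) summable_on A"
  using summable_on_add[OF assms(1) summable_on_uminus[THEN iffD2, OF assms(2)]] by simp

lemma coef_summable: "coef a summable_on A"
proof -
  have "coef a summable_on UNIV" using coef[of a] by simp
  then show ?thesis by (rule summable_on_subset_banach) auto
qed

lemma coef_abs_summable: "(\<lambda>k. \<bar>coef a k\<bar>) summable_on A"
  using coef_summable[of a A] summable_on_iff_abs_summable_on_real[of "coef a" A] by simp

lemma l1_eqI: "(\<And>k. coef a k = coef b k) \<Longrightarrow> a = b"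
  by (metis coef_inject ext)

instantiation l1 :: (type) real_vector
begin

lift_definition zero_l1 :: "'a l1" is "\<lambda>_. 0" by simp
lift_definition plus_l1 :: "'a l1 \<Rightarrow> 'a l1 \<Rightarrow> 'a l1" is "\<lambda>a b k. a k + b k"
  by (rule summable_on_add)
lift_definition minus_l1 :: "'a l1 \<Rightarrow> 'a l1 \<Rightarrow> 'a l1" is "\<lambda>a b k. a k - b k"
  by (rule summable_on_diff_real)
lift_definition uminus_l1 :: "'a l1 \<Rightarrow> 'a l1" is "\<lambda>a k. - a k"
  by (simp add: summable_on_uminus)
lift_definition scaleR_l1 :: "real \<Rightarrow> 'a l1 \<Rightarrow> 'a l1" is "\<lambda>c a k. c * a k"
  by (rule summable_on_cmult_right)

instance
  by standard (transfer; simp add: algebra_simps)+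

end

instantiation l1 :: (type) real_normed_vector
begin

definition norm_l1 :: "'a l1 \<Rightarrow> real" where "norm_l1 a = (\<Sum>\<^sub>\<infinity>k. \<bar>coef a k\<bar>)"
definition sgn_l1 :: "'a l1 \<Rightarrow> 'a l1" where "sgn_l1 a = a /\<^sub>R norm a"
definition dist_l1 :: "'a l1 \<Rightarrow> 'a l1 \<Rightarrow> real" where "dist_l1 a b = norm (a - b)"
definition uniformity_l1 :: "('a l1 \<times> 'a l1) filter"
  where "uniformity_l1 = (INF e\<in>{0<..}. principal {(x, y). dist x y < e})"
definition open_l1 :: "'a l1 set \<Rightarrow> bool"
  where "open_l1 U = (\<forall>x\<in>U. \<forall>\<^sub>F (x', y) in uniformity. x' = x \<longrightarrow> y \<in> U)"

instance
proof
  fix a b :: "'a l1" and r :: real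
  show "dist a b = norm (a - b)" by (rule dist_l1_def)
  show "sgn a = a /\<^sub>R norm a" by (rule sgn_l1_def)
  show "uniformity = (INF e\<in>{0<..}. principal {(x::'a l1, y). dist x y < e})"
    by (rule uniformity_l1_def)
  show "open U = (\<forall>x\<in>U. \<forall>\<^sub>F (x', y) in uniformity. x' = x \<longrightarrow> y \<in> U)" for U :: "'a l1 set"
    by (rule open_l1_def)
  show "norm a = 0 \<longleftrightarrow> a = 0"
  proof
    assume "norm a = 0"
    then have "\<bar>coef a k\<bar> = 0" for k
      using nonneg_infsum_le_0D[of "\<lambda>k. \<bar>coef a k\<bar>" UNIV k] coef_abs_summable[of a UNIV]
      by (simp add: norm_l1_def)
    then show "a = 0" by (intro l1_eqI) (simp add: zero_l1.rep_eq)
  next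
    assume "a = 0"
    then show "norm a = 0" by (simp add: norm_l1_def zero_l1.rep_eq)
  qed
  show "norm (a + b) \<le> norm a + norm b"
    unfolding norm_l1_def plus_l1.rep_eq
    by (subst infsum_add[symmetric])
      (auto intro!: infsum_mono summable_on_add coef_abs_summable
        coef_abs_summable[of "a + b", unfolded plus_l1.rep_eq])
  show "norm (r *\<^sub>R a) = \<bar>r\<bar> * norm a"
    unfolding norm_l1_def scaleR_l1.rep_eq by (simp add: abs_mult infsum_cmult_right')
qed

end

lemmas coef_simps [simp] =
  zero_l1.rep_eq plus_l1.rep_eq minus_l1.rep_eq uminus_l1.rep_eq scaleR_l1.rep_eq

lemma coef_has_norm: "((\<lambda>k. \<bar>coef a k\<bar>) has_sum norm a) UNIV"
  by (simp add: norm_l1_def coef_abs_summable)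

lemma sum_coef_le_norm: "finite A \<Longrightarrow> (\<Sum>k\<in>A. \<bar>coef a k\<bar>) \<le> norm a"
  unfolding norm_l1_def by (intro finite_sum_le_infsum coef_abs_summable) auto

lemma abs_coef_le_norm: "\<bar>coef a k\<bar> \<le> norm a"
  using sum_coef_le_norm[of "{k}" a] by simp

text \<open>Bounds on finite partial sums give membership and the norm estimate at once;
  completeness, \<open>wpull\<close> and \<open>conv\<close> all rest on this.\<close>

lemma l1_of_bound:
  assumes "\<And>A. finite A \<Longrightarrow> (\<Sum>k\<in>A. \<bar>f k\<bar>) \<le> c"
  obtains a where "coef a = f" "norm a \<le> c"
proof -
  have "(\<lambda>k. \<bar>f k\<bar>) summable_on UNIV"
    by (rule nonneg_bdd_above_summable_on) (use assms in \<open>auto intro!: bdd_aboveI2[of _ _ c]\<close>)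
  then have s: "f summable_on UNIV"
    using summable_on_iff_abs_summable_on_real[of f] by simp
  then have "coef (Abs_l1 f) = f" by (simp add: Abs_l1_inverse)
  moreover have "norm (Abs_l1 f) \<le> c"
    unfolding norm_l1_def using s assms
    by (intro infsum_le_finite_sums coef_abs_summable) (simp add: Abs_l1_inverse)
  ultimately show thesis by (rule that)
qed

instance l1 :: (type) banach
proof
  fix X :: "nat \<Rightarrow> 'a l1"
  assume C: "Cauchy X"
  have N: "\<exists>N. \<forall>m\<ge>N. \<forall>n\<ge>N. dist (X m) (X n) < e" if "e > 0" for e
    using metric_CauchyD[OF C that] .
  have "Cauchy (\<lambda>n. coef (X n) k)" for k
  proof (rule metric_CauchyI)
    fix e :: real assume "e > 0"
    have "dist (coef (X m) k) (coef (X n) k) \<le> dist (X m) (X n)" for m n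
      using abs_coef_le_norm[of "X m - X n" k] by (simp add: dist_norm)
    then show "\<exists>M. \<forall>m\<ge>M. \<forall>n\<ge>M. dist (coef (X m) k) (coef (X n) k) < e"
      using N[OF \<open>e > 0\<close>] by (meson le_less_trans)
  qed
  then have "(\<lambda>n. coef (X n) k) \<longlonglongrightarrow> lim (\<lambda>n. coef (X n) k)" for k
    by (simp add: Cauchy_convergent_iff convergent_LIMSEQ_iff)
  then obtain f where f: "\<And>k. (\<lambda>n. coef (X n) k) \<longlonglongrightarrow> f k" ..
  have bound: "(\<Sum>k\<in>A. \<bar>f k - coef (X n) k\<bar>) \<le> e"
    if "finite A" and N: "\<And>m n. m \<ge> N \<Longrightarrow> n \<ge> N \<Longrightarrow> dist (X m) (X n) < e" and "n \<ge> N" for A e N n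
  proof (rule tendsto_upperbound)
    show "(\<lambda>m. \<Sum>k\<in>A. \<bar>coef (X m) k - coef (X n) k\<bar>) \<longlonglongrightarrow> (\<Sum>k\<in>A. \<bar>f k - coef (X n) k\<bar>)"
      by (intro tendsto_intros f)
    show "\<forall>\<^sub>F m in sequentially. (\<Sum>k\<in>A. \<bar>coef (X m) k - coef (X n) k\<bar>) \<le> e"
    proof (rule eventually_sequentiallyI[of N])
      fix m assume "m \<ge> N"
      with N[of m n] \<open>n \<ge> N\<close> sum_coef_le_norm[OF \<open>finite A\<close>, of "X m - X n"]
      show "(\<Sum>k\<in>A. \<bar>coef (X m) k - coef (X n) k\<bar>) \<le> e" by (simp add: dist_norm)
    qed
  qed auto
  \<comment> \<open>The coefficientwise limit \<open>f\<close> is not yet known to be summable. The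
    Cauchy bound controls only its difference from a fixed \<open>X N\<close>, so the limit is
    assembled from this difference and \<open>X N\<close>.\<close>
  obtain N where N1: "\<And>m n. m \<ge> N \<Longrightarrow> n \<ge> N \<Longrightarrow> dist (X m) (X n) < 1"
    using N[of 1] by auto
  have "(\<Sum>k\<in>A. \<bar>f k - coef (X N) k\<bar>) \<le> 1" if "finite A" for A
    using bound[OF that N1] by blast
  then obtain b where b: "coef b = (\<lambda>k. f k - coef (X N) k)"
    using l1_of_bound by metis
  define a where "a = b + X N"
  have a: "coef a k = f k" for k by (simp add: a_def b)
  have "X \<longlonglongrightarrow> a"
  proof (rule metric_LIMSEQ_I)
    fix e :: real assume "e > 0"
    then obtain M where M: "\<And>m n. m \<ge> M \<Longrightarrow> n \<ge> M \<Longrightarrow> dist (X m) (X n) < e / 2"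
      using N[of "e / 2"] by auto
    have "dist (X n) a < e" if "n \<ge> M" for n
    proof -
      have "norm (a - X n) \<le> e / 2"
        unfolding norm_l1_def
        by (intro infsum_le_finite_sums coef_abs_summable)
          (use bound[OF _ M that] in \<open>simp add: a\<close>)
      then show ?thesis using \<open>e > 0\<close> by (simp add: dist_norm norm_minus_commute)
    qed
    then show "\<exists>no. \<forall>n\<ge>no. dist (X n) a < e" by blast
  qed
  then show "convergent X" by (auto simp: convergent_def)
qed

section \<open>Weighted pull-backs, convolution and evaluation\<close>

definition wpull :: "('i \<Rightarrow> real) \<Rightarrow> ('i \<Rightarrow> 'j) \<Rightarrow> 'j l1 \<Rightarrow> 'i l1" where
  "wpull w f b = Abs_l1 (\<lambda>k. w k * coef b (f k))"

text \<open>One estimate for multiplication by bounded sequences, index shifts in both directions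
  and restriction to a row. Injectivity is asked only where the weight is nonzero: the index map of
  \<open>shift\<close> identifies j = 0 with j = 1 by truncated subtraction.\<close>

lemma wpull:
  assumes "\<And>k. \<bar>w k\<bar> \<le> c" and "inj_on f {k. w k \<noteq> 0}"
  shows coef_wpull: "coef (wpull w f b) k = w k * coef b (f k)"
    and norm_wpull: "norm (wpull w f b) \<le> c * norm b"
proof -
  have "c \<ge> 0" using assms(1) abs_ge_zero order_trans by blast
  have *: "(\<Sum>k\<in>A. \<bar>w k * coef b (f k)\<bar>) \<le> c * norm b" if "finite A" for A
  proof -
    have "(\<Sum>k\<in>A. \<bar>w k * coef b (f k)\<bar>) = (\<Sum>k\<in>{k\<in>A. w k \<noteq> 0}. \<bar>w k * coef b (f k)\<bar>)"
      by (rule sum.mono_neutral_right) (use that in auto)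
    also have "\<dots> \<le> (\<Sum>k\<in>{k\<in>A. w k \<noteq> 0}. c * \<bar>coef b (f k)\<bar>)"
      by (intro sum_mono) (simp add: abs_mult mult_right_mono assms)
    also have "\<dots> = c * (\<Sum>k\<in>f ` {k\<in>A. w k \<noteq> 0}. \<bar>coef b k\<bar>)"
      by (subst sum.reindex) (auto intro: inj_on_subset[OF assms(2)] simp: sum_distrib_left)
    also have "\<dots> \<le> c * norm b"
      using that \<open>c \<ge> 0\<close> by (intro mult_left_mono sum_coef_le_norm) auto
    finally show ?thesis .
  qed
  obtain a where a: "coef a = (\<lambda>k. w k * coef b (f k))" "norm a \<le> c * norm b"
    using l1_of_bound[of "\<lambda>k. w k * coef b (f k)"] * by blast
  have "wpull w f b = a" unfolding wpull_def a(1)[symmetric] by (rule coef_inverse)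
  with a show "coef (wpull w f b) k = w k * coef b (f k)" "norm (wpull w f b) \<le> c * norm b"
    by simp_all
qed

definition single :: "'i \<Rightarrow> 'i l1" where
  "single k = Abs_l1 (\<lambda>l. if l = k then 1 else 0)"

lemma coef_single [simp]: "coef (single k) l = (if l = k then 1 else 0)"
  and norm_single [simp]: "norm (single k) = 1"
proof -
  have hs: "((\<lambda>l. if l = k then 1 else 0::real) has_sum 1) UNIV"
    by (rule has_sum_finite_neutralI[of "{k}"]) auto
  then have c: "coef (single k) = (\<lambda>l. if l = k then 1 else 0)"
    unfolding single_def by (intro Abs_l1_inverse) (auto simp: summable_on_def)
  then show "coef (single k) l = (if l = k then 1 else 0)" by simp
  have "(\<lambda>l. \<bar>coef (single k) l\<bar>) = (\<lambda>l. if l = k then 1 else 0)" by (auto simp: c)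
  then show "norm (single k) = 1" unfolding norm_l1_def using hs by (simp add: infsumI)
qed

text \<open>Multiplication of power series. For a general index type the fibres i + j = k may be
  infinite, hence the infinite sum.\<close>

definition conv :: "'i::plus l1 \<Rightarrow> 'i l1 \<Rightarrow> 'i l1" where
  "conv a b = Abs_l1 (\<lambda>k. \<Sum>\<^sub>\<infinity>(i, j)\<in>{(i, j). i + j = k}. coef a i * coef b j)"

lemma has_sum_real_product:
  fixes f :: "'i \<Rightarrow> real" and g :: "'j \<Rightarrow> real"
  assumes "(f has_sum s) UNIV" "(g has_sum t) UNIV"
  shows "((\<lambda>(i, j). f i * g j) has_sum s * t) UNIV"
proof -
  have f: "(\<lambda>i. norm (f i)) summable_on UNIV" and g: "(\<lambda>j. norm (g j)) summable_on UNIV"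
    using assms summable_on_iff_abs_summable_on_real by (auto simp: summable_on_def)
  have "(\<lambda>p. norm (case p of (i, j) \<Rightarrow> f i * g j)) summable_on UNIV \<times> UNIV"
    by (subst Infinite_Sum.abs_summable_on_Sigma_iff)
      (use f g in \<open>auto simp: abs_mult infsum_cmult_right' intro: summable_on_cmult_right summable_on_cmult_left\<close>)
  then have sm: "(\<lambda>(i, j). f i * g j) summable_on UNIV \<times> UNIV"
    by (rule abs_summable_summable)
  have "(\<Sum>\<^sub>\<infinity>p\<in>UNIV \<times> UNIV. case p of (i, j) \<Rightarrow> f i * g j) = (\<Sum>\<^sub>\<infinity>i. \<Sum>\<^sub>\<infinity>j. f i * g j)"
    using infsum_Sigma_banach[OF sm] by simp
  also have "\<dots> = s * t"
    using assms by (simp add: infsum_cmult_right' infsum_cmult_left' infsumI)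
  finally show ?thesis using sm by (metis UNIV_Times_UNIV has_sum_infsum)
qed

lemma has_sum_regroup:
  fixes h :: "'i::plus \<times> 'i \<Rightarrow> real"
  assumes "(h has_sum s) UNIV"
  shows "((\<lambda>k. \<Sum>\<^sub>\<infinity>p\<in>{(i, j). i + j = k}. h p) has_sum s) UNIV"
proof -
  \<comment> \<open>Tagging each pair with its sum presents all pairs as the disjoint union of the
    fibres, over which the sum can be iterated.\<close>
  have "((\<lambda>(k, p). h p) has_sum s) (Sigma UNIV (\<lambda>k. {(i, j). i + j = k})) \<longleftrightarrow> (h has_sum s) UNIV"
    by (rule has_sum_reindex_bij_witness[where j = snd and i = "\<lambda>(i, j). (i + j, i, j)"]) auto
  moreover have "h summable_on UNIV"
    using assms has_sum_imp_summable by blast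
  then have "h summable_on B" for B
    by (rule summable_on_subset_banach) simp
  then have "(h has_sum infsum h B) B" for B
    by (rule has_sum_infsum)
  ultimately show ?thesis
    using assms has_sum_SigmaD[where f = "\<lambda>(k, p). h p" and S = s and A = UNIV and B = "\<lambda>k. {(i, j). i + j = k}"] by simp
qed

lemma conv:
  shows coef_conv: "coef (conv a b) k = (\<Sum>\<^sub>\<infinity>(i, j)\<in>{(i, j). i + j = k}. coef a i * coef b j)"
    and norm_conv: "norm (conv a b) \<le> norm a * norm b"
proof -
  let ?f = "\<lambda>k. \<Sum>\<^sub>\<infinity>(i, j)\<in>{(i, j). i + j = k}. coef a i * coef b j"
  let ?g = "\<lambda>k. \<Sum>\<^sub>\<infinity>(i, j)\<in>{(i, j). i + j = k}. \<bar>coef a i\<bar> * \<bar>coef b j\<bar>"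
  have P: "((\<lambda>(i, j). \<bar>coef a i\<bar> * \<bar>coef b j\<bar>) has_sum norm a * norm b) UNIV"
    by (intro has_sum_real_product coef_has_norm)
  have S: "(?g has_sum norm a * norm b) UNIV"
    by (rule has_sum_regroup[OF P])
  have fg: "\<bar>?f k\<bar> \<le> ?g k" for k
  proof -
    have "(\<lambda>(i, j). \<bar>coef a i\<bar> * \<bar>coef b j\<bar>) summable_on {(i, j). i + j = k}"
      by (rule summable_on_subset_banach[of _ UNIV]) (use P in \<open>auto simp: summable_on_def\<close>)
    then have "(\<lambda>p. norm (case p of (i, j) \<Rightarrow> coef a i * coef b j)) summable_on {(i, j). i + j = k}"
      by (simp add: case_prod_unfold abs_mult)
    from norm_infsum_bound[OF this] show ?thesis
      by (simp add: case_prod_unfold abs_mult)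
  qed
  have "(\<Sum>k\<in>A. \<bar>?f k\<bar>) \<le> norm a * norm b" if "finite A" for A
  proof -
    have "(\<Sum>k\<in>A. \<bar>?f k\<bar>) \<le> (\<Sum>k\<in>A. ?g k)" by (intro sum_mono fg)
    also have "\<dots> \<le> norm a * norm b"
      by (rule finite_sum_le_has_sum[OF S that]) (auto intro!: infsum_nonneg)
    finally show ?thesis .
  qed
  then obtain c where c: "coef c = ?f" "norm c \<le> norm a * norm b"
    using l1_of_bound[of ?f] by blast
  have "conv a b = c" unfolding conv_def c(1)[symmetric] by (rule coef_inverse)
  with c show "coef (conv a b) k = ?f k" "norm (conv a b) \<le> norm a * norm b" by simp_all
qed

lemma conv_summable: "(\<lambda>(i, j). coef a i * coef b j) summable_on A"
proof -
  have "(\<lambda>(i, j). coef a i * coef b j) summable_on UNIV"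
    using has_sum_real_product[OF has_sum_infsum has_sum_infsum, OF coef_summable coef_summable, of a b]
    by (auto simp: summable_on_def)
  then show ?thesis by (rule summable_on_subset_banach) auto
qed

lemma conv_diff_left: "conv (a - a') b = conv a b - conv a' b"
  and conv_diff_right: "conv a (b - b') = conv a b - conv a b'"
proof -
  have *: "(\<Sum>\<^sub>\<infinity>p\<in>A. f p - g p) = infsum f A - infsum g A"
    if "f summable_on A" "g summable_on A" for f g :: "'a \<times> 'a \<Rightarrow> real" and A
    using infsum_add[OF that(1) summable_on_uminus[THEN iffD2, OF that(2)]]
    by (simp add: infsum_uminus)
  show "conv (a - a') b = conv a b - conv a' b"
    by (intro l1_eqI, simp add: coef_conv, subst *[symmetric])
       (auto intro: conv_summable intro!: infsum_cong simp: algebra_simps)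
  show "conv a (b - b') = conv a b - conv a b'"
    by (intro l1_eqI, simp add: coef_conv, subst *[symmetric])
       (auto intro: conv_summable intro!: infsum_cong simp: algebra_simps)
qed

definition eval_l1 :: "('i \<Rightarrow> real) \<Rightarrow> 'i l1 \<Rightarrow> real" where
  "eval_l1 \<xi> a = (\<Sum>\<^sub>\<infinity>k. coef a k * \<xi> k)"

text \<open>The instances are monomials evaluated at a point of the closed unit polydisc. For them
  \<open>eval_l1\<close> is a continuous homomorphism from convolution to multiplication.\<close>

definition character :: "('i::plus \<Rightarrow> real) \<Rightarrow> bool" where
  "character \<xi> \<longleftrightarrow> (\<forall>k. \<bar>\<xi> k\<bar> \<le> 1) \<and> (\<forall>k l. \<xi> (k + l) = \<xi> k * \<xi> l)"

lemma eval_l1_has_sum: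
  assumes "\<And>k. \<bar>\<xi> k\<bar> \<le> 1"
  shows "((\<lambda>k. coef a k * \<xi> k) has_sum eval_l1 \<xi> a) UNIV" and "\<bar>eval_l1 \<xi> a\<bar> \<le> norm a"
proof -
  have le: "\<bar>coef a k * \<xi> k\<bar> \<le> \<bar>coef a k\<bar>" for k
    using assms[of k] by (simp add: abs_mult mult_left_le)
  have s: "(\<lambda>k. norm (coef a k * \<xi> k)) summable_on UNIV"
    using coef_abs_summable[of a UNIV] le
    by (intro Infinite_Sum.abs_summable_on_comparison_test[where g = "coef a" and f = "\<lambda>k. coef a k * \<xi> k"]) simp_all
  then show "((\<lambda>k. coef a k * \<xi> k) has_sum eval_l1 \<xi> a) UNIV"
    unfolding eval_l1_def by (rule has_sum_infsum[OF abs_summable_summable])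
  have "\<bar>eval_l1 \<xi> a\<bar> \<le> (\<Sum>\<^sub>\<infinity>k. \<bar>coef a k * \<xi> k\<bar>)"
    using norm_infsum_bound[OF s] by (simp add: eval_l1_def)
  also have "\<dots> \<le> norm a" unfolding norm_l1_def
    using s by (intro infsum_mono coef_abs_summable le) simp
  finally show "\<bar>eval_l1 \<xi> a\<bar> \<le> norm a" .
qed

lemma eval_l1_bounded_linear:
  assumes "\<And>k. \<bar>\<xi> k\<bar> \<le> 1"
  shows "bounded_linear (eval_l1 \<xi>)"
proof (rule bounded_linear_intro[where K = 1])
  have hs: "((\<lambda>k. coef a k * \<xi> k) has_sum eval_l1 \<xi> a) UNIV" for a
    using assms by (rule eval_l1_has_sum(1))
  show "eval_l1 \<xi> (a + b) = eval_l1 \<xi> a + eval_l1 \<xi> b" for a b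
    using has_sum_add[OF hs[of a] hs[of b]]
    by (subst eval_l1_def) (simp add: infsumI algebra_simps)
  show "eval_l1 \<xi> (r *\<^sub>R a) = r *\<^sub>R eval_l1 \<xi> a" for a r
    using has_sum_cmult_right[OF hs[of a], of r]
    by (subst eval_l1_def) (simp add: infsumI algebra_simps)
  show "norm (eval_l1 \<xi> a) \<le> norm a * 1" for a
    using eval_l1_has_sum(2)[of \<xi> a, OF assms] by simp
qed

lemma eval_l1_single [simp]: "eval_l1 \<xi> (single k) = \<xi> k"
  unfolding eval_l1_def by (rule infsumI, rule has_sum_finite_neutralI[of "{k}"]) auto

lemma eval_l1_conv:
  assumes "character \<xi>"
  shows "eval_l1 \<xi> (conv a b) = eval_l1 \<xi> a * eval_l1 \<xi> b"
proof -
  have \<xi>: "\<And>k. \<bar>\<xi> k\<bar> \<le> 1" "\<And>k l. \<xi> (k + l) = \<xi> k * \<xi> l"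
    using assms by (auto simp: character_def)
  have "((\<lambda>k. \<Sum>\<^sub>\<infinity>(i, j)\<in>{(i, j). i + j = k}. (coef a i * \<xi> i) * (coef b j * \<xi> j))
      has_sum eval_l1 \<xi> a * eval_l1 \<xi> b) UNIV"
    by (intro has_sum_regroup has_sum_real_product eval_l1_has_sum \<xi>)
  moreover have "(\<Sum>\<^sub>\<infinity>(i, j)\<in>{(i, j). i + j = k}. (coef a i * \<xi> i) * (coef b j * \<xi> j))
      = coef (conv a b) k * \<xi> k" for k
    unfolding coef_conv
    by (subst infsum_cmult_left'[symmetric], intro infsum_cong) (auto simp: \<xi> algebra_simps)
  ultimately show ?thesis by (simp add: eval_l1_def infsumI)
qed

section \<open>The equation for the coefficients\<close>

lemma wpull_diff:
  assumes "\<And>k. \<bar>w k\<bar> \<le> c" and "inj_on f {k. w k \<noteq> 0}"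
  shows "wpull w f (a - b) = wpull w f a - wpull w f b"
  by (rule l1_eqI) (simp add: coef_wpull[OF assms] algebra_simps)

text \<open>
  The index \<open>(i, j)\<close> stands for \<open>z (x / 16)\<^sup>i (z\<^sup>2 / 256)\<^sup>j\<close>, a function of degree \<open>d = i + 2 j + 1\<close>; \<open>eig\<close>
  is \<open>d (d + 1)\<close> and \<open>lap\<close> is the Laplacian of the sphere. The value \<open>6\<close> of \<open>eig\<close> occurs at \<open>(1, 0)\<close> only.
\<close>

definition eig :: "nat \<times> nat \<Rightarrow> real" where
  "eig = (\<lambda>(i, j). real (i + 2 * j + 1) * real (i + 2 * j + 2))"

definition lap :: "(nat \<times> nat \<Rightarrow> real) \<Rightarrow> nat \<times> nat \<Rightarrow> real" where
  "lap a = (\<lambda>(i, j). (real ((i + 2) * (i + 1)) * a (i + 2, j)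
     + real ((2 * j + 3) * (2 * j + 2)) * a (i, j + 1)) / 256 - eig (i, j) * a (i, j))"

text \<open>The negative inverse of the diagonal of \<Delta> + 6. The value 0 at (1, 0) normalises
  the fixed point to have no component along the kernel.\<close>

definition inv_weight :: "nat \<times> nat \<Rightarrow> real" where
  "inv_weight k = (if k = (1, 0) then 0 else 1 / (eig k - 6))"

definition inv_op :: "(nat \<times> nat) l1 \<Rightarrow> (nat \<times> nat) l1" where
  "inv_op = wpull inv_weight (\<lambda>k. k)"

text \<open>On homogeneous polynomials of degree d the spherical Laplacian is the Euclidean one
  minus d (d + 1). \<open>lower_x\<close> and \<open>lower_z\<close> are the second derivatives in x
  and in z, divided by the shifted diagonal; each lowers the degree by two and so gains 16^-2 = 1 /
  256.\<close>

definition lower_x :: "(nat \<times> nat) l1 \<Rightarrow> (nat \<times> nat) l1" where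
  "lower_x = wpull (\<lambda>(i, j). real ((i + 2) * (i + 1)) / 256 * inv_weight (i, j)) (\<lambda>(i, j). (i + 2, j))"

definition lower_z :: "(nat \<times> nat) l1 \<Rightarrow> (nat \<times> nat) l1" where
  "lower_z = wpull (\<lambda>(i, j). real ((2 * j + 3) * (2 * j + 2)) / 256 * inv_weight (i, j)) (\<lambda>(i, j). (i, j + 1))"

text \<open>Multiplication by z^2 / 256, which is why the equation contains it with the factor
  256.\<close>

definition shift :: "(nat \<times> nat) l1 \<Rightarrow> (nat \<times> nat) l1" where
  "shift = wpull (\<lambda>(i, j). if j = 0 then 0 else 1) (\<lambda>(i, j). (i, j - 1))"

text \<open>The degree d is 1 or at least 3, since i + 2 j = 1 happens at (1, 0) only. For d >= 3
  put D = d (d + 1) >= 12: the two numerators are at most D and 2 D, and D / (D - 6) <= 2.\<close>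

lemma eig_bounds:
  fixes i j :: nat
  assumes "(i, j) \<noteq> (1, 0)"
  shows "\<bar>inv_weight (i, j)\<bar> \<le> 1 / 4"
    and "\<bar>real ((i + 2) * (i + 1)) / 256 * inv_weight (i, j)\<bar> \<le> 1 / 32"
    and "\<bar>real ((2 * j + 3) * (2 * j + 2)) / 256 * inv_weight (i, j)\<bar> \<le> 1 / 32"
proof -
  define d where "d = i + 2 * j + 1"
  have w: "inv_weight (i, j) = 1 / (real (d * (d + 1)) - 6)"
    using assms by (simp add: inv_weight_def eig_def d_def algebra_simps)
  have "d = 1 \<or> d \<ge> 3"
  proof -
    have "d \<noteq> 2" using assms by (cases j) (auto simp: d_def)
    then show ?thesis by (auto simp: d_def)
  qed
  then have "\<bar>inv_weight (i, j)\<bar> \<le> 1 / 4 \<and> \<bar>real ((i + 2) * (i + 1)) / 256 * inv_weight (i, j)\<bar> \<le> 1 / 32 \<and>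
    \<bar>real ((2 * j + 3) * (2 * j + 2)) / 256 * inv_weight (i, j)\<bar> \<le> 1 / 32"
  proof
    assume "d = 1"
    then have "i = 0" "j = 0" by (auto simp: d_def)
    moreover have "inv_weight (i, j) = - 1 / 4" using \<open>d = 1\<close> by (simp add: w)
    ultimately show ?thesis by simp
  next
    assume d: "d \<ge> 3"
    define D where "D = real (d * (d + 1))"
    have "3 * (3 + 1) \<le> d * (d + 1)" using d by (intro mult_mono) auto
    then have "real (3 * (3 + 1)) \<le> D" unfolding D_def by (rule of_nat_mono)
    then have D: "D \<ge> 12" by simp
    have "(i + 2) * (i + 1) \<le> (d + 1) * d" by (intro mult_mono) (auto simp: d_def)
    then have i: "real ((i + 2) * (i + 1)) \<le> D" unfolding D_def by (metis mult.commute of_nat_mono)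
    have "(2 * j + 3) * (2 * j + 2) \<le> (d + 2) * (d + 1)" by (intro mult_mono) (auto simp: d_def)
    also have "\<dots> \<le> (2 * d) * (d + 1)" using d by (intro mult_right_mono) auto
    also have "\<dots> = 2 * (d * (d + 1))" by simp
    finally have j: "real ((2 * j + 3) * (2 * j + 2)) \<le> 2 * D"
      unfolding D_def by (metis of_nat_mono of_nat_mult of_nat_numeral)
    have w': "inv_weight (i, j) = 1 / (D - 6)" by (simp add: w D_def)
    show ?thesis unfolding w' using D i j by (simp add: abs_mult divide_simps)
  qed
  then show "\<bar>inv_weight (i, j)\<bar> \<le> 1 / 4" "\<bar>real ((i + 2) * (i + 1)) / 256 * inv_weight (i, j)\<bar> \<le> 1 / 32"
    "\<bar>real ((2 * j + 3) * (2 * j + 2)) / 256 * inv_weight (i, j)\<bar> \<le> 1 / 32" by auto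
qed

lemma eig_ne_6: "(i, j) \<noteq> (1, 0) \<Longrightarrow> eig (i, j) \<noteq> 6"
proof
  assume a: "(i, j) \<noteq> (1, 0)" "eig (i, j) = 6"
  have "real ((i + 2 * j + 1) * (i + 2 * j + 2)) = real 6"
    using a(2) by (simp only: eig_def of_nat_mult prod.case)
  then have e: "(i + 2 * j + 1) * (i + 2 * j + 2) = 6" by (simp only: of_nat_eq_iff)
  consider "i + 2 * j = 0" | "i + 2 * j = 1" | "i + 2 * j \<ge> 2" by linarith
  then show False
  proof cases
    case 1
    with e show False by simp
  next
    case 2
    then have "i = 1 \<and> j = 0" by presburger
    with a(1) show False by simp
  next
    case 3
    then have "(2 + 1) * (2 + 2) \<le> (i + 2 * j + 1) * (i + 2 * j + 2)" by (intro mult_mono) auto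
    with e show False by simp
  qed
qed

lemma inv_op:
  shows coef_inv_op: "coef (inv_op a) k = inv_weight k * coef a k"
    and norm_inv_op: "norm (inv_op a) \<le> 1 / 4 * norm a"
    and inv_op_diff: "inv_op (a - b) = inv_op a - inv_op b"
proof -
  have "\<bar>inv_weight k\<bar> \<le> 1 / 4" for k
    using eig_bounds(1)[of "fst k" "snd k"] by (cases "k = (1, 0)") (auto simp: inv_weight_def)
  note * = wpull[where w = inv_weight, OF this, of "\<lambda>k. k", simplified]
    wpull_diff[where w = inv_weight, OF this, of "\<lambda>k. k", simplified]
  show "coef (inv_op a) k = inv_weight k * coef a k" "norm (inv_op a) \<le> 1 / 4 * norm a" "inv_op (a - b) = inv_op a - inv_op b"
    using * by (simp_all add: inv_op_def)
qed

lemma lower_x: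
  shows coef_lower_x: "coef (lower_x a) (i, j) = real ((i + 2) * (i + 1)) / 256 * inv_weight (i, j) * coef a (i + 2, j)"
    and norm_lower_x: "norm (lower_x a) \<le> 1 / 32 * norm a"
    and lower_x_diff: "lower_x (a - b) = lower_x a - lower_x b"
proof -
  let ?w = "\<lambda>(i, j). real ((i + 2) * (i + 1)) / 256 * inv_weight (i, j)"
  have b: "\<bar>?w k\<bar> \<le> 1 / 32" for k
  proof (cases "k = (1, 0)")
    case False
    then show ?thesis using eig_bounds(2)[of "fst k" "snd k"] by (simp add: case_prod_unfold)
  qed (simp add: inv_weight_def)
  have i: "inj_on (\<lambda>(i, j). (i + 2, j)) {k. ?w k \<noteq> 0}" by (auto simp: inj_on_def)
  show "coef (lower_x a) (i, j) = real ((i + 2) * (i + 1)) / 256 * inv_weight (i, j) * coef a (i + 2, j)"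
    unfolding lower_x_def by (subst coef_wpull[OF b i]) simp
  show "norm (lower_x a) \<le> 1 / 32 * norm a" unfolding lower_x_def by (rule norm_wpull[OF b i])
  show "lower_x (a - b) = lower_x a - lower_x b" unfolding lower_x_def by (rule wpull_diff[OF b i])
qed

lemma lower_z:
  shows coef_lower_z: "coef (lower_z a) (i, j) = real ((2 * j + 3) * (2 * j + 2)) / 256 * inv_weight (i, j) * coef a (i, j + 1)"
    and norm_lower_z: "norm (lower_z a) \<le> 1 / 32 * norm a"
    and lower_z_diff: "lower_z (a - b) = lower_z a - lower_z b"
proof -
  let ?w = "\<lambda>(i, j). real ((2 * j + 3) * (2 * j + 2)) / 256 * inv_weight (i, j)"
  have b: "\<bar>?w k\<bar> \<le> 1 / 32" for k
  proof (cases "k = (1, 0)")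
    case False
    then show ?thesis using eig_bounds(3)[of "fst k" "snd k"] by (simp add: case_prod_unfold)
  qed (simp add: inv_weight_def)
  have i: "inj_on (\<lambda>(i, j). (i, j + 1)) {k. ?w k \<noteq> 0}" by (auto simp: inj_on_def)
  show "coef (lower_z a) (i, j) = real ((2 * j + 3) * (2 * j + 2)) / 256 * inv_weight (i, j) * coef a (i, j + 1)"
    unfolding lower_z_def by (subst coef_wpull[OF b i]) simp
  show "norm (lower_z a) \<le> 1 / 32 * norm a" unfolding lower_z_def by (rule norm_wpull[OF b i])
  show "lower_z (a - b) = lower_z a - lower_z b" unfolding lower_z_def by (rule wpull_diff[OF b i])
qed

lemma shift:
  shows coef_shift: "coef (shift a) (i, j) = (if j = 0 then 0 else coef a (i, j - 1))"
    and norm_shift: "norm (shift a) \<le> norm a"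
    and shift_diff: "shift (a - b) = shift a - shift b"
proof -
  let ?w = "\<lambda>(i::nat, j::nat). if j = 0 then 0 else 1 :: real"
  have b: "\<bar>?w k\<bar> \<le> 1" for k by (cases k) simp
  have i: "inj_on (\<lambda>(i, j). (i, j - 1)) {k. ?w k \<noteq> 0}" by (auto simp: inj_on_def)
  show "coef (shift a) (i, j) = (if j = 0 then 0 else coef a (i, j - 1))"
    unfolding shift_def by (subst coef_wpull[OF b i]) simp
  show "norm (shift a) \<le> norm a" unfolding shift_def using norm_wpull[OF b i] by simp
  show "shift (a - b) = shift a - shift b" unfolding shift_def by (rule wpull_diff[OF b i])
qed

text \<open>
  \<open>beta\<close> makes the component of the equation at \<open>(1, 0)\<close>, on which \<open>\<Delta> + 6\<close> has no diagonal term, hold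
  at a fixed point. The terms of order \<open>e\<close> in \<open>profile_of\<close> are the explicit solution of
  \<open>(\<Delta> + 6) w = z\<^sup>3 + \<beta> z\<close>; splitting them off is what makes \<open>fixmap\<close> a contraction.
\<close>

definition beta :: "(nat \<times> nat) l1 \<Rightarrow> real" where
  "beta V = 3 / 2048 * (coef V (3, 0) + coef V (1, 1))"

definition profile_of :: "real \<Rightarrow> (nat \<times> nat) l1 \<Rightarrow> (nat \<times> nat) l1" where
  "profile_of e V = 16 *\<^sub>R single (1, 0)
     + e *\<^sub>R (((beta V + 1) / 4) *\<^sub>R single (0, 0) - (128 / 3) *\<^sub>R single (0, 1)) + e\<^sup>2 *\<^sub>R V"

text \<open>Chosen so that (1 + e Y)^3 = 1 + e \<open>cubic e Y\<close>, which separates the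
  explicit z^3 in s^3 from the part that depends on Y.\<close>

definition cubic :: "real \<Rightarrow> (nat \<times> nat) l1 \<Rightarrow> (nat \<times> nat) l1" where
  "cubic e Y = 3 *\<^sub>R Y + (3 * e) *\<^sub>R conv Y Y + e\<^sup>2 *\<^sub>R conv Y (conv Y Y)"

text \<open>The remaining equation (\<Delta> + 6) V = \<beta> Y + 256
  \<open>shift (cubic e Y)\<close>, with Y the profile of V, solved for its diagonal term.\<close>

definition fixmap :: "real \<Rightarrow> (nat \<times> nat) l1 \<Rightarrow> (nat \<times> nat) l1" where
  "fixmap e V = lower_x V + lower_z V - inv_op (beta V *\<^sub>R profile_of e V + 256 *\<^sub>R shift (cubic e (profile_of e V)))"

lemma beta_bound: "\<bar>beta V\<bar> \<le> 3 / 1024 * norm V"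
  using abs_coef_le_norm[of V "(3, 0)"] abs_coef_le_norm[of V "(1, 1)"]
  unfolding beta_def by (simp add: abs_mult)

lemma beta_diff: "beta V - beta W = beta (V - W)"
  by (simp add: beta_def algebra_simps)

lemma inv_op_single: "inv_op (c *\<^sub>R single (1, 0)) = 0"
  by (rule l1_eqI) (simp add: coef_inv_op inv_weight_def)

section \<open>Contraction estimates and the fixed point\<close>

context
  fixes e :: real
  \<comment> \<open>The threshold is generous: it has to beat the constants 10000 and 156600 that
    accumulate in the estimates.\<close>
  assumes e: "0 < e" "e \<le> 1 / 10 ^ 14"
begin

text \<open>The terms 16 x z / 16 and z^3 do not depend on V, so the profile varies with V only at
  order e. This makes the nonlinear terms of \<open>fixmap\<close> contractive for small e.\<close>

lemma norm_profile_of_diff_le: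
  "norm (profile_of e V - profile_of e W) \<le> 2 * e * norm (V - W)"
proof -
  have eq: "profile_of e V - profile_of e W = (e * (beta (V - W) / 4)) *\<^sub>R single (0, 0) + e\<^sup>2 *\<^sub>R (V - W)"
    by (simp add: profile_of_def beta_diff[symmetric] algebra_simps diff_divide_distrib add_divide_distrib)
  have "norm (profile_of e V - profile_of e W) \<le> e * (\<bar>beta (V - W)\<bar> / 4) + e\<^sup>2 * norm (V - W)"
    unfolding eq by (rule norm_triangle_le) (use e in \<open>simp add: abs_mult\<close>)
  also have "\<dots> \<le> e * norm (V - W) + e * norm (V - W)"
  proof (intro add_mono mult_left_mono mult_right_mono)
    show "\<bar>beta (V - W)\<bar> / 4 \<le> norm (V - W)"
      using beta_bound[of "V - W"] norm_ge_zero[of "V - W"] by linarith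
    show "e\<^sup>2 \<le> e" using e by (simp add: power2_eq_square mult_left_le)
  qed (use e in auto)
  finally show ?thesis by simp
qed

lemma norm_profile_of_minus_le:
  assumes "norm V \<le> 8192"
  shows "norm (profile_of e V - 16 *\<^sub>R single (1, 0)) \<le> 10000 * e"
proof -
  have eq: "profile_of e V - 16 *\<^sub>R single (1, 0)
      = e *\<^sub>R (((beta V + 1) / 4) *\<^sub>R single (0, 0) - (128 / 3) *\<^sub>R single (0, 1) + e *\<^sub>R V)"
    by (simp add: profile_of_def power2_eq_square algebra_simps)
  have "norm (((beta V + 1) / 4) *\<^sub>R single (0, 0) - (128 / 3) *\<^sub>R single (0, 1) + e *\<^sub>R V)
      \<le> \<bar>(beta V + 1) / 4\<bar> + 128 / 3 + e * norm V"
    using e by (intro norm_triangle_le add_mono norm_triangle_le_diff) auto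
  \<comment> \<open>On the ball of radius 8192 the bound \<open>beta_bound\<close> gives 24 for
    \<open>beta V\<close>.\<close>
  also have "\<dots> \<le> 25 / 4 + 128 / 3 + 1 * 8192"
    using beta_bound[of V] assms e by (intro add_mono mult_mono) auto
  finally have "norm (((beta V + 1) / 4) *\<^sub>R single (0, 0) - (128 / 3) *\<^sub>R single (0, 1) + e *\<^sub>R V) \<le> 10000"
    by simp
  with e show ?thesis unfolding eq by simp
qed

lemma norm_profile_of_le:
  assumes "norm V \<le> 8192"
  shows "norm (profile_of e V) \<le> 17"
proof -
  have "norm (profile_of e V) \<le> norm (profile_of e V - 16 *\<^sub>R single (1, 0)) + norm (16 *\<^sub>R single (1::nat, 0::nat))"
    using norm_triangle_ineq[of "profile_of e V - 16 *\<^sub>R single (1, 0)" "16 *\<^sub>R single (1, 0)"] by simp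
  with norm_profile_of_minus_le[OF assms] e show ?thesis by simp
qed

lemma cubic_lipschitz:
  assumes "norm Y \<le> 17" "norm Z \<le> 17"
  shows "norm (cubic e Y - cubic e Z) \<le> 1200 * norm (Y - Z)"
proof -
  let ?D = "norm (Y - Z)"
  \<comment> \<open>34 = 2 * 17 and, below, 867 = 3 * 17^2 are the Lipschitz constants of square and
    cube on the ball of radius 17.\<close>
  have 2: "norm (conv Y Y - conv Z Z) \<le> 34 * ?D"
  proof -
    have eq: "conv Y Y - conv Z Z = conv (Y - Z) Y + conv Z (Y - Z)"
      by (simp add: conv_diff_left conv_diff_right)
    have "norm (conv Y Y - conv Z Z) \<le> norm (conv (Y - Z) Y) + norm (conv Z (Y - Z))"
      unfolding eq by (rule norm_triangle_ineq)
    also have "\<dots> \<le> ?D * norm Y + norm Z * ?D" by (intro add_mono norm_conv)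
    also have "\<dots> \<le> ?D * 17 + 17 * ?D" using assms by (intro add_mono mult_mono) auto
    finally show ?thesis by simp
  qed
  have 3: "norm (conv Y (conv Y Y) - conv Z (conv Z Z)) \<le> 867 * ?D"
  proof -
    have eq: "conv Y (conv Y Y) - conv Z (conv Z Z)
        = conv (Y - Z) (conv Y Y) + conv Z (conv Y Y - conv Z Z)"
      by (simp add: conv_diff_left conv_diff_right)
    have "norm (conv Y (conv Y Y) - conv Z (conv Z Z))
        \<le> norm (conv (Y - Z) (conv Y Y)) + norm (conv Z (conv Y Y - conv Z Z))"
      unfolding eq by (rule norm_triangle_ineq)
    also have "\<dots> \<le> ?D * norm (conv Y Y) + norm Z * norm (conv Y Y - conv Z Z)"
      by (intro add_mono norm_conv)
    also have "\<dots> \<le> ?D * (norm Y * norm Y) + norm Z * (34 * ?D)"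
      by (intro add_mono mult_left_mono norm_conv 2) auto
    also have "\<dots> \<le> ?D * (17 * 17) + 17 * (34 * ?D)"
      using assms by (intro add_mono mult_mono) auto
    finally show ?thesis by simp
  qed
  have eq: "cubic e Y - cubic e Z = 3 *\<^sub>R (Y - Z) + (3 * e) *\<^sub>R (conv Y Y - conv Z Z)
      + e\<^sup>2 *\<^sub>R (conv Y (conv Y Y) - conv Z (conv Z Z))"
    by (simp add: cubic_def algebra_simps)
  have "norm (cubic e Y - cubic e Z) \<le> 3 * ?D + 3 * e * norm (conv Y Y - conv Z Z)
      + e\<^sup>2 * norm (conv Y (conv Y Y) - conv Z (conv Z Z))"
    unfolding eq using e by (intro norm_triangle_le add_mono) auto
  also have "\<dots> \<le> 3 * ?D + 3 * 1 * (34 * ?D) + 1 * (867 * ?D)"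
    using e by (intro add_mono mult_mono 2 3) (auto simp: power_le_one)
  also have "\<dots> \<le> 1200 * ?D" using norm_ge_zero[of "Y - Z"] by linarith
  finally show ?thesis .
qed

lemma fixmap_lipschitz:
  assumes V: "norm V \<le> 8192" and W: "norm W \<le> 8192"
  shows "norm (fixmap e V - fixmap e W) \<le> 1 / 2 * norm (V - W)"
proof -
  let ?X = "16 *\<^sub>R single (1::nat, 0::nat)"
  let ?Y = "profile_of e V" and ?Z = "profile_of e W" and ?D = "norm (V - W)"
  have b: "norm (beta V *\<^sub>R (?Y - ?X) - beta W *\<^sub>R (?Z - ?X)) \<le> 12000 * e * ?D"
  proof -
    have eq: "beta V *\<^sub>R (?Y - ?X) - beta W *\<^sub>R (?Z - ?X)
        = beta (V - W) *\<^sub>R (?Y - ?X) + beta W *\<^sub>R (?Y - ?Z)"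
      by (simp add: beta_diff[symmetric] algebra_simps)
    have "norm (beta V *\<^sub>R (?Y - ?X) - beta W *\<^sub>R (?Z - ?X))
        \<le> \<bar>beta (V - W)\<bar> * norm (?Y - ?X) + \<bar>beta W\<bar> * norm (?Y - ?Z)"
      unfolding eq by (rule norm_triangle_le) simp
    also have "\<dots> \<le> ?D * (10000 * e) + 24 * (2 * e * ?D)"
    proof (intro add_mono mult_mono norm_profile_of_diff_le norm_profile_of_minus_le V)
      show "\<bar>beta (V - W)\<bar> \<le> ?D"
        using beta_bound[of "V - W"] norm_ge_zero[of "V - W"] by linarith
      show "\<bar>beta W\<bar> \<le> 24" using beta_bound[of W] W by linarith
    qed auto
    also have "\<dots> \<le> 12000 * e * ?D" using e by simp
    finally show ?thesis .
  qed
  have c: "norm (cubic e ?Y - cubic e ?Z) \<le> 2400 * e * ?D"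
    using cubic_lipschitz[OF norm_profile_of_le[OF V] norm_profile_of_le[OF W]] norm_profile_of_diff_le[of V W] by linarith
  \<comment> \<open>\<open>beta\<close> is not small, but the leading term of the profile is a
    multiple of the kernel element and is annihilated by \<open>inv_op\<close>. After subtracting
    it, \<open>beta\<close> multiplies only a remainder of order e.\<close>
  have X': "inv_op (beta U *\<^sub>R profile_of e U + G) = inv_op (beta U *\<^sub>R (profile_of e U - ?X) + G)" for U G
  proof -
    have "inv_op (beta U *\<^sub>R (profile_of e U - ?X) + G) = inv_op (beta U *\<^sub>R profile_of e U + G - (beta U * 16) *\<^sub>R single (1, 0))"
      by (simp add: algebra_simps)
    then show ?thesis by (simp only: inv_op_diff inv_op_single diff_zero)
  qed
  have eq: "fixmap e V - fixmap e W = lower_x (V - W) + lower_z (V - W)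
      - inv_op ((beta V *\<^sub>R (?Y - ?X) - beta W *\<^sub>R (?Z - ?X)) + 256 *\<^sub>R shift (cubic e ?Y - cubic e ?Z))"
    unfolding fixmap_def X' lower_x_diff lower_z_diff shift_diff
    using inv_op_diff[of "beta V *\<^sub>R (?Y - ?X) + 256 *\<^sub>R shift (cubic e ?Y)" "beta W *\<^sub>R (?Z - ?X) + 256 *\<^sub>R shift (cubic e ?Z)"]
    by (simp add: algebra_simps)
  have g: "norm ((beta V *\<^sub>R (?Y - ?X) - beta W *\<^sub>R (?Z - ?X)) + 256 *\<^sub>R shift (cubic e ?Y - cubic e ?Z))
      \<le> 12000 * e * ?D + 256 * (2400 * e * ?D)"
    using norm_shift[of "cubic e ?Y - cubic e ?Z"] c by (intro norm_triangle_le add_mono b) simp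
  have "norm (fixmap e V - fixmap e W) \<le> 1 / 32 * ?D + 1 / 32 * ?D
     + 1 / 4 * (12000 * e * ?D + 256 * (2400 * e * ?D))"
    unfolding eq
    by (rule norm_triangle_le_diff, intro add_mono norm_triangle_le norm_lower_x norm_lower_z)
      (use norm_inv_op g order_trans in fastforce)
  also have "\<dots> = (1 / 16 + 156600 * e) * ?D" by (simp add: algebra_simps)
  also have "\<dots> \<le> 1 / 2 * ?D" using e by (intro mult_right_mono) auto
  finally show ?thesis .
qed

text \<open>Together with the contraction factor 1 / 2 this bound makes the ball of radius 2 * 4096
  = 8192 invariant.\<close>

lemma norm_fixmap_zero: "norm (fixmap e 0) \<le> 4096"
proof -
  let ?Y = "profile_of e 0"
  have Y: "norm ?Y \<le> 17" by (rule norm_profile_of_le) simp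
  have 2: "norm (conv ?Y ?Y) \<le> 17 * 17"
    using norm_conv[of ?Y ?Y] mult_mono[OF Y Y] by simp
  have 3: "norm (conv ?Y (conv ?Y ?Y)) \<le> 17 * (17 * 17)"
    using norm_conv[of ?Y "conv ?Y ?Y"] mult_mono[OF Y 2] by simp
  have "norm (cubic e ?Y) \<le> 3 * norm ?Y + 3 * e * norm (conv ?Y ?Y) + e\<^sup>2 * norm (conv ?Y (conv ?Y ?Y))"
    unfolding cubic_def using e by (intro norm_triangle_le add_mono) auto
  also have "\<dots> \<le> 3 * 17 + 3 * (1 / 10 ^ 14) * (17 * 17) + (1 / 10 ^ 14)\<^sup>2 * (17 * (17 * 17))"
    using e by (intro add_mono mult_mono Y 2 3 power_mono) auto
  also have "\<dots> \<le> 60" by (simp add: power2_eq_square)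
  finally have c: "norm (cubic e ?Y) \<le> 60" .
  have z: "lower_x 0 = 0" "lower_z 0 = 0" "beta 0 = 0"
    using norm_lower_x[of 0] norm_lower_z[of 0] by (auto simp: beta_def)
  have "norm (fixmap e 0) \<le> 1 / 4 * (256 * norm (shift (cubic e ?Y)))"
    unfolding fixmap_def z using norm_inv_op[of "256 *\<^sub>R shift (cubic e ?Y)"] by simp
  also have "\<dots> \<le> 1 / 4 * (256 * 60)"
    using norm_shift[of "cubic e ?Y"] c by simp
  finally show ?thesis by simp
qed

lemma fixmap_fixed_point: "\<exists>V. norm V \<le> 8192 \<and> fixmap e V = V"
proof -
  have "\<exists>!V. V \<in> cball 0 8192 \<and> fixmap e V = V"
  proof (rule Banach_fix)
    show "complete (cball 0 8192 :: (nat \<times> nat) l1 set)" by (simp add: complete_eq_closed)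
    show "cball 0 8192 \<noteq> ({} :: (nat \<times> nat) l1 set)" by simp
    show "fixmap e ` cball 0 8192 \<subseteq> cball 0 8192"
    proof safe
      fix V :: "(nat \<times> nat) l1" assume "V \<in> cball 0 8192"
      then have V: "norm V \<le> 8192" by simp
      have "norm (fixmap e V) \<le> norm (fixmap e V - fixmap e 0) + norm (fixmap e 0)"
        using norm_triangle_ineq[of "fixmap e V - fixmap e 0" "fixmap e 0"] by simp
      also have "\<dots> \<le> 1 / 2 * norm (V - 0) + 4096"
        by (intro add_mono fixmap_lipschitz norm_fixmap_zero V) simp
      finally show "fixmap e V \<in> cball 0 8192" using V by simp
    qed
    show "dist (fixmap e V) (fixmap e W) \<le> 1 / 2 * dist V W"
      if "V \<in> cball 0 8192" "W \<in> cball 0 8192" for V W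
      using fixmap_lipschitz[of V W] that by (simp add: dist_norm)
  qed auto
  then show ?thesis by auto
qed

lemma wave_coeffs:
  "\<exists>Y \<beta>. norm Y \<le> 17 \<and> coef Y (1, 0) = 16 \<and>
     (\<forall>k. lap (coef Y) k + 6 * coef Y k
        = e * coef (\<beta> *\<^sub>R (single (0, 0) + e *\<^sub>R Y)
            + 256 *\<^sub>R shift (single (0, 0) + e *\<^sub>R cubic e Y)) k)"
proof -
  obtain V where V: "norm V \<le> 8192" "fixmap e V = V" using fixmap_fixed_point by blast
  define Y where "Y = profile_of e V"
  define G where "G = beta V *\<^sub>R Y + 256 *\<^sub>R shift (cubic e Y)"
  have VG: "coef V k = coef (lower_x V) k + coef (lower_z V) k - inv_weight k * coef G k" for k
    using V(2) coef_inv_op[of G k] by (metis G_def fixmap_def Y_def minus_l1.rep_eq plus_l1.rep_eq)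
  have V10: "coef V (1, 0) = 0"
    by (subst VG) (simp add: coef_lower_x coef_lower_z inv_weight_def)
  have Y10: "coef Y (1, 0) = 16" using V10 by (simp add: Y_def profile_of_def)
  have G10: "coef G (1, 0) = 16 * beta V" by (simp add: G_def coef_shift Y10[simplified])
  have lapV: "lap (coef V) (i, j) + 6 * coef V (i, j) = coef G (i, j)" for i j
  proof (cases "(i, j) = (1, 0)")
    case True
    \<comment> \<open>At (1, 0) the diagonal terms cancel. What is left is 6 / 256 times V(3, 0) +
      V(1, 1) on one side and 16 \<beta> on the other; this is the origin of 3 / 2048 = 6 / (256 *
      16) in \<open>beta\<close>.\<close>
    then show ?thesis using V10 G10 by (auto simp: lap_def eig_def beta_def numeral_3_eq_3)
  next
    case False
    have ne: "eig (i, j) - 6 \<noteq> 0" using eig_ne_6[OF False] by simp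
    have w: "inv_weight (i, j) = 1 / (eig (i, j) - 6)" using False by (auto simp: inv_weight_def)
    define A B where "A = real ((i + 2) * (i + 1))" and "B = real ((2 * j + 3) * (2 * j + 2))"
    have "coef V (i, j) = A / 256 * inv_weight (i, j) * coef V (i + 2, j)
        + B / 256 * inv_weight (i, j) * coef V (i, j + 1) - inv_weight (i, j) * coef G (i, j)"
      unfolding A_def B_def by (subst VG) (simp only: coef_lower_x coef_lower_z)
    also have "\<dots> = (A / 256 * coef V (i + 2, j) + B / 256 * coef V (i, j + 1) - coef G (i, j))
        / (eig (i, j) - 6)"
      by (simp add: w diff_divide_distrib add_divide_distrib)
    finally have "coef V (i, j) * (eig (i, j) - 6)
        = A / 256 * coef V (i + 2, j) + B / 256 * coef V (i, j + 1) - coef G (i, j)"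
      using ne by (simp add: eq_divide_eq)
    then show ?thesis unfolding lap_def A_def B_def by (simp add: algebra_simps add_divide_distrib)
  qed
  \<comment> \<open>\<Delta> + 6 annihilates x z and maps the explicit terms of order e to \<beta> z
    + z^3, because (\<Delta> + 6) z = 4 z and (\<Delta> + 6) z^3 = 6 z - 6 z^3. The power z^3 is 256
    times the monomial of index (0, 1).\<close>
  have main: "lap (coef Y) (i, j) + 6 * coef Y (i, j)
      = e * (if (i, j) = (0, 0) then beta V else 0) + e * (if (i, j) = (0, 1) then 256 else 0)
        + e\<^sup>2 * (lap (coef V) (i, j) + 6 * coef V (i, j))" for i j
    unfolding Y_def profile_of_def lap_def eig_def
    by (auto simp: algebra_simps add_divide_distrib diff_divide_distrib)
  have "lap (coef Y) (i, j) + 6 * coef Y (i, j)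
      = e * coef (beta V *\<^sub>R (single (0, 0) + e *\<^sub>R Y)
          + 256 *\<^sub>R shift (single (0, 0) + e *\<^sub>R cubic e Y)) (i, j)" for i j
    unfolding main lapV G_def by (auto simp: coef_shift algebra_simps power2_eq_square)
  moreover have "norm Y \<le> 17" unfolding Y_def by (rule norm_profile_of_le[OF V(1)])
  ultimately show ?thesis using Y10 by (intro exI[of _ Y] exI[of _ "beta V"]) auto
qed

end

section \<open>Power series in two variables\<close>

definition powser2 :: "(nat \<times> nat \<Rightarrow> real) \<Rightarrow> real \<Rightarrow> real \<Rightarrow> real" where
  "powser2 a p q = (\<Sum>\<^sub>\<infinity>(i, j). a (i, j) * p ^ i * q ^ j)"

text \<open>Summability of the coefficients is lost under differentiation. Polynomial growth is
  implied by it, is preserved by \<open>deriv_p\<close> and \<open>deriv_q\<close>, and still gives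
  absolute convergence for arguments up to 1 / 2, where x / 16 and z^2 / 256 lie.\<close>

definition polygrowth :: "(nat \<times> nat \<Rightarrow> real) \<Rightarrow> bool" where
  "polygrowth a \<longleftrightarrow> (\<exists>C m. \<forall>i j. \<bar>a (i, j)\<bar> \<le> C * (real (i + 1) * real (j + 1)) ^ m)"

definition deriv_p :: "(nat \<times> nat \<Rightarrow> real) \<Rightarrow> nat \<times> nat \<Rightarrow> real" where
  "deriv_p a = (\<lambda>(i, j). real (i + 1) * a (i + 1, j))"

definition deriv_q :: "(nat \<times> nat \<Rightarrow> real) \<Rightarrow> nat \<times> nat \<Rightarrow> real" where
  "deriv_q a = (\<lambda>(i, j). real (j + 1) * a (i, j + 1))"

lemma polygrowthI: "(\<And>i j. \<bar>a (i, j)\<bar> \<le> C * (real (i + 1) * real (j + 1)) ^ m) \<Longrightarrow> polygrowth a"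
  unfolding polygrowth_def by blast

lemma polygrowthE:
  assumes "polygrowth a"
  obtains C m where "C \<ge> 0" "\<And>i j. \<bar>a (i, j)\<bar> \<le> C * (real (i + 1) * real (j + 1)) ^ m"
proof -
  obtain C m where *: "\<And>i j. \<bar>a (i, j)\<bar> \<le> C * (real (i + 1) * real (j + 1)) ^ m"
    using assms unfolding polygrowth_def by blast
  have "C \<ge> 0" using *[of 0 0] by simp
  with * show thesis using that by blast
qed

lemma polygrowth_coef: "polygrowth (coef a)"
  by (rule polygrowthI[of _ "norm a" 0]) (simp add: abs_coef_le_norm)

lemma polygrowth_mult:
  assumes "polygrowth a" "\<And>i j. \<bar>w (i, j)\<bar> \<le> (real (i + 1) * real (j + 1)) ^ n"
  shows "polygrowth (\<lambda>k. w k * a k)"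
proof -
  obtain C m where C: "C \<ge> 0" "\<And>i j. \<bar>a (i, j)\<bar> \<le> C * (real (i + 1) * real (j + 1)) ^ m"
    using polygrowthE[OF assms(1)] by metis
  show ?thesis
  proof (rule polygrowthI[of _ C "n + m"])
    fix i j
    have "\<bar>w (i, j)\<bar> * \<bar>a (i, j)\<bar>
      \<le> (real (i + 1) * real (j + 1)) ^ n * (C * (real (i + 1) * real (j + 1)) ^ m)"
      by (intro mult_mono assms C) auto
    then show "\<bar>w (i, j) * a (i, j)\<bar> \<le> C * (real (i + 1) * real (j + 1)) ^ (n + m)"
      by (simp add: abs_mult power_add algebra_simps)
  qed
qed

lemma polygrowth_shift_i: "polygrowth a \<Longrightarrow> polygrowth (\<lambda>(i, j). a (i + 1, j))"
  and polygrowth_shift_j: "polygrowth a \<Longrightarrow> polygrowth (\<lambda>(i, j). a (i, j + 1))"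
proof -
  assume "polygrowth a"
  then obtain C m where C: "C \<ge> 0" "\<And>i j. \<bar>a (i, j)\<bar> \<le> C * (real (i + 1) * real (j + 1)) ^ m"
    using polygrowthE by blast
  have *: "C * (x * y) ^ m \<le> C * 2 ^ m * (x' * y') ^ m"
    if "x * y \<le> 2 * (x' * y')" "x \<ge> 0" "y \<ge> 0" for x y x' y' :: real
  proof -
    have "(x * y) ^ m \<le> (2 * (x' * y')) ^ m" by (rule power_mono) (use that in auto)
    from mult_left_mono[OF this C(1)] show ?thesis by (simp add: power_mult_distrib)
  qed
  show "polygrowth (\<lambda>(i, j). a (i + 1, j))"
    by (rule polygrowthI[of _ "C * 2 ^ m" m], simp, rule order_trans, rule C(2)[of "Suc _", simplified])
      (rule *, auto simp: algebra_simps)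
  show "polygrowth (\<lambda>(i, j). a (i, j + 1))"
    by (rule polygrowthI[of _ "C * 2 ^ m" m], simp, rule order_trans, rule C(2)[of _ "Suc _", simplified])
      (rule *, auto simp: algebra_simps)
qed

lemma polygrowth_deriv_p: "polygrowth a \<Longrightarrow> polygrowth (deriv_p a)"
  using polygrowth_mult[OF polygrowth_shift_i, of a "\<lambda>(i, j). real (i + 1)" 1]
  by (simp add: deriv_p_def case_prod_unfold)

lemma polygrowth_deriv_q: "polygrowth a \<Longrightarrow> polygrowth (deriv_q a)"
  using polygrowth_mult[OF polygrowth_shift_j, of a "\<lambda>(i, j). real (j + 1)" 1]
  by (simp add: deriv_q_def case_prod_unfold)

lemma summable_poly_geometric: "summable (\<lambda>i. real (i + 1) ^ m * (1 / 2) ^ i)"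
proof (rule summable_comparison_test_bigo)
  show "summable (\<lambda>n. norm ((3 / 4 :: real) ^ n))" by simp
  show "(\<lambda>i. real (i + 1) ^ m * (1 / 2) ^ i) \<in> O(\<lambda>n. (3 / 4 :: real) ^ n)"
    by real_asymp
qed

lemma polygrowth_summable:
  assumes "polygrowth a"
  shows "(\<lambda>(i, j). \<bar>a (i, j)\<bar> * (1 / 2) ^ i * (1 / 2) ^ j) summable_on UNIV"
proof -
  obtain C m where C: "C \<ge> 0" "\<And>i j. \<bar>a (i, j)\<bar> \<le> C * (real (i + 1) * real (j + 1)) ^ m"
    using polygrowthE[OF assms] by metis
  let ?g = "\<lambda>i. real (i + 1) ^ m * (1 / 2) ^ i"
  have "?g summable_on UNIV"
    by (rule norm_summable_imp_summable_on) (use summable_poly_geometric[of m] in simp)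
  then have "(?g has_sum infsum ?g UNIV) UNIV" by simp
  from has_sum_cmult_right[OF has_sum_real_product[OF this this], of C]
  have s: "(\<lambda>(i, j). C * (?g i * ?g j)) summable_on UNIV"
    by (auto simp: summable_on_def case_prod_unfold)
  have "(\<lambda>k. norm (case k of (i, j) \<Rightarrow> \<bar>a (i, j)\<bar> * (1 / 2) ^ i * (1 / 2) ^ j)) summable_on UNIV"
  proof (rule Infinite_Sum.abs_summable_on_comparison_test)
    show "(\<lambda>k. norm (case k of (i, j) \<Rightarrow> C * (?g i * ?g j))) summable_on UNIV"
      using s C(1) by (simp add: case_prod_unfold abs_mult)
    fix k :: "nat \<times> nat"
    obtain i j where k: "k = (i, j)" by (cases k)
    have "\<bar>a (i, j)\<bar> * ((1 / 2) ^ i * (1 / 2) ^ j)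
        \<le> C * (real (i + 1) ^ m * real (j + 1) ^ m) * ((1 / 2) ^ i * (1 / 2) ^ j)"
      by (intro mult_right_mono C(2)[unfolded power_mult_distrib]) auto
    then show "norm (case k of (i, j) \<Rightarrow> \<bar>a (i, j)\<bar> * (1 / 2) ^ i * (1 / 2) ^ j)
        \<le> norm (case k of (i, j) \<Rightarrow> C * (?g i * ?g j))"
      using C(1) by (simp add: k abs_mult mult_ac)
  qed
  then show ?thesis by (rule abs_summable_summable)
qed

lemma powser2_abs_summable:
  assumes "polygrowth a" "\<bar>p\<bar> \<le> 1 / 2" "\<bar>q\<bar> \<le> 1 / 2"
  shows "(\<lambda>k. norm (case k of (i, j) \<Rightarrow> a (i, j) * p ^ i * q ^ j)) summable_on UNIV"
proof (rule Infinite_Sum.abs_summable_on_comparison_test)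
  show "(\<lambda>k. norm (case k of (i, j) \<Rightarrow> \<bar>a (i, j)\<bar> * (1 / 2) ^ i * (1 / 2) ^ j)) summable_on UNIV"
    using polygrowth_summable[OF assms(1)] by (simp add: case_prod_unfold abs_mult)
  show "norm (case k of (i, j) \<Rightarrow> a (i, j) * p ^ i * q ^ j)
      \<le> norm (case k of (i, j) \<Rightarrow> \<bar>a (i, j)\<bar> * (1 / 2) ^ i * (1 / 2) ^ j)" for k
    using assms by (cases k) (auto simp: abs_mult power_abs intro!: mult_mono power_mono)
qed

lemma powser2_has_sum:
  assumes "polygrowth a" "\<bar>p\<bar> \<le> 1 / 2" "\<bar>q\<bar> \<le> 1 / 2"
  shows "((\<lambda>(i, j). a (i, j) * p ^ i * q ^ j) has_sum powser2 a p q) UNIV"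
  unfolding powser2_def by (rule has_sum_infsum, rule abs_summable_summable, rule powser2_abs_summable[OF assms])

lemma infsum_prod_decode:
  fixes f :: "nat \<times> nat \<Rightarrow> real"
  assumes "(\<lambda>k. norm (f k)) summable_on UNIV"
  shows "(\<lambda>n. f (prod_decode n)) sums infsum f UNIV" and "summable (\<lambda>n. norm (f (prod_decode n)))"
proof -
  have "(f has_sum infsum f UNIV) UNIV"
    using abs_summable_summable[OF assms] by simp
  then have "((\<lambda>n. f (prod_decode n)) has_sum infsum f UNIV) UNIV"
    using has_sum_reindex_bij_betw[OF bij_prod_decode, of f] by blast
  then show "(\<lambda>n. f (prod_decode n)) sums infsum f UNIV" by (rule has_sum_imp_sums)
  have "(\<lambda>n. norm (f (prod_decode n))) summable_on UNIV"
    using assms summable_on_reindex_bij_betw[OF bij_prod_decode, of "\<lambda>k. norm (f k)"] by blast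
  then show "summable (\<lambda>n. norm (f (prod_decode n)))" by (rule summable_on_imp_summable)
qed

text \<open>Differentiating along a curve needs only the theorem on series of functions of one
  variable, with pairs enumerated by \<open>prod_decode\<close>. The bounds are global in t, so that
  the convergence is uniform on the whole line.\<close>

lemma powser2_chain_rule:
  assumes a: "polygrowth a"
    and p: "\<And>t. (p has_real_derivative p' t) (at t)" and q: "\<And>t. (q has_real_derivative q' t) (at t)"
    and b: "\<And>t. \<bar>p t\<bar> \<le> 1 / 2" "\<And>t. \<bar>q t\<bar> \<le> 1 / 2" "\<And>t. \<bar>p' t\<bar> \<le> 1" "\<And>t. \<bar>q' t\<bar> \<le> 1"
  shows "((\<lambda>t. powser2 a (p t) (q t)) has_real_derivative
    powser2 (deriv_p a) (p t) (q t) * p' t + powser2 (deriv_q a) (p t) (q t) * q' t) (at t)"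
proof -
  define f where "f k t = (case k of (i, j) \<Rightarrow> a (i, j) * p t ^ i * q t ^ j)" for k t
  define f1 where "f1 k t = (case k of (i, j) \<Rightarrow> a (i, j) * (real i * p t ^ (i - 1)) * q t ^ j)" for k t
  define f2 where "f2 k t = (case k of (i, j) \<Rightarrow> a (i, j) * p t ^ i * (real j * q t ^ (j - 1)))" for k t
  have f1s: "((\<lambda>k. f1 k t) has_sum powser2 (deriv_p a) (p t) (q t)) UNIV" for t
  proof -
    have "((\<lambda>(i, j). deriv_p a (i, j) * p t ^ i * q t ^ j) has_sum powser2 (deriv_p a) (p t) (q t)) UNIV \<longleftrightarrow>
      ((\<lambda>k. f1 k t) has_sum powser2 (deriv_p a) (p t) (q t)) {(i, j). i > 0}"
      by (rule has_sum_reindex_bij_witness[where i = "\<lambda>(i, j). (i - 1, j)" and j = "\<lambda>(i, j). (i + 1, j)"])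
        (auto simp: f1_def deriv_p_def)
    also have "\<dots> \<longleftrightarrow> ((\<lambda>k. f1 k t) has_sum powser2 (deriv_p a) (p t) (q t)) UNIV"
      by (rule has_sum_cong_neutral) (auto simp: f1_def)
    finally show ?thesis using powser2_has_sum[OF polygrowth_deriv_p[OF a] b(1,2)] by blast
  qed
  have f2s: "((\<lambda>k. f2 k t) has_sum powser2 (deriv_q a) (p t) (q t)) UNIV" for t
  proof -
    have "((\<lambda>(i, j). deriv_q a (i, j) * p t ^ i * q t ^ j) has_sum powser2 (deriv_q a) (p t) (q t)) UNIV \<longleftrightarrow>
      ((\<lambda>k. f2 k t) has_sum powser2 (deriv_q a) (p t) (q t)) {(i, j). j > 0}"
      by (rule has_sum_reindex_bij_witness[where i = "\<lambda>(i, j). (i, j - 1)" and j = "\<lambda>(i, j). (i, j + 1)"])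
        (auto simp: f2_def deriv_q_def)
    also have "\<dots> \<longleftrightarrow> ((\<lambda>k. f2 k t) has_sum powser2 (deriv_q a) (p t) (q t)) UNIV"
      by (rule has_sum_cong_neutral) (auto simp: f2_def)
    finally show ?thesis using powser2_has_sum[OF polygrowth_deriv_q[OF a] b(1,2)] by blast
  qed
  \<comment> \<open>The factor 2 pays for the lowered exponent, (1 / 2)^(i - 1) = 2 (1 / 2)^i for i
    > 0.\<close>
  define M where "M = (\<lambda>(i, j). \<bar>2 * (real i + real j) * a (i, j)\<bar> * (1 / 2) ^ i * (1 / 2) ^ j)"
  have "polygrowth (\<lambda>k. (\<lambda>(i, j). 2 * (real i + real j)) k * a k)"
  proof (rule polygrowth_mult[OF a, where n = 2])
    fix i j :: nat
    have "2 * (real i + real j) \<le> (real i + real j + 1)\<^sup>2"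
      by (simp add: power2_eq_square algebra_simps)
    also have "\<dots> \<le> (real (i + 1) * real (j + 1))\<^sup>2"
      by (intro power_mono) (auto simp: algebra_simps)
    finally show "\<bar>case (i, j) of (i, j) \<Rightarrow> 2 * (real i + real j)\<bar> \<le> (real (i + 1) * real (j + 1))\<^sup>2"
      by simp
  qed
  then have M: "M summable_on UNIV"
    using polygrowth_summable[of "\<lambda>(i, j). 2 * (real i + real j) * a (i, j)"]
    by (simp add: M_def case_prod_unfold)
  have bound: "\<bar>f1 k t * p' t + f2 k t * q' t\<bar> \<le> M k" for k t
  proof -
    obtain i j where k: "k = (i, j)" by (cases k)
    have pw: "\<bar>x\<bar> ^ n \<le> (1 / 2) ^ n" if "\<bar>x\<bar> \<le> 1 / 2" for x :: real and n
      using that by (intro power_mono) auto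
    have pw': "real n * \<bar>x\<bar> ^ (n - 1) \<le> real n * (2 * (1 / 2) ^ n)" if "\<bar>x\<bar> \<le> 1 / 2" for x :: real and n
      using pw[OF that, of "n - 1"] by (cases n) auto
    have "\<bar>f1 k t\<bar> \<le> \<bar>a (i, j)\<bar> * (real i * (2 * (1 / 2) ^ i)) * (1 / 2) ^ j"
    proof -
      have "\<bar>f1 k t\<bar> = \<bar>a (i, j)\<bar> * (real i * \<bar>p t\<bar> ^ (i - 1)) * \<bar>q t\<bar> ^ j"
        by (simp add: f1_def k abs_mult power_abs)
      then show ?thesis
        using mult_mono[OF mult_left_mono[OF pw'[OF b(1)]] pw[OF b(2)]] by simp
    qed
    moreover have "\<bar>f2 k t\<bar> \<le> \<bar>a (i, j)\<bar> * (1 / 2) ^ i * (real j * (2 * (1 / 2) ^ j))"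
    proof -
      have "\<bar>f2 k t\<bar> = \<bar>a (i, j)\<bar> * \<bar>p t\<bar> ^ i * (real j * \<bar>q t\<bar> ^ (j - 1))"
        by (simp add: f2_def k abs_mult power_abs)
      then show ?thesis
        using mult_mono[OF mult_left_mono[OF pw[OF b(1)]] pw'[OF b(2)]] by simp
    qed
    moreover have "\<bar>f1 k t * p' t + f2 k t * q' t\<bar> \<le> \<bar>f1 k t\<bar> * 1 + \<bar>f2 k t\<bar> * 1"
      by (rule order_trans[OF abs_triangle_ineq], unfold abs_mult, intro add_mono mult_left_mono b) auto
    moreover have "M k = 2 * (real i + real j) * \<bar>a (i, j)\<bar> * (1 / 2) ^ i * (1 / 2) ^ j"
      by (simp add: M_def k abs_mult)
    ultimately show ?thesis by (simp add: algebra_simps)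
  qed
  have Ms: "summable (\<lambda>n. M (prod_decode n))"
    using infsum_prod_decode(1)[of M] M
    by (auto simp: M_def case_prod_unfold abs_mult sums_iff)
  have fs: "(\<lambda>n. f (prod_decode n) t) sums powser2 a (p t) (q t)" for t
    using infsum_prod_decode(1)[OF powser2_abs_summable[OF a b(1,2)], of t t]
    by (simp add: f_def powser2_def)
  have f's: "(\<lambda>n. f1 (prod_decode n) t * p' t + f2 (prod_decode n) t * q' t)
      sums (powser2 (deriv_p a) (p t) (q t) * p' t + powser2 (deriv_q a) (p t) (q t) * q' t)" for t
  proof (intro sums_add sums_mult2)
    show "(\<lambda>n. f1 (prod_decode n) t) sums powser2 (deriv_p a) (p t) (q t)"
      by (rule has_sum_imp_sums) (use f1s[of t] has_sum_reindex_bij_betw[OF bij_prod_decode, of "\<lambda>k. f1 k t"] in blast)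
    show "(\<lambda>n. f2 (prod_decode n) t) sums powser2 (deriv_q a) (p t) (q t)"
      by (rule has_sum_imp_sums) (use f2s[of t] has_sum_reindex_bij_betw[OF bij_prod_decode, of "\<lambda>k. f2 k t"] in blast)
  qed
  have "((\<lambda>t. \<Sum>n. f (prod_decode n) t) has_field_derivative
      (\<Sum>n. f1 (prod_decode n) t * p' t + f2 (prod_decode n) t * q' t)) (at t)"
  proof (rule has_field_derivative_series'(2)[where S = UNIV and x0 = t])
    show "(f (prod_decode n) has_field_derivative f1 (prod_decode n) x * p' x + f2 (prod_decode n) x * q' x)
        (at x within UNIV)" for n x
    proof -
      obtain i j where k: "prod_decode n = (i, j)" by (cases "prod_decode n")
      show ?thesis unfolding k f_def f1_def f2_def
        by (auto intro!: derivative_eq_intros p q simp: algebra_simps)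
    qed
    show "uniformly_convergent_on UNIV (\<lambda>n x. \<Sum>i<n. f1 (prod_decode i) x * p' x + f2 (prod_decode i) x * q' x)"
      by (rule Weierstrass_m_test'[OF _ Ms]) (use bound in simp)
    show "summable (\<lambda>n. f (prod_decode n) t)" using fs[of t] by (simp add: sums_iff)
  qed auto
  then show ?thesis
    using fs f's by (simp add: sums_iff)
qed

lemma powser2_add:
  assumes "polygrowth a" "polygrowth b" "\<bar>p\<bar> \<le> 1 / 2" "\<bar>q\<bar> \<le> 1 / 2"
  shows "powser2 (\<lambda>k. a k + b k) p q = powser2 a p q + powser2 b p q"
  using has_sum_add[OF powser2_has_sum[OF assms(1,3,4)] powser2_has_sum[OF assms(2,3,4)]]
  by (simp add: powser2_def case_prod_unfold algebra_simps infsumI)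

lemma powser2_cmult: "powser2 (\<lambda>k. c * a k) p q = c * powser2 a p q"
  unfolding powser2_def infsum_cmult_right'[symmetric] by (rule infsum_cong) (auto simp: algebra_simps)

lemma powser2_shift_i:
  "powser2 (\<lambda>(i, j). if i = 0 then 0 else a (i - 1, j)) p q = p * powser2 a p q"
proof -
  have "powser2 (\<lambda>(i, j). if i = 0 then 0 else a (i - 1, j)) p q = (\<Sum>\<^sub>\<infinity>(i, j)\<in>{(i, j). i > 0}. a (i - 1, j) * p ^ i * q ^ j)"
    unfolding powser2_def by (rule infsum_cong_neutral) auto
  also have "\<dots> = (\<Sum>\<^sub>\<infinity>(i, j). p * (a (i, j) * p ^ i * q ^ j))"
    by (rule infsum_reindex_bij_witness[where i = "\<lambda>(i, j). (i + 1, j)" and j = "\<lambda>(i, j). (i - 1, j)"])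
      (auto simp: power_eq_if)
  also have "\<dots> = p * powser2 a p q"
    unfolding powser2_def infsum_cmult_right'[symmetric] by (rule infsum_cong) auto
  finally show ?thesis .
qed

lemma powser2_shift_j:
  "powser2 (\<lambda>(i, j). if j = 0 then 0 else a (i, j - 1)) p q = q * powser2 a p q"
proof -
  have "powser2 (\<lambda>(i, j). if j = 0 then 0 else a (i, j - 1)) p q = (\<Sum>\<^sub>\<infinity>(i, j)\<in>{(i, j). j > 0}. a (i, j - 1) * p ^ i * q ^ j)"
    unfolding powser2_def by (rule infsum_cong_neutral) auto
  also have "\<dots> = (\<Sum>\<^sub>\<infinity>(i, j). q * (a (i, j) * p ^ i * q ^ j))"
    by (rule infsum_reindex_bij_witness[where i = "\<lambda>(i, j). (i, j + 1)" and j = "\<lambda>(i, j). (i, j - 1)"])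
      (auto simp: power_eq_if)
  also have "\<dots> = q * powser2 a p q"
    unfolding powser2_def infsum_cmult_right'[symmetric] by (rule infsum_cong) auto
  finally show ?thesis .
qed

text \<open>Through these Euler operators, factors polynomial in the indices, as in
  \<open>lap\<close>, become differential operators in p and q.\<close>

lemma powser2_euler_p: "powser2 (\<lambda>(i, j). real i * a (i, j)) p q = p * powser2 (deriv_p a) p q"
  unfolding powser2_shift_i[symmetric] by (rule arg_cong[of _ _ "\<lambda>a. powser2 a p q"]) (auto simp: deriv_p_def fun_eq_iff)

lemma powser2_euler_q: "powser2 (\<lambda>(i, j). real j * a (i, j)) p q = q * powser2 (deriv_q a) p q"
  unfolding powser2_shift_j[symmetric] by (rule arg_cong[of _ _ "\<lambda>a. powser2 a p q"]) (auto simp: deriv_q_def fun_eq_iff)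

section \<open>The Laplacian in coordinates\<close>

definition perturb :: "(nat \<times> nat \<Rightarrow> real) \<Rightarrow> S2_fun" where
  "perturb b \<theta> \<phi> = cos \<theta> * powser2 b (sin \<theta> * cos \<phi> / 16) ((cos \<theta>)\<^sup>2 / 256)"

lemma abs_trig_mult_le:
  fixes x y :: real
  shows "\<bar>sin x * cos y\<bar> \<le> 1" "\<bar>cos x * cos y\<bar> \<le> 1" "\<bar>sin x * sin y\<bar> \<le> 1" "\<bar>cos x * sin y\<bar> \<le> 1"
proof -
  have *: "\<bar>u * v\<bar> \<le> 1" if "\<bar>u\<bar> \<le> 1" "\<bar>v\<bar> \<le> 1" for u v :: real
    using mult_mono[OF that] by (simp add: abs_mult)
  show "\<bar>sin x * cos y\<bar> \<le> 1" by (rule *[OF abs_sin_le_one abs_cos_le_one])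
  show "\<bar>cos x * cos y\<bar> \<le> 1" by (rule *[OF abs_cos_le_one abs_cos_le_one])
  show "\<bar>sin x * sin y\<bar> \<le> 1" by (rule *[OF abs_sin_le_one abs_sin_le_one])
  show "\<bar>cos x * sin y\<bar> \<le> 1" by (rule *[OF abs_cos_le_one abs_sin_le_one])
qed

lemma cos_sq_le: "\<bar>(cos x)\<^sup>2\<bar> \<le> (1::real)"
  by (simp add: power_le_one abs_square_le_1)

lemma DERIV_powser2_theta:
  assumes "polygrowth b"
  shows "((\<lambda>\<theta>. powser2 b (sin \<theta> * cos \<phi> / 16) ((cos \<theta>)\<^sup>2 / 256)) has_real_derivative
    powser2 (deriv_p b) (sin \<theta> * cos \<phi> / 16) ((cos \<theta>)\<^sup>2 / 256) * (cos \<theta> * cos \<phi> / 16)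
    + powser2 (deriv_q b) (sin \<theta> * cos \<phi> / 16) ((cos \<theta>)\<^sup>2 / 256) * (- (cos \<theta> * sin \<theta> / 128))) (at \<theta>)"
proof (rule powser2_chain_rule[OF assms])
  show "((\<lambda>\<theta>. sin \<theta> * cos \<phi> / 16) has_real_derivative cos t * cos \<phi> / 16) (at t)" for t
    by (auto intro!: derivative_eq_intros)
  show "((\<lambda>\<theta>. (cos \<theta>)\<^sup>2 / 256) has_real_derivative - (cos t * sin t / 128)) (at t)" for t
    by (auto intro!: derivative_eq_intros)
  fix t
  show "\<bar>sin t * cos \<phi> / 16\<bar> \<le> 1 / 2" "\<bar>cos t * cos \<phi> / 16\<bar> \<le> 1" "\<bar>- (cos t * sin t / 128)\<bar> \<le> 1"
    "\<bar>(cos t)\<^sup>2 / 256\<bar> \<le> 1 / 2"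
    using abs_trig_mult_le(1,2)[of t \<phi>] abs_trig_mult_le(4)[of t t] cos_sq_le[of t] by simp_all
qed

lemma DERIV_powser2_phi:
  assumes "polygrowth b"
  shows "((\<lambda>\<phi>. powser2 b (sin \<theta> * cos \<phi> / 16) ((cos \<theta>)\<^sup>2 / 256)) has_real_derivative
    powser2 (deriv_p b) (sin \<theta> * cos \<phi> / 16) ((cos \<theta>)\<^sup>2 / 256) * (- (sin \<theta> * sin \<phi> / 16))) (at \<phi>)"
proof -
  have "((\<lambda>\<phi>. powser2 b (sin \<theta> * cos \<phi> / 16) ((cos \<theta>)\<^sup>2 / 256)) has_real_derivative
    powser2 (deriv_p b) (sin \<theta> * cos \<phi> / 16) ((cos \<theta>)\<^sup>2 / 256) * (- (sin \<theta> * sin \<phi> / 16))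
    + powser2 (deriv_q b) (sin \<theta> * cos \<phi> / 16) ((cos \<theta>)\<^sup>2 / 256) * 0) (at \<phi>)"
  proof (rule powser2_chain_rule[OF assms])
    show "((\<lambda>\<phi>. sin \<theta> * cos \<phi> / 16) has_real_derivative - (sin \<theta> * sin t / 16)) (at t)" for t
      by (auto intro!: derivative_eq_intros)
    show "((\<lambda>\<phi>. (cos \<theta>)\<^sup>2 / 256) has_real_derivative 0) (at t)" for t by simp
    fix t
    show "\<bar>sin \<theta> * cos t / 16\<bar> \<le> 1 / 2" "\<bar>- (sin \<theta> * sin t / 16)\<bar> \<le> 1" "\<bar>(cos \<theta>)\<^sup>2 / 256\<bar> \<le> 1 / 2"
      using abs_trig_mult_le(1,3)[of \<theta> t] cos_sq_le[of \<theta>] by simp_all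
  qed auto
  then show ?thesis by simp
qed

text \<open>The Laplacian of \<open>z powser2(x / 16, z\<^sup>2 / 256)\<close>, for \<open>x\<close> and \<open>z\<close> restricted to the sphere, in
  terms of the partial derivatives of \<open>powser2\<close>.\<close>

definition lap_powser2 :: "(nat \<times> nat \<Rightarrow> real) \<Rightarrow> real \<Rightarrow> real \<Rightarrow> real" where
  "lap_powser2 b p q = (powser2 (deriv_p (deriv_p b)) p q + 6 * powser2 (deriv_q b) p q + 4 * q * powser2 (deriv_q (deriv_q b)) p q) / 256
     - (p\<^sup>2 * powser2 (deriv_p (deriv_p b)) p q + 4 * p * q * powser2 (deriv_q (deriv_p b)) p q + 4 * q\<^sup>2 * powser2 (deriv_q (deriv_q b)) p q
        + 4 * p * powser2 (deriv_p b) p q + 10 * q * powser2 (deriv_q b) p q + 2 * powser2 b p q)"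

lemma deriv_p_deriv_q: "deriv_p (deriv_q b) = deriv_q (deriv_p b)"
  by (auto simp: deriv_p_def deriv_q_def fun_eq_iff)

lemma deriv_p_euler_p: "deriv_p (\<lambda>(i, j). real i * b (i, j)) = (\<lambda>k. deriv_p b k + (\<lambda>(i, j). real i * deriv_p b (i, j)) k)"
  and deriv_p_euler_q: "deriv_p (\<lambda>(i, j). real j * b (i, j)) = (\<lambda>(i, j). real j * deriv_p b (i, j))"
  and deriv_q_euler_q: "deriv_q (\<lambda>(i, j). real j * b (i, j)) = (\<lambda>k. deriv_q b k + (\<lambda>(i, j). real j * deriv_q b (i, j)) k)"
  by (auto simp: deriv_p_def deriv_q_def fun_eq_iff algebra_simps)

lemma powser2_lap:
  assumes b: "polygrowth b" and pq: "\<bar>p\<bar> \<le> 1 / 2" "\<bar>q\<bar> \<le> 1 / 2"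
  shows "powser2 (lap b) p q = lap_powser2 b p q"
proof -
  let ?euler_p = "\<lambda>a (i, j). real i * a (i, j)" and ?euler_q = "\<lambda>a (i, j). real j * a (i, j)"
  have euler_p: "polygrowth a \<Longrightarrow> polygrowth (?euler_p a)" for a
    using polygrowth_mult[of a "\<lambda>(i, j). real i" 1] by (simp add: case_prod_unfold algebra_simps)
  have euler_q: "polygrowth a \<Longrightarrow> polygrowth (?euler_q a)" for a
    using polygrowth_mult[of a "\<lambda>(i, j). real j" 1] by (simp add: case_prod_unfold algebra_simps)
  have cm: "polygrowth a \<Longrightarrow> polygrowth (\<lambda>k. c * a k)" for a c
  proof -
    assume "polygrowth a"
    then obtain C m where C: "C \<ge> 0" "\<And>i j. \<bar>a (i, j)\<bar> \<le> C * (real (i + 1) * real (j + 1)) ^ m"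
      using polygrowthE by metis
    show "polygrowth (\<lambda>k. c * a k)"
      by (rule polygrowthI[of _ "\<bar>c\<bar> * C" m]) (use C in \<open>auto simp: abs_mult mult.assoc intro!: mult_left_mono\<close>)
  qed
  have ad: "polygrowth a \<Longrightarrow> polygrowth a' \<Longrightarrow> polygrowth (\<lambda>k. a k + a' k)" for a a'
  proof -
    assume "polygrowth a" "polygrowth a'"
    then obtain C m C' m' where C: "C \<ge> 0" "\<And>i j. \<bar>a (i, j)\<bar> \<le> C * (real (i + 1) * real (j + 1)) ^ m"
      and C': "C' \<ge> 0" "\<And>i j. \<bar>a' (i, j)\<bar> \<le> C' * (real (i + 1) * real (j + 1)) ^ m'"
      using polygrowthE by metis
    show "polygrowth (\<lambda>k. a k + a' k)"
    proof (rule polygrowthI[of _ "C + C'" "m + m'"])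
      fix i j
      let ?x = "real (i + 1) * real (j + 1)"
      have "1 * 1 \<le> ?x" by (intro mult_mono) auto
      then have "?x ^ m \<le> ?x ^ (m + m')" "?x ^ m' \<le> ?x ^ (m + m')" by (auto intro!: power_increasing)
      then have "C * ?x ^ m \<le> C * ?x ^ (m + m')" "C' * ?x ^ m' \<le> C' * ?x ^ (m + m')"
        using C(1) C'(1) by (auto intro!: mult_left_mono)
      then show "\<bar>a (i, j) + a' (i, j)\<bar> \<le> (C + C') * ?x ^ (m + m')"
        using C(2)[of i j] C'(2)[of i j] by (simp add: distrib_right)
    qed
  qed
  note D = polygrowth_deriv_p polygrowth_deriv_q
  \<comment> \<open>\<open>eig\<close> is expanded as i^2 + 4 i j + 4 j^2 + 3 i + 6 j + 2, and (2 j
    + 3) (2 j + 2) is written as (4 j + 6) (j + 1).\<close>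
  have eq: "lap b = (\<lambda>k. 1 / 256 * deriv_p (deriv_p b) k + ((1 / 256) * (6 * deriv_q b k + 4 * ?euler_q (deriv_q b) k)
      + ((- 2) * b k + ((- 3) * ?euler_p b k + ((- 6) * ?euler_q b k
      + ((- 1) * ?euler_p (?euler_p b) k + ((- 4) * ?euler_p (?euler_q b) k + (- 4) * ?euler_q (?euler_q b) k)))))))"
    by (auto simp: lap_def deriv_p_def deriv_q_def eig_def fun_eq_iff algebra_simps add_divide_distrib)
  note [simp] = powser2_add[OF _ _ pq] powser2_cmult powser2_euler_p powser2_euler_q euler_p euler_q cm ad b D
  have "powser2 (lap b) p q = 1 / 256 * powser2 (deriv_p (deriv_p b)) p q + (1 / 256 * (6 * powser2 (deriv_q b) p q + 4 * (q * powser2 (deriv_q (deriv_q b)) p q))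
      + (- 2 * powser2 b p q + (- 3 * (p * powser2 (deriv_p b) p q) + (- 6 * (q * powser2 (deriv_q b) p q)
      + (- 1 * (p * (powser2 (deriv_p b) p q + p * powser2 (deriv_p (deriv_p b)) p q)) + (- 4 * (p * (q * powser2 (deriv_q (deriv_p b)) p q))
      + - 4 * (q * (powser2 (deriv_q b) p q + q * powser2 (deriv_q (deriv_q b)) p q))))))))"
    unfolding eq
    by (subst powser2_add[OF _ _ pq] | subst powser2_cmult | subst powser2_euler_p | subst powser2_euler_q | subst deriv_p_euler_p | subst deriv_p_euler_q | subst deriv_q_euler_q
        | rule refl cm ad euler_p euler_q D b)+
  also have "\<dots> = lap_powser2 b p q"
    by (simp add: lap_powser2_def algebra_simps power2_eq_square add_divide_distrib)
  finally show ?thesis .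
qed

text \<open>The algebraic core of \<open>laplace_perturb\<close>: S, C and s, c are the sines and
  cosines of colatitude and shifted longitude, and k, k1, ..., k22 the values of the series and of
  its partial derivatives. Only the two Pythagorean relations are left to use.\<close>

lemma laplace_identity:
  fixes S C c s A B k k1 k2 k11 k12 k22 :: real
  assumes C: "C\<^sup>2 = 1 - S\<^sup>2" and s: "s\<^sup>2 = 1 - c\<^sup>2" and S: "S \<noteq> 0"
  shows "1 / S * (C * (- A * S - B * S * k + B * C * (k1 * (C * c / 16) + k2 * (- (C * S / 128))))
      + S * (- A * C - B * C * k
       - B * S * (k1 * (C * c / 16) + k2 * (- (C * S / 128)))
       - B * S * (k1 * (C * c / 16) + k2 * (- (C * S / 128)))
       + B * C * ((k11 * (C * c / 16) + k12 * (- (C * S / 128))) * (C * c / 16)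
         + k1 * (- (S * c / 16))
         + (k12 * (C * c / 16) + k22 * (- (C * S / 128))) * (- (C * S / 128))
         + k2 * ((S\<^sup>2 - C\<^sup>2) / 128))))
    + 1 / S\<^sup>2 * (B * C * (k11 * (S * s / 16)\<^sup>2 - k1 * (S * c / 16)))
    = - 2 * A * C + B * C * ((k11 + 6 * k2 + 4 * (C\<^sup>2 / 256) * k22) / 256
     - ((S * c / 16)\<^sup>2 * k11 + 4 * (S * c / 16) * (C\<^sup>2 / 256) * k12 + 4 * (C\<^sup>2 / 256)\<^sup>2 * k22
        + 4 * (S * c / 16) * k1 + 10 * (C\<^sup>2 / 256) * k2 + 2 * k))" (is "?L = ?R")
proof -
  have C3: "C * (C * x) = (1 - S\<^sup>2) * x" for x using C by (simp add: power2_eq_square)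
  have s3: "s * (s * x) = (1 - c\<^sup>2) * x" for x using s by (simp add: power2_eq_square)
  have "S\<^sup>2 * ?L = S\<^sup>2 * ?R"
    using S by (simp add: field_simps power2_eq_square C3 s3) (simp add: C3 s3 algebra_simps power2_eq_square)?
  then show ?thesis using S by simp
qed

lemma laplace_perturb:
  assumes b: "polygrowth b" and s: "sin \<theta> \<noteq> 0"
  shows "laplace_S2 (\<lambda>\<theta> \<phi>. A * cos \<theta> + B * perturb b \<theta> (\<phi> - \<tau>)) \<theta> \<phi>
    = - 2 * A * cos \<theta> + B * cos \<theta> * lap_powser2 b (sin \<theta> * cos (\<phi> - \<tau>) / 16) ((cos \<theta>)\<^sup>2 / 256)"
proof -
  note D = polygrowth_deriv_p polygrowth_deriv_q
  define K where "K a x y = powser2 a (sin x * cos y / 16) ((cos x)\<^sup>2 / 256)" for a x y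
  note DT = DERIV_powser2_theta[folded K_def]
  have DP: "polygrowth a \<Longrightarrow> ((\<lambda>s. K a x (s - \<tau>)) has_real_derivative
      K (deriv_p a) x (y - \<tau>) * (- (sin x * sin (y - \<tau>) / 16))) (at y)" for a x y
    using DERIV_powser2_phi[folded K_def, of a x "y - \<tau>"] DERIV_shift[of "K a x" _ y "- \<tau>"] by simp
  let ?c = "cos (\<phi> - \<tau>)" and ?s = "sin (\<phi> - \<tau>)"
  define f1 where "f1 x = - A * sin x - B * sin x * K b x (\<phi> - \<tau>)
      + B * cos x * (K (deriv_p b) x (\<phi> - \<tau>) * (cos x * ?c / 16) + K (deriv_q b) x (\<phi> - \<tau>) * (- (cos x * sin x / 128)))" for x
  have 1: "((\<lambda>r. A * cos r + B * perturb b r (\<phi> - \<tau>)) has_real_derivative f1 x) (at x)" for x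
    unfolding perturb_def K_def[symmetric] f1_def
    by (rule DT b refl derivative_eq_intros)+ (simp add: algebra_simps)
  have T1: "((\<lambda>z. cos z * ?c / 16) has_real_derivative - (sin \<theta> * ?c / 16)) (at \<theta>)"
    by (auto intro!: derivative_eq_intros)
  have T2: "((\<lambda>z. - (cos z * sin z / 128)) has_real_derivative ((sin \<theta>)\<^sup>2 - (cos \<theta>)\<^sup>2) / 128) (at \<theta>)"
    by (auto intro!: derivative_eq_intros simp: power2_eq_square field_simps)
  have T3: "((\<lambda>y. - (sin \<theta> * sin (y - \<tau>) / 16)) has_real_derivative - (sin \<theta> * ?c / 16)) (at \<phi>)"
    by (auto intro!: derivative_eq_intros)
  have 2: "((\<lambda>x. sin x * f1 x) has_real_derivative
      cos \<theta> * f1 \<theta> + sin \<theta> * (- A * cos \<theta> - B * cos \<theta> * K b \<theta> (\<phi> - \<tau>)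
       - B * sin \<theta> * (K (deriv_p b) \<theta> (\<phi> - \<tau>) * (cos \<theta> * ?c / 16) + K (deriv_q b) \<theta> (\<phi> - \<tau>) * (- (cos \<theta> * sin \<theta> / 128)))
       - B * sin \<theta> * (K (deriv_p b) \<theta> (\<phi> - \<tau>) * (cos \<theta> * ?c / 16) + K (deriv_q b) \<theta> (\<phi> - \<tau>) * (- (cos \<theta> * sin \<theta> / 128)))
       + B * cos \<theta> * ((K (deriv_p (deriv_p b)) \<theta> (\<phi> - \<tau>) * (cos \<theta> * ?c / 16) + K (deriv_q (deriv_p b)) \<theta> (\<phi> - \<tau>) * (- (cos \<theta> * sin \<theta> / 128))) * (cos \<theta> * ?c / 16)
         + K (deriv_p b) \<theta> (\<phi> - \<tau>) * (- (sin \<theta> * ?c / 16))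
         + (K (deriv_q (deriv_p b)) \<theta> (\<phi> - \<tau>) * (cos \<theta> * ?c / 16) + K (deriv_q (deriv_q b)) \<theta> (\<phi> - \<tau>) * (- (cos \<theta> * sin \<theta> / 128))) * (- (cos \<theta> * sin \<theta> / 128))
         + K (deriv_q b) \<theta> (\<phi> - \<tau>) * (((sin \<theta>)\<^sup>2 - (cos \<theta>)\<^sup>2) / 128)))) (at \<theta>)"
    unfolding f1_def
    by (rule T1 T2 DT b D refl derivative_eq_intros)+ (simp add: deriv_p_deriv_q power2_eq_square algebra_simps)
  have 3: "((\<lambda>r. A * cos \<theta> + B * perturb b \<theta> (r - \<tau>)) has_real_derivative
     B * cos \<theta> * (K (deriv_p b) \<theta> (y - \<tau>) * (- (sin \<theta> * sin (y - \<tau>) / 16)))) (at y)" for y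
    unfolding perturb_def K_def[symmetric]
    by (rule DP b refl derivative_eq_intros)+ simp
  have 4: "((\<lambda>y. B * cos \<theta> * (K (deriv_p b) \<theta> (y - \<tau>) * (- (sin \<theta> * sin (y - \<tau>) / 16)))) has_real_derivative
     B * cos \<theta> * (K (deriv_p (deriv_p b)) \<theta> (\<phi> - \<tau>) * (sin \<theta> * ?s / 16)\<^sup>2 - K (deriv_p b) \<theta> (\<phi> - \<tau>) * (sin \<theta> * ?c / 16))) (at \<phi>)"
    by (rule T3 DP b D refl derivative_eq_intros)+ (simp add: power2_eq_square algebra_simps)
  show ?thesis
    unfolding laplace_S2_def DERIV_imp_deriv[OF 1] DERIV_imp_deriv[OF 2] DERIV_imp_deriv[OF 3] DERIV_imp_deriv[OF 4]
    unfolding lap_powser2_def K_def[symmetric] f1_def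
    by (rule laplace_identity[OF cos_squared_eq sin_squared_eq s])
qed

section \<open>The travelling waves\<close>

definition wave :: "real \<Rightarrow> (nat \<times> nat) l1 \<Rightarrow> S2_fun" where
  "wave e Y \<theta> \<phi> = cos \<theta> + e * perturb (coef Y) \<theta> \<phi>"

definition stream :: "real \<Rightarrow> real \<Rightarrow> (nat \<times> nat) l1 \<Rightarrow> real \<Rightarrow> S2_fun" where
  "stream c e Y t \<theta> \<phi> = c * cos \<theta> + c / 2 * wave e Y \<theta> (\<phi> - c * t)"

text \<open>The series of (s^3 + \<beta> s) / z for s = z (1 + e Y), the factor z being part of the
  index convention.\<close>

definition wave_source :: "real \<Rightarrow> real \<Rightarrow> (nat \<times> nat) l1 \<Rightarrow> (nat \<times> nat) l1" where
  "wave_source e \<beta> Y = \<beta> *\<^sub>R (single (0, 0) + e *\<^sub>R Y) + 256 *\<^sub>R shift (single (0, 0) + e *\<^sub>R cubic e Y)"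

definition solves_wave :: "real \<Rightarrow> real \<Rightarrow> (nat \<times> nat) l1 \<Rightarrow> bool" where
  "solves_wave e \<beta> Y \<longleftrightarrow> (\<forall>k. lap (coef Y) k + 6 * coef Y k = e * coef (wave_source e \<beta> Y) k)"

lemma powser2_eval_l1: "powser2 (coef a) p q = eval_l1 (\<lambda>(i, j). p ^ i * q ^ j) a"
  unfolding powser2_def eval_l1_def by (rule infsum_cong) (auto simp: algebra_simps)

lemma character_monomial:
  assumes "\<bar>p\<bar> \<le> 1" "\<bar>q\<bar> \<le> 1"
  shows "character (\<lambda>(i, j). p ^ i * q ^ j)"
  using assms by (auto simp: character_def power_add abs_mult power_abs power_le_one mult_le_one)

lemma powser2_shift: "powser2 (coef (shift a)) p q = q * powser2 (coef a) p q"
  unfolding powser2_shift_j[symmetric] by (rule arg_cong[of _ _ "\<lambda>a. powser2 a p q"]) (auto simp: coef_shift fun_eq_iff)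

lemma powser2_wave_source:
  assumes p: "\<bar>p\<bar> \<le> 1" and q: "\<bar>q\<bar> \<le> 1"
  shows "powser2 (coef (wave_source e \<beta> Y)) p q
    = \<beta> * (1 + e * powser2 (coef Y) p q) + 256 * q * (1 + e * powser2 (coef Y) p q) ^ 3"
proof -
  let ?\<xi> = "\<lambda>(i, j). p ^ i * q ^ j"
  have ch: "character ?\<xi>" by (rule character_monomial[OF p q])
  interpret bounded_linear "eval_l1 ?\<xi>"
    by (rule eval_l1_bounded_linear) (use ch in \<open>auto simp: character_def\<close>)
  have sh: "eval_l1 ?\<xi> (shift a) = q * eval_l1 ?\<xi> a" for a
    using powser2_shift[of a p q] by (simp only: powser2_eval_l1)
  show ?thesis
    unfolding powser2_eval_l1 wave_source_def cubic_def
    by (simp only: add scaleR sh eval_l1_single eval_l1_conv[OF ch])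
      (simp add: power3_eq_cube power2_eq_square algebra_simps)
qed

lemma powser2_lap_solves:
  assumes "solves_wave e \<beta> Y" and pq: "\<bar>p\<bar> \<le> 1 / 2" "\<bar>q\<bar> \<le> 1 / 2"
  shows "powser2 (lap (coef Y)) p q = e * powser2 (coef (wave_source e \<beta> Y)) p q - 6 * powser2 (coef Y) p q"
proof -
  have eq: "lap (coef Y) = (\<lambda>k. coef (e *\<^sub>R wave_source e \<beta> Y + (- 6) *\<^sub>R Y) k)"
    using assms(1) by (auto simp: solves_wave_def fun_eq_iff algebra_simps)
  interpret bounded_linear "eval_l1 (\<lambda>(i, j). p ^ i * q ^ j)"
    by (rule eval_l1_bounded_linear) (use character_monomial[of p q] pq in \<open>auto simp: character_def\<close>)
  show ?thesis unfolding eq powser2_eval_l1 by (simp only: add scaleR) simp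
qed

text \<open>The contribution -2 c z of the rotation cancels the term 4 z in (\<Delta> + 6) s - 4 z,
  which enters with the factor c / 2. No explicit z survives, and the vorticity depends on position
  through s alone.\<close>

lemma laplace_stream:
  assumes Y: "solves_wave e \<beta> Y" and s: "sin \<theta> \<noteq> 0"
  shows "laplace_S2 (stream c e Y t) \<theta> \<phi>
    = - 3 * c * wave e Y \<theta> (\<phi> - c * t)
      + c * e\<^sup>2 / 2 * (wave e Y \<theta> (\<phi> - c * t) ^ 3 + \<beta> * wave e Y \<theta> (\<phi> - c * t))"
proof -
  define p q h where "p = sin \<theta> * cos (\<phi> - c * t) / 16" and "q = (cos \<theta>)\<^sup>2 / 256" and "h = powser2 (coef Y) p q"
  have pq: "\<bar>p\<bar> \<le> 1 / 2" "\<bar>q\<bar> \<le> 1 / 2"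
    using abs_trig_mult_le(1)[of \<theta> "\<phi> - c * t"] cos_sq_le[of \<theta>] by (simp_all add: p_def q_def)
  have w: "wave e Y \<theta> (\<phi> - c * t) = cos \<theta> * (1 + e * h)"
    by (simp add: wave_def perturb_def p_def q_def h_def algebra_simps)
  have st: "stream c e Y t = (\<lambda>\<theta> \<phi>. (3 * c / 2) * cos \<theta> + (c * e / 2) * perturb (coef Y) \<theta> (\<phi> - c * t))"
    by (auto simp: stream_def wave_def fun_eq_iff algebra_simps)
  have "laplace_S2 (stream c e Y t) \<theta> \<phi>
      = - 2 * (3 * c / 2) * cos \<theta> + (c * e / 2) * cos \<theta> * powser2 (lap (coef Y)) p q"
    unfolding st laplace_perturb[OF polygrowth_coef s] powser2_lap[OF polygrowth_coef pq] by (simp add: p_def q_def)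
  also have "powser2 (lap (coef Y)) p q = e * (\<beta> * (1 + e * h) + (cos \<theta>)\<^sup>2 * (1 + e * h) ^ 3) - 6 * h"
    using powser2_lap_solves[OF Y pq] powser2_wave_source[of p q e \<beta> Y] pq by (simp add: h_def q_def)
  also have "- 2 * (3 * c / 2) * cos \<theta> + (c * e / 2) * cos \<theta>
      * (e * (\<beta> * (1 + e * h) + (cos \<theta>)\<^sup>2 * (1 + e * h) ^ 3) - 6 * h)
    = - 3 * c * (cos \<theta> * (1 + e * h))
      + c * e\<^sup>2 / 2 * ((cos \<theta> * (1 + e * h)) ^ 3 + \<beta> * (cos \<theta> * (1 + e * h)))"
    by (simp add: power2_eq_square power3_eq_cube algebra_simps)
  finally show ?thesis by (simp only: w)
qed

lemma euler_solution_stream: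
  assumes Y: "solves_wave e \<beta> Y"
  shows "euler_solution (stream c e Y)"
proof -
  define g where "g s = - 3 * c * s + c * e\<^sup>2 / 2 * (s ^ 3 + \<beta> * s)" for s
  define g' where "g' s = - 3 * c + c * e\<^sup>2 / 2 * (3 * s\<^sup>2 + \<beta>)" for s
  have g: "(g has_real_derivative g' s) (at s)" for s
    unfolding g_def g'_def by (auto intro!: derivative_eq_intros)
  have lap: "laplace_S2 (stream c e Y t) \<theta> \<phi> = g (wave e Y \<theta> (\<phi> - c * t))" if "sin \<theta> \<noteq> 0" for t \<theta> \<phi>
    using laplace_stream[OF Y that] by (simp add: g_def)
  show ?thesis
    unfolding euler_solution_def Let_def
  proof (intro allI ballI)
    fix t \<theta> \<phi> :: real assume \<theta>: "\<theta> \<in> {0<..<pi}"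
    then have sin: "sin \<theta> \<noteq> 0" using sin_gt_zero[of \<theta>] by auto
    let ?w = "wave e Y \<theta> (\<phi> - c * t)"
    obtain a where a: "((\<lambda>x. wave e Y x (\<phi> - c * t)) has_real_derivative a) (at \<theta>)"
      unfolding wave_def perturb_def
      using DERIV_add[OF DERIV_cos DERIV_cmult[OF DERIV_mult[OF DERIV_cos DERIV_powser2_theta[OF polygrowth_coef]]]]
      by blast
    obtain b where b: "((\<lambda>y. wave e Y \<theta> y) has_real_derivative b) (at (\<phi> - c * t))"
      unfolding wave_def perturb_def
      using DERIV_add[OF DERIV_const DERIV_cmult[OF DERIV_cmult[OF DERIV_powser2_phi[OF polygrowth_coef]]]]
      by blast
    have b1: "((\<lambda>y. wave e Y \<theta> (y - c * t)) has_real_derivative b) (at \<phi>)"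
      using DERIV_shift[of "wave e Y \<theta>" b \<phi> "- c * t"] b by simp
    have b2: "((\<lambda>s. wave e Y \<theta> (\<phi> - c * s)) has_real_derivative b * (- c)) (at t)"
      by (rule DERIV_chain2[where f = "wave e Y \<theta>" and g = "\<lambda>s. \<phi> - c * s", OF b])
        (auto intro!: derivative_eq_intros)
    have P: "grad_S2 (stream c e Y t) \<theta> \<phi> = (- c * sin \<theta> + c / 2 * a, 1 / sin \<theta> * (c / 2 * b))"
    proof -
      have "((\<lambda>x. stream c e Y t x \<phi>) has_real_derivative c * (- sin \<theta>) + c / 2 * a) (at \<theta>)"
        unfolding stream_def by (intro DERIV_add DERIV_cmult DERIV_cos a)
      moreover have "((\<lambda>y. stream c e Y t \<theta> y) has_real_derivative 0 + c / 2 * b) (at \<phi>)"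
        unfolding stream_def by (intro DERIV_add DERIV_cmult DERIV_const b1)
      ultimately show ?thesis by (simp add: grad_S2_def DERIV_imp_deriv)
    qed
    have O: "grad_S2 (laplace_S2 (stream c e Y t)) \<theta> \<phi> = (g' ?w * a, 1 / sin \<theta> * (g' ?w * b))"
    proof -
      \<comment> \<open>The formula for the vorticity is available off the poles only, so its
        \<theta>-derivative requires it on a neighbourhood of \<theta>.\<close>
      have ev: "\<forall>\<^sub>F x in nhds \<theta>. laplace_S2 (stream c e Y t) x \<phi> = g (wave e Y x (\<phi> - c * t))"
        using eventually_nhds_in_open[OF open_greaterThanLessThan \<theta>]
        by eventually_elim (use sin_gt_zero in \<open>force intro!: lap\<close>)
      have "((\<lambda>x. g (wave e Y x (\<phi> - c * t))) has_real_derivative g' ?w * a) (at \<theta>)"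
        by (rule DERIV_chain2[OF g a])
      then have "((\<lambda>x. laplace_S2 (stream c e Y t) x \<phi>) has_real_derivative g' ?w * a) (at \<theta>)"
        using DERIV_cong_ev[OF refl ev refl] by blast
      moreover have "((\<lambda>y. laplace_S2 (stream c e Y t) \<theta> y) has_real_derivative g' ?w * b) (at \<phi>)"
        unfolding lap[OF sin] by (rule DERIV_chain2[OF g b1])
      ultimately show ?thesis by (simp add: grad_S2_def DERIV_imp_deriv)
    qed
    have "((\<lambda>s. laplace_S2 (stream c e Y s) \<theta> \<phi>) has_real_derivative g' ?w * (b * (- c))) (at t)"
      unfolding lap[OF sin] by (rule DERIV_chain2[OF g b2])
    \<comment> \<open>The products of a and b cancel, since the gradients of s and of the vorticity
      are parallel. The surviving term comes from \<open>- c * sin \<theta>\<close>, and its factor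
      sin \<theta> cancels that of the frame.\<close>
    moreover have "g' ?w * (b * (- c))
        = - (grad_perp_S2 (stream c e Y t) \<theta> \<phi> \<bullet> grad_S2 (laplace_S2 (stream c e Y t)) \<theta> \<phi>)"
      unfolding grad_perp_S2_def P O J_S2_def using sin by (simp add: field_simps)
    ultimately show "((\<lambda>s. laplace_S2 (stream c e Y s) \<theta> \<phi>) has_real_derivative
        - (grad_perp_S2 (stream c e Y t) \<theta> \<phi> \<bullet> grad_S2 (laplace_S2 (stream c e Y t)) \<theta> \<phi>)) (at t)"
      by simp
  qed
qed

lemma travelling_wave_stream:
  assumes "solves_wave e \<beta> Y"
  shows "travelling_wave c (stream c e Y)"
  unfolding travelling_wave_def
  by (intro conjI euler_solution_stream[OF assms] exI[of _ "\<lambda>\<theta> \<phi>. c * cos \<theta> + c / 2 * wave e Y \<theta> \<phi>"])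
    (simp add: stream_def)

section \<open>Non-triviality\<close>

text \<open>Once the lower coefficients vanish, division by x^n exhibits a n as the limit at 0 of a
  series that is zero for small x > 0. One-sided information matters because the argument q = z^2 /
  256 is never negative.\<close>

lemma powser_eq_zero:
  fixes a :: "nat \<Rightarrow> real"
  assumes bd: "\<And>n. \<bar>a n\<bar> \<le> C" and r: "r > 0"
    and z: "\<And>x. 0 < x \<Longrightarrow> x < r \<Longrightarrow> (\<lambda>n. a n * x ^ n) sums 0"
  shows "a n = 0"
proof (induction n rule: less_induct)
  case (less n)
  have sm: "summable (\<lambda>m. a (m + n) * x ^ m)" if "norm x < 1" for x
  proof (rule summable_comparison_test')
    show "summable (\<lambda>m. C * \<bar>x\<bar> ^ m)" using that by (intro summable_mult summable_geometric) simp
    show "norm (a (m + n) * x ^ m) \<le> C * \<bar>x\<bar> ^ m" for m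
      using bd[of "m + n"] by (simp add: abs_mult power_abs mult_right_mono)
  qed
  define f where "f x = (\<Sum>m. a (m + n) * x ^ m)" for x
  have "(f \<longlongrightarrow> a (0 + n)) (at 0)"
    by (rule powser_limit_0[of 1 "\<lambda>m. a (m + n)"]) (use sm in \<open>auto simp: f_def summable_sums\<close>)
  then have lim: "(f \<longlongrightarrow> a n) (at_right 0)"
    by (simp add: filterlim_at_split)
  have "f x = 0" if x: "0 < x" "x < r" for x
  proof -
    have "(\<lambda>m. a (m + n) * x ^ (m + n)) sums (0 - (\<Sum>i<n. a i * x ^ i))"
      using sums_split_initial_segment[OF z[OF x], of n] by simp
    also have "(\<Sum>i<n. a i * x ^ i) = 0" using less by simp
    finally have "(\<lambda>m. a (m + n) * x ^ (m + n) * (1 / x ^ n)) sums (0 * (1 / x ^ n))"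
      by (intro sums_mult2) simp
    moreover have "a (m + n) * x ^ (m + n) * (1 / x ^ n) = a (m + n) * x ^ m" for m
      using x by (simp add: power_add)
    ultimately show ?thesis by (simp add: f_def sums_iff)
  qed
  then have "\<forall>\<^sub>F x in at_right 0. f x = 0"
    using eventually_at_right_less r by (intro eventually_at_rightI[of 0 r]) auto
  then have "(f \<longlongrightarrow> 0) (at_right 0)" by (simp add: tendsto_eventually)
  with lim show ?case using tendsto_unique[OF trivial_limit_at_right_real] by blast
qed

text \<open>The orders 1 and -1 share the factor sin \<theta> cos \<theta>, the orders 2 and -2
  share (sin \<theta>)^2, and order 0 disappears in the unspecified zonal part.\<close>

lemma in_Y2_form:
  assumes "in_Y2 y"
  obtains z A B A' B' where "\<And>\<theta> \<phi>. \<theta> \<in> {0..pi} \<Longrightarrow> y \<theta> \<phi> = z \<theta>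
    + sin \<theta> * cos \<theta> * (A * cos \<phi> + B * sin \<phi>) + (sin \<theta>)\<^sup>2 * (A' * cos (2 * \<phi>) + B' * sin (2 * \<phi>))"
proof -
  obtain a where a: "\<And>\<theta> \<phi>. \<theta> \<in> {0..pi} \<Longrightarrow> y \<theta> \<phi> = (\<Sum>m\<in>{-2..2}. a m * sph_harm 2 m \<theta> \<phi>)"
    using assms unfolding in_Y2_def by blast
  define N :: "nat \<Rightarrow> real" where "N m = sqrt ((2 * real 2 + 1) / (4 * pi) * fact (2 - m) / fact (2 + m))" for m
  define Q :: "nat \<Rightarrow> real poly" where "Q m = (pderiv ^^ m) (legendre_poly 2)" for m
  have lp: "legendre_poly 2 = [:- 1 / 2, 0, 3 / 2:]"
    by (simp add: legendre_poly_def pderiv_pCons numeral_2_eq_2 power2_eq_square)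
  have pd2: "(pderiv ^^ 2) p = pderiv (pderiv p)" for p :: "real poly"
    by (simp add: numeral_2_eq_2)
  have Q1: "poly (Q 1) x = 3 * x" and Q2: "poly (Q 2) x = 3" for x
    by (simp_all add: Q_def pd2 lp pderiv_pCons)
  have set: "{-2..2::int} = {-2, -1, 0, 1, 2}" by auto
  have "y \<theta> \<phi> = a 0 * sph_harm 2 0 \<theta> 0
    + sin \<theta> * cos \<theta> * ((3 * sqrt 2 * N 1 * a 1) * cos \<phi> + (3 * sqrt 2 * N 1 * a (-1)) * sin \<phi>)
    + (sin \<theta>)\<^sup>2 * ((3 * sqrt 2 * N 2 * a 2) * cos (2 * \<phi>) + (3 * sqrt 2 * N 2 * a (-2)) * sin (2 * \<phi>))"
    if "\<theta> \<in> {0..pi}" for \<theta> \<phi>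
  proof -
    have sph: "sph_harm 2 m \<theta> \<phi> = N (nat \<bar>m\<bar>) * (sin \<theta> ^ nat \<bar>m\<bar> * poly (Q (nat \<bar>m\<bar>)) (cos \<theta>))
      * (if m = 0 then 1 else if m > 0 then sqrt 2 * cos (real_of_int m * \<phi>)
         else sqrt 2 * sin (real_of_int \<bar>m\<bar> * \<phi>))" for m \<phi>
      by (simp only: sph_harm_def N_def Q_def legendre_assoc_def)
    show ?thesis
      unfolding a[OF that] set
      by (simp add: sph Q1[simplified] Q2 algebra_simps power2_eq_square)
  qed
  then show thesis by (rule that)
qed

text \<open>Triviality forces the coefficients of Y with i >= 1 to vanish except at (1, 0). Then the
  equation makes s^3 + \<beta> s independent of x, while the coefficient 16 keeps s itself dependent
  on x.\<close>

lemma not_trivial_stream: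
  assumes Y: "solves_wave e \<beta> Y" and c: "c \<noteq> 0" and e: "e \<noteq> 0" and Y10: "coef Y (1, 0) = 16"
  shows "\<not> trivial_S2 (stream c e Y t)"
proof
  assume "trivial_S2 (stream c e Y t)"
  then obtain z0 y where "zonal z0" "in_Y2 y"
    and eq0: "\<And>\<theta> \<phi>. \<theta> \<in> {0..pi} \<Longrightarrow> stream c e Y t \<theta> \<phi> = z0 \<theta> \<phi> + y \<theta> \<phi>"
    unfolding trivial_S2_def by blast
  obtain z1 where z1: "\<And>\<theta> \<phi>. \<theta> \<in> {0..pi} \<Longrightarrow> z0 \<theta> \<phi> = z1 \<theta>"
    using \<open>zonal z0\<close> unfolding zonal_def by blast
  obtain z2 A B A' B' where y: "\<And>\<theta> \<phi>. \<theta> \<in> {0..pi} \<Longrightarrow> y \<theta> \<phi> = z2 \<theta>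
    + sin \<theta> * cos \<theta> * (A * cos \<phi> + B * sin \<phi>) + (sin \<theta>)\<^sup>2 * (A' * cos (2 * \<phi>) + B' * sin (2 * \<phi>))"
    using in_Y2_form[OF \<open>in_Y2 y\<close>] by metis
  define \<tau> where "\<tau> = c * t"
  have even: "perturb (coef Y) \<theta> (- \<alpha>) = perturb (coef Y) \<theta> \<alpha>" for \<theta> \<alpha> by (simp add: perturb_def)
  define k where "k = c * e / 2"
  have k: "k \<noteq> 0" using c e by (simp add: k_def)
  define W where "W \<theta> = (z1 \<theta> + z2 \<theta> - 3 * c / 2 * cos \<theta>) / k" for \<theta>
  define a where "a = (A * cos \<tau> + B * sin \<tau>) / k"
  define b where "b = (A' * cos (2 * \<tau>) + B' * sin (2 * \<tau>)) / k"
  \<comment> \<open>Averaging over \<alpha> and -\<alpha> around the longitude \<tau> removes the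
    sine terms, as \<open>perturb\<close> is even in the longitude.\<close>
  have form: "perturb (coef Y) \<theta> \<alpha> = W \<theta> + a * (sin \<theta> * cos \<theta> * cos \<alpha>) + b * ((sin \<theta>)\<^sup>2 * cos (2 * \<alpha>))"
    if \<theta>: "\<theta> \<in> {0..pi}" for \<theta> \<alpha>
  proof -
    have s: "stream c e Y t \<theta> (\<tau> + x) = 3 * c / 2 * cos \<theta> + k * perturb (coef Y) \<theta> x" for x
      by (simp add: stream_def wave_def \<tau>_def k_def algebra_simps)
    have 1: "3 * c / 2 * cos \<theta> + k * perturb (coef Y) \<theta> \<alpha> = z1 \<theta> + y \<theta> (\<tau> + \<alpha>)"
      using eq0[OF \<theta>, of "\<tau> + \<alpha>"] s[of \<alpha>] z1[OF \<theta>] by simp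
    have 2: "3 * c / 2 * cos \<theta> + k * perturb (coef Y) \<theta> \<alpha> = z1 \<theta> + y \<theta> (\<tau> - \<alpha>)"
      using eq0[OF \<theta>, of "\<tau> + - \<alpha>"] s[of "- \<alpha>"] z1[OF \<theta>] even by simp
    have "2 * (k * perturb (coef Y) \<theta> \<alpha>) = 2 * (z1 \<theta> - 3 * c / 2 * cos \<theta>) + (y \<theta> (\<tau> + \<alpha>) + y \<theta> (\<tau> - \<alpha>))"
      using 1 2 by simp
    also have "y \<theta> (\<tau> + \<alpha>) + y \<theta> (\<tau> - \<alpha>) = 2 * (z2 \<theta> + k * a * (sin \<theta> * cos \<theta> * cos \<alpha>)
        + k * b * ((sin \<theta>)\<^sup>2 * cos (2 * \<alpha>)))"
    proof -
      have ka: "k * a = A * cos \<tau> + B * sin \<tau>" and kb: "k * b = A' * cos (2 * \<tau>) + B' * sin (2 * \<tau>)"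
        using k by (simp_all add: a_def b_def)
      show ?thesis unfolding y[OF \<theta>] ka kb distrib_left right_diff_distrib cos_add sin_add cos_diff sin_diff
        by (simp add: algebra_simps)
    qed
    finally have "k * perturb (coef Y) \<theta> \<alpha> = (z1 \<theta> + z2 \<theta> - 3 * c / 2 * cos \<theta>)
        + k * a * (sin \<theta> * cos \<theta> * cos \<alpha>) + k * b * ((sin \<theta>)\<^sup>2 * cos (2 * \<alpha>))"
      by simp
    also have "z1 \<theta> + z2 \<theta> - 3 * c / 2 * cos \<theta> = k * W \<theta>" using k by (simp add: W_def)
    finally have "k * perturb (coef Y) \<theta> \<alpha>
        = k * (W \<theta> + a * (sin \<theta> * cos \<theta> * cos \<alpha>) + b * ((sin \<theta>)\<^sup>2 * cos (2 * \<alpha>)))"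
      by (simp only: distrib_left mult.assoc)
    then show ?thesis using k by simp
  qed
  \<comment> \<open>On the equator \<open>perturb\<close> vanishes through its factor cos \<theta>,
    leaving only the second harmonic.\<close>
  have b0: "b = 0"
  proof -
    have "perturb (coef Y) (pi / 2) x = 0" for x by (simp add: perturb_def)
    then have "W (pi / 2) + b * cos (2 * x) = 0" for x using form[of "pi / 2" x] by simp
    from this[of 0] this[of "pi / 2"] show ?thesis by simp
  qed
  define \<kappa> where "\<kappa> = 16 * a"
  \<comment> \<open>Divided by cos \<theta>, the profile is affine in p. The point belonging to (p,
    q) has cos \<theta> = 16 sqrt q and cos \<alpha> = 16 p / sin \<theta>; the bound on q gives sin
    \<theta> >= 1 / 2, so every p up to 1 / 32 is reached.\<close>
  have lin: "powser2 (coef Y) p q = powser2 (coef Y) 0 q + \<kappa> * p" if p: "\<bar>p\<bar> \<le> 1 / 32" and q: "0 < q" "q < 1 / 1024" for p q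
  proof -
    define \<theta> where "\<theta> = arccos (16 * sqrt q)"
    have "sqrt q < sqrt ((1 / 32)\<^sup>2)" using q by (intro real_sqrt_less_mono) (simp add: power2_eq_square)
    then have sq: "0 < 16 * sqrt q" "16 * sqrt q < 1 / 2" using q by simp_all
    then have "- 1 \<le> 16 * sqrt q" "16 * sqrt q \<le> 1" by linarith+
    then have \<theta>: "\<theta> \<in> {0..pi}" and cos: "cos \<theta> = 16 * sqrt q"
      unfolding \<theta>_def by (auto intro!: arccos_lbound arccos_ubound cos_arccos)
    have "(16 * sqrt q)\<^sup>2 \<le> (1 / 2)\<^sup>2" using sq by (intro power_mono) auto
    then have "(cos \<theta>)\<^sup>2 \<le> (1 / 2)\<^sup>2" by (simp only: cos)
    then have "(sin \<theta>)\<^sup>2 \<ge> (1 / 2)\<^sup>2" unfolding sin_squared_eq by (simp add: power_divide)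
    moreover have "sin \<theta> \<ge> 0" using \<theta> by (simp add: sin_ge_zero)
    ultimately have sin: "sin \<theta> \<ge> 1 / 2" by (rule power2_le_imp_le)
    have q': "(cos \<theta>)\<^sup>2 / 256 = q" using q by (simp add: cos power_mult_distrib)
    have *: "powser2 (coef Y) x q = W \<theta> / cos \<theta> + \<kappa> * x" if x: "\<bar>x\<bar> \<le> 1 / 32" for x
    proof -
      define u where "u = 16 * x / sin \<theta>"
      have "\<bar>16 * x\<bar> \<le> \<bar>sin \<theta>\<bar>" using x sin by simp
      then have u: "\<bar>u\<bar> \<le> 1" using sin by (simp add: u_def abs_mult divide_le_eq)
      have x'': "sin \<theta> * cos (arccos u) = 16 * x"
        using u sin by (simp add: cos_arccos_abs u_def)
      then have x': "sin \<theta> * cos (arccos u) / 16 = x" by simp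
      have x3: "sin \<theta> * cos \<theta> * cos (arccos u) = cos \<theta> * (16 * x)"
        unfolding x''[symmetric] by simp
      have "cos \<theta> * powser2 (coef Y) x q = W \<theta> + a * (cos \<theta> * (16 * x))"
        using form[OF \<theta>, of "arccos u"] x' unfolding perturb_def b0 x' q' x3 by simp
      then show ?thesis using cos sq by (simp add: \<kappa>_def field_simps)
    qed
    show ?thesis using *[OF p] *[of 0] by simp
  qed
  \<comment> \<open>The double series is read as a power series in p whose coefficients are power
    series in q. All are bounded by \<open>norm Y\<close>, so that \<open>powser_eq_zero\<close>
    applies first in p for fixed q and then in q.\<close>
  have row: "(\<lambda>i. (\<Sum>j. coef Y (i, j) * q ^ j) * p ^ i) sums powser2 (coef Y) p q"
    and row_sum: "(\<lambda>j. coef Y (i, j) * q ^ j) sums (\<Sum>j. coef Y (i, j) * q ^ j)"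
    and row_bound: "\<bar>\<Sum>j. coef Y (i, j) * q ^ j\<bar> \<le> norm Y"
    if p: "\<bar>p\<bar> \<le> 1 / 2" and q: "\<bar>q\<bar> \<le> 1 / 2" for p q i
  proof -
    define r where "r i = wpull (\<lambda>_. 1) (Pair i) Y" for i :: nat
    have r: "coef (r i) j = coef Y (i, j)" "norm (r i) \<le> norm Y" for i j
      using coef_wpull[of "\<lambda>_. 1" 1 "Pair i" Y j] norm_wpull[of "\<lambda>_. 1" 1 "Pair i" Y]
      by (simp_all add: r_def inj_on_def)
    have q1: "\<bar>q ^ j\<bar> \<le> 1" for j using q by (simp add: power_abs power_le_one)
    have hs: "((\<lambda>j. coef Y (i, j) * q ^ j) has_sum eval_l1 (\<lambda>j. q ^ j) (r i)) UNIV" for i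
      using eval_l1_has_sum(1)[of "\<lambda>j. q ^ j" "r i", OF q1] by (simp add: r)
    have sm: "(\<lambda>j. coef Y (i, j) * q ^ j) sums eval_l1 (\<lambda>j. q ^ j) (r i)" for i
      by (rule has_sum_imp_sums[OF hs])
    then have ev: "(\<Sum>j. coef Y (i, j) * q ^ j) = eval_l1 (\<lambda>j. q ^ j) (r i)" for i
      by (simp add: sums_iff)
    show "(\<lambda>j. coef Y (i, j) * q ^ j) sums (\<Sum>j. coef Y (i, j) * q ^ j)" unfolding ev by (rule sm)
    show "\<bar>\<Sum>j. coef Y (i, j) * q ^ j\<bar> \<le> norm Y"
      unfolding ev using eval_l1_has_sum(2)[of "\<lambda>j. q ^ j" "r i", OF q1] r(2)[of i] by simp
    have "((\<lambda>i. eval_l1 (\<lambda>j. q ^ j) (r i) * p ^ i) has_sum powser2 (coef Y) p q) UNIV"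
    proof (rule has_sum_SigmaD)
      show "((\<lambda>(i, j). coef Y (i, j) * p ^ i * q ^ j) has_sum powser2 (coef Y) p q) (UNIV \<times> UNIV)"
        using powser2_has_sum[OF polygrowth_coef p q] by simp
      show "((\<lambda>j. case (i, j) of (i, j) \<Rightarrow> coef Y (i, j) * p ^ i * q ^ j) has_sum eval_l1 (\<lambda>j. q ^ j) (r i) * p ^ i) UNIV" for i
        using has_sum_cmult_left[OF hs[of i], of "p ^ i"] by (simp add: mult_ac)
    qed
    then show "(\<lambda>i. (\<Sum>j. coef Y (i, j) * q ^ j) * p ^ i) sums powser2 (coef Y) p q"
      unfolding ev by (rule has_sum_imp_sums)
  qed
  have c0: "(\<Sum>j. coef Y (i, j) * q ^ j) = (if i = 1 then \<kappa> else 0)"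
    if q: "0 < q" "q < 1 / 1024" and i: "i \<ge> 1" for i q
  proof -
    define d where "d i = (\<Sum>j. coef Y (i, j) * q ^ j)" for i
    have q2: "\<bar>q\<bar> \<le> 1 / 2" using q by simp
    define g where "g i = (if i = 0 then 0 else if i = 1 then d 1 - \<kappa> else d i)" for i
    have "g i = 0"
    proof (rule powser_eq_zero[where C = "norm Y + \<bar>\<kappa>\<bar>" and r = "1 / 32"])
      show "\<bar>g n\<bar> \<le> norm Y + \<bar>\<kappa>\<bar>" for n
        using row_bound[of 0 q n] row_bound[of 0 q 1] q2 by (auto simp: g_def d_def)
      fix x :: real assume x: "0 < x" "x < 1 / 32"
      have "(\<lambda>i. d i * x ^ i - (if i = 0 then d 0 else 0) - (if i = 1 then \<kappa> * x else 0))
          sums (powser2 (coef Y) x q - d 0 - \<kappa> * x)"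
        using row[of x q] x q2 sums_single[of 0 "\<lambda>_. d 0"] sums_single[of 1 "\<lambda>_. \<kappa> * x"]
        by (intro sums_diff) (auto simp: d_def)
      also have "(\<lambda>i. d i * x ^ i - (if i = 0 then d 0 else 0) - (if i = 1 then \<kappa> * x else 0)) = (\<lambda>i. g i * x ^ i)"
        by (auto simp: g_def algebra_simps)
      also have "d 0 = powser2 (coef Y) 0 q"
        using row[of 0 q] q2 powser_sums_zero_iff[of d] by (simp add: d_def)
      also have "powser2 (coef Y) x q - powser2 (coef Y) 0 q - \<kappa> * x = 0" using lin[of x q] x q by simp
      finally show "(\<lambda>n. g n * x ^ n) sums 0" .
    qed simp
    then show ?thesis using i by (auto simp: g_def d_def split: if_splits)
  qed
  have gz: "coef Y (i, j) = (if j = 0 then if i = 1 then \<kappa> else 0 else 0)" if ij: "i \<ge> 1" for i j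
  proof -
    define g where "g j = coef Y (i, j) - (if j = 0 then if i = 1 then \<kappa> else 0 else 0)" for j
    have "g j = 0" for j
    proof (rule powser_eq_zero[where C = "norm Y + \<bar>\<kappa>\<bar>" and r = "1 / 1024"])
      show "\<bar>g n\<bar> \<le> norm Y + \<bar>\<kappa>\<bar>" for n
        using abs_coef_le_norm[of Y "(i, n)"] by (auto simp: g_def)
      fix x :: real assume x: "0 < x" "x < 1 / 1024"
      have "(\<lambda>j. coef Y (i, j) * x ^ j - (if j = 0 then if i = 1 then \<kappa> else 0 else 0))
         sums ((if i = 1 then \<kappa> else 0) - (if i = 1 then \<kappa> else 0))"
        using row_sum[of 0 x i] c0[OF x ij] x sums_single[of 0 "\<lambda>_. if i = 1 then \<kappa> else 0"]
        by (intro sums_diff) auto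
      also have "(\<lambda>j. coef Y (i, j) * x ^ j - (if j = 0 then if i = 1 then \<kappa> else 0 else 0)) = (\<lambda>j. g j * x ^ j)"
        by (auto simp: g_def)
      finally show "(\<lambda>j. g j * x ^ j) sums 0" by simp
    qed simp
    then show ?thesis by (simp add: g_def)
  qed
  have Yij: "coef Y (i, j) = 0" if "i \<ge> 1" "(i, j) \<noteq> (1, 0)" for i j
    using gz[of i j] that by auto
  have \<kappa>: "\<kappa> = 16" using gz[of 1 0] Y10 by simp
  \<comment> \<open>\<open>lap\<close> couples (i, j) only to (i + 2, j) and (i, j + 1). For i >= 1
    just the entry (1, 0) could contribute, and there \<open>eig\<close> is 6.\<close>
  have G: "coef (wave_source e \<beta> Y) (i, j) = 0" if "i \<ge> 1" for i j
  proof -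
    have "lap (coef Y) (i, j) + 6 * coef Y (i, j) = 0"
      using Yij[of i j] Yij[of "i + 2" j] Yij[of i "j + 1"] that
      by (cases "(i, j) = (1, 0)") (auto simp: lap_def eig_def)
    then show ?thesis using Y e by (simp add: solves_wave_def)
  qed
  define q :: real where "q = 1 / 2048"
  have const: "powser2 (coef (wave_source e \<beta> Y)) p q = powser2 (coef (wave_source e \<beta> Y)) 0 q" for p
    unfolding powser2_def by (rule infsum_cong) (use G in \<open>auto simp: power_0_left\<close>)
  define F where "F = 1 + e * powser2 (coef Y) 0 q"
  have main: "\<beta> * (F + e * \<kappa> * p) + 256 * q * (F + e * \<kappa> * p) ^ 3 = \<beta> * F + 256 * q * F ^ 3"
    if p: "\<bar>p\<bar> \<le> 1 / 32" for p
  proof -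
    have pq: "\<bar>p\<bar> \<le> 1" "\<bar>q\<bar> \<le> 1" using p by (auto simp: q_def)
    have Fp: "1 + e * powser2 (coef Y) p q = F + e * \<kappa> * p"
      using lin[OF p, of q] by (simp add: q_def F_def algebra_simps)
    have "\<beta> * (F + e * \<kappa> * p) + 256 * q * (F + e * \<kappa> * p) ^ 3 = powser2 (coef (wave_source e \<beta> Y)) p q"
      unfolding Fp[symmetric] by (rule powser2_wave_source[OF pq, symmetric])
    also have "\<dots> = powser2 (coef (wave_source e \<beta> Y)) 0 q" by (rule const)
    also have "\<dots> = \<beta> * F + 256 * q * F ^ 3"
      unfolding F_def by (rule powser2_wave_source) (use pq(2) in auto)
    finally show ?thesis .
  qed
  \<comment> \<open>The third difference with step h kills the linear part of \<open>E\<close> and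
    leaves 6 h^3 from the cube. The nodes p = 1 / 100, 2 / 100, 3 / 100 stay below 1 / 32.\<close>
  define h where "h = e * \<kappa> / 100"
  define E where "E x = \<beta> * x + 256 * q * x ^ 3" for x
  have "E (F + h) = E F" "E (F + 2 * h) = E F" "E (F + 3 * h) = E F"
    using main[of "1 / 100"] main[of "2 / 100"] main[of "3 / 100"] by (simp_all add: E_def h_def mult_ac)
  moreover have "E (F + 3 * h) - 3 * E (F + 2 * h) + 3 * E (F + h) - E F = 256 * q * (6 * h ^ 3)"
    by (simp add: E_def power3_eq_cube algebra_simps)
  ultimately have "256 * q * (6 * h ^ 3) = 0" by simp
  then show False using e \<kappa> by (simp add: h_def q_def)
qed

lemma not_zonal_if_not_trivial:
  assumes "\<not> trivial_S2 f"
  shows "\<not> zonal f"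
proof
  assume "zonal f"
  moreover have "in_Y2 (\<lambda>_ _. 0)" unfolding in_Y2_def by (intro exI[of _ "\<lambda>_. 0"]) simp
  ultimately have "trivial_S2 f" unfolding trivial_S2_def by (intro exI[of _ f] exI[of _ "\<lambda>_ _. 0"]) simp
  with assms show False by simp
qed

section \<open>Analyticity\<close>

lemma character_multi_index:
  fixes h :: "'n::finite \<Rightarrow> real"
  assumes "\<And>i. \<bar>h i\<bar> \<le> 1"
  shows "character (\<lambda>\<alpha>. \<Prod>i\<in>UNIV. h i ^ \<alpha> i)"
  unfolding character_def
proof (intro conjI allI)
  show "\<bar>\<Prod>i\<in>UNIV. h i ^ \<alpha> i\<bar> \<le> 1" for \<alpha>
    unfolding abs_prod power_abs by (intro prod_le_1 conjI power_le_one assms) simp_all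
  show "(\<Prod>i\<in>UNIV. h i ^ (\<alpha> + \<beta>) i) = (\<Prod>i\<in>UNIV. h i ^ \<alpha> i) * (\<Prod>i\<in>UNIV. h i ^ \<beta> i)" for \<alpha> \<beta>
    by (simp add: power_add prod.distrib)
qed

definition conv_unit :: "('n \<Rightarrow> nat) l1" where
  "conv_unit = single (\<lambda>_. 0)"

definition coord :: "'n \<Rightarrow> ('n \<Rightarrow> nat) l1" where
  "coord k = single (\<lambda>i. if i = k then 1 else 0)"

lemma eval_l1_coord:
  fixes h :: "'n::finite \<Rightarrow> real"
  shows "eval_l1 (\<lambda>\<alpha>. \<Prod>i\<in>UNIV. h i ^ \<alpha> i) conv_unit = 1"
    and "eval_l1 (\<lambda>\<alpha>. \<Prod>i\<in>UNIV. h i ^ \<alpha> i) (coord k) = h k"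
proof -
  have "(\<Prod>i\<in>UNIV. h i ^ (if i = k then 1 else 0)) = (\<Prod>i\<in>UNIV. if i = k then h i else 1)"
    by (rule prod.cong) auto
  then show "eval_l1 (\<lambda>\<alpha>. \<Prod>i\<in>UNIV. h i ^ \<alpha> i) (coord k) = h k"
    by (simp add: coord_def)
qed (simp add: conv_unit_def)

primrec conv_power :: "('n \<Rightarrow> nat) l1 \<Rightarrow> nat \<Rightarrow> ('n \<Rightarrow> nat) l1" where
  "conv_power X 0 = conv_unit"
| "conv_power X (Suc n) = conv X (conv_power X n)"

lemma norm_conv_power: "norm X \<le> 1 \<Longrightarrow> norm (conv_power X n) \<le> 1"
proof (induction n)
  case (Suc n)
  have "norm (conv X (conv_power X n)) \<le> norm X * norm (conv_power X n)" by (rule norm_conv)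
  also have "\<dots> \<le> 1 * 1" using Suc by (intro mult_mono) auto
  finally show ?case by simp
qed (simp add: conv_unit_def)

text \<open>Composition of power series: for norms at most 1 the sum of a(i, j) X^i V^j converges
  absolutely in the Banach space, and evaluation at h, being continuous and multiplicative, passes
  through it.\<close>

lemma subst_l1:
  fixes X V :: "('n::finite \<Rightarrow> nat) l1" and a :: "(nat \<times> nat) l1"
  assumes X: "norm X \<le> 1" and V: "norm V \<le> 1"
  shows "\<exists>S. \<forall>h. (\<forall>i. \<bar>h i\<bar> \<le> 1) \<longrightarrow> eval_l1 (\<lambda>\<alpha>. \<Prod>i\<in>UNIV. h i ^ \<alpha> i) S
    = powser2 (coef a) (eval_l1 (\<lambda>\<alpha>. \<Prod>i\<in>UNIV. h i ^ \<alpha> i) X) (eval_l1 (\<lambda>\<alpha>. \<Prod>i\<in>UNIV. h i ^ \<alpha> i) V)"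
proof -
  define f where "f = (\<lambda>(i, j). coef a (i, j) *\<^sub>R conv (conv_power X i) (conv_power V j))"
  have "(\<lambda>k. norm (f k)) summable_on UNIV"
  proof (rule Infinite_Sum.abs_summable_on_comparison_test)
    show "(\<lambda>k. norm (coef a k)) summable_on UNIV" using coef_abs_summable[of a UNIV] by simp
    fix k :: "nat \<times> nat"
    obtain i j where k: "k = (i, j)" by (cases k)
    have "norm (conv (conv_power X i) (conv_power V j)) \<le> norm (conv_power X i) * norm (conv_power V j)"
      by (rule norm_conv)
    also have "\<dots> \<le> 1 * 1" by (intro mult_mono norm_conv_power X V) auto
    finally show "norm (f k) \<le> norm (coef a k)" by (simp add: f_def k mult_left_le)
  qed
  then have S: "(f has_sum infsum f UNIV) UNIV"
    by (intro has_sum_infsum) (rule abs_summable_summable)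
  have "eval_l1 (\<lambda>\<alpha>. \<Prod>i\<in>UNIV. h i ^ \<alpha> i) (infsum f UNIV)
      = powser2 (coef a) (eval_l1 (\<lambda>\<alpha>. \<Prod>i\<in>UNIV. h i ^ \<alpha> i) X) (eval_l1 (\<lambda>\<alpha>. \<Prod>i\<in>UNIV. h i ^ \<alpha> i) V)"
    if h: "\<And>i. \<bar>h i\<bar> \<le> 1" for h
  proof -
    define \<xi> where "\<xi> = (\<lambda>\<alpha>. \<Prod>i\<in>UNIV. h i ^ \<alpha> i)"
    have ch: "character \<xi>" unfolding \<xi>_def by (rule character_multi_index[OF h])
    then have lin: "bounded_linear (eval_l1 \<xi>)" by (intro eval_l1_bounded_linear) (simp add: character_def)
    have pw: "eval_l1 \<xi> (conv_power Z n) = eval_l1 \<xi> Z ^ n" for Z n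
      by (induction n) (simp_all add: eval_l1_conv[OF ch] eval_l1_coord \<xi>_def[symmetric], simp add: \<xi>_def eval_l1_coord)
    have "((\<lambda>k. eval_l1 \<xi> (f k)) has_sum eval_l1 \<xi> (infsum f UNIV)) UNIV"
      by (rule has_sum_bounded_linear[OF lin S])
    moreover have "eval_l1 \<xi> (f (i, j)) = coef a (i, j) * eval_l1 \<xi> X ^ i * eval_l1 \<xi> V ^ j" for i j
      by (simp add: f_def linear_scale[OF bounded_linear.linear[OF lin]] eval_l1_conv[OF ch] pw)
    then have "(\<lambda>k. eval_l1 \<xi> (f k)) = (\<lambda>(i, j). coef a (i, j) * eval_l1 \<xi> X ^ i * eval_l1 \<xi> V ^ j)"
      by (simp add: fun_eq_iff)
    ultimately have "eval_l1 \<xi> (infsum f UNIV) = powser2 (coef a) (eval_l1 \<xi> X) (eval_l1 \<xi> V)"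
      unfolding powser2_def by (intro infsumI[symmetric]) simp
    then show ?thesis by (simp add: \<xi>_def)
  qed
  then show ?thesis by blast
qed

text \<open>The extension is the same formula in Cartesian coordinates, with x rotated by \<tau>.
  Around a point of the sphere its two arguments are polynomials in the displacement, of norm at
  most 4 / 16 and 4 / 256 thanks to the weight; hence radius 1 works everywhere.\<close>

lemma analytic_stream: "analytic_S2 (stream c e Y t)"
proof -
  define \<tau> where "\<tau> = c * t"
  define F :: "real ^ 3 \<Rightarrow> real" where "F v = 3 * c / 2 * v $ 3
    + c * e / 2 * (v $ 3 * powser2 (coef Y) ((v $ 1 * cos \<tau> + v $ 2 * sin \<tau>) / 16) ((v $ 3)\<^sup>2 / 256))" for v
  have "stream c e Y t \<theta> \<phi> = F (S2_point \<theta> \<phi>)" for \<theta> \<phi>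
  proof -
    have "sin \<theta> * cos (\<phi> - \<tau>) = sin \<theta> * cos \<phi> * cos \<tau> + sin \<theta> * sin \<phi> * sin \<tau>"
      by (simp add: cos_diff algebra_simps)
    then show ?thesis
      by (simp add: stream_def wave_def perturb_def F_def S2_point_def \<tau>_def[symmetric] algebra_simps)
  qed
  moreover have "real_analytic_at F x" if "x \<in> sphere 0 1" for x
  proof -
    have x: "\<bar>x $ i\<bar> \<le> 1" for i using component_le_norm_cart[of x i] that by simp
    define X :: "(3 \<Rightarrow> nat) l1" where
      "X = (1 / 16) *\<^sub>R ((x $ 1 * cos \<tau> + x $ 2 * sin \<tau>) *\<^sub>R conv_unit + cos \<tau> *\<^sub>R coord 1 + sin \<tau> *\<^sub>R coord 2)"
    define Z :: "(3 \<Rightarrow> nat) l1" where "Z = x $ 3 *\<^sub>R conv_unit + coord 3"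
    have n1: "norm (conv_unit :: (3 \<Rightarrow> nat) l1) = 1" "norm (coord k :: (3 \<Rightarrow> nat) l1) = 1" for k
      by (simp_all add: conv_unit_def coord_def)
    have "\<bar>x $ 1 * cos \<tau> + x $ 2 * sin \<tau>\<bar> \<le> 1 * 1 + 1 * 1"
      using mult_mono[OF x[of 1] abs_cos_le_one[of \<tau>]] mult_mono[OF x[of 2] abs_sin_le_one[of \<tau>]]
      by (intro order_trans[OF abs_triangle_ineq] add_mono) (simp_all add: abs_mult)
    then have "norm ((x $ 1 * cos \<tau> + x $ 2 * sin \<tau>) *\<^sub>R conv_unit + cos \<tau> *\<^sub>R coord 1 + sin \<tau> *\<^sub>R coord 2 :: (3 \<Rightarrow> nat) l1)
        \<le> 2 + 1 + 1"
      by (intro norm_triangle_le add_mono) (simp_all add: n1)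
    then have X: "norm X \<le> 1" by (simp add: X_def)
    have Z2: "norm Z \<le> 1 + 1"
      unfolding Z_def by (intro norm_triangle_le add_mono) (simp_all add: n1 x)
    have V: "norm ((1 / 256) *\<^sub>R conv Z Z) \<le> 1"
      using norm_conv[of Z Z] mult_mono[OF Z2 Z2] by simp
    from subst_l1[OF X V, of Y] obtain S where S: "\<forall>h. (\<forall>i. \<bar>h i\<bar> \<le> 1) \<longrightarrow>
        eval_l1 (\<lambda>\<alpha>. \<Prod>i\<in>UNIV. h i ^ \<alpha> i) S = powser2 (coef Y) (eval_l1 (\<lambda>\<alpha>. \<Prod>i\<in>UNIV. h i ^ \<alpha> i) X)
          (eval_l1 (\<lambda>\<alpha>. \<Prod>i\<in>UNIV. h i ^ \<alpha> i) ((1 / 256) *\<^sub>R conv Z Z))" ..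
    define T where "T = (3 * c / 2) *\<^sub>R Z + (c * e / 2) *\<^sub>R conv Z S"
    have "((\<lambda>\<alpha>. coef T \<alpha> * (\<Prod>i\<in>UNIV. (y $ i - x $ i) ^ \<alpha> i)) has_sum F y) UNIV" if "y \<in> ball x 1" for y
    proof -
      define h where "h i = y $ i - x $ i" for i
      have h: "\<bar>h i\<bar> \<le> 1" for i
        using component_le_norm_cart[of "y - x" i] that by (simp add: h_def dist_norm norm_minus_commute)
      define \<xi> where "\<xi> = (\<lambda>\<alpha>. \<Prod>i\<in>UNIV. h i ^ \<alpha> i)"
      have ch: "character \<xi>" unfolding \<xi>_def by (rule character_multi_index[OF h])
      then have ch1: "\<bar>\<xi> k\<bar> \<le> 1" for k by (simp add: character_def)
      interpret bounded_linear "eval_l1 \<xi>" by (rule eval_l1_bounded_linear[OF ch1])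
      note ev = eval_l1_coord[of h, folded \<xi>_def]
      have eX: "eval_l1 \<xi> X = (y $ 1 * cos \<tau> + y $ 2 * sin \<tau>) / 16"
        unfolding X_def by (simp only: add scaleR ev) (simp add: h_def algebra_simps)
      have eZ: "eval_l1 \<xi> Z = y $ 3"
        unfolding Z_def by (simp only: add scaleR ev) (simp add: h_def)
      have eV: "eval_l1 \<xi> ((1 / 256) *\<^sub>R conv Z Z) = (y $ 3)\<^sup>2 / 256"
        by (simp only: scaleR eval_l1_conv[OF ch] eZ) (simp add: power2_eq_square)
      have eS: "eval_l1 \<xi> S = powser2 (coef Y) ((y $ 1 * cos \<tau> + y $ 2 * sin \<tau>) / 16) ((y $ 3)\<^sup>2 / 256)"
        unfolding eX[symmetric] eV[symmetric] unfolding \<xi>_def by (rule S[rule_format]) (rule h)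
      have "eval_l1 \<xi> T = F y"
        unfolding T_def F_def by (simp only: add scaleR eval_l1_conv[OF ch] eZ eS) simp
      then show ?thesis
        using eval_l1_has_sum(1)[of \<xi> T, OF ch1] by (simp add: \<xi>_def h_def)
    qed
    then show ?thesis unfolding real_analytic_at_def by (intro exI[of _ "coef T"] exI[of _ 1]) auto
  qed
  ultimately show ?thesis unfolding analytic_S2_def by blast
qed

section \<open>Spherical harmonics\<close>

definition coeff_norm :: "real poly \<Rightarrow> real" where
  "coeff_norm p = (\<Sum>i\<le>degree p. \<bar>coeff p i\<bar>)"

lemma coeff_norm_eq: "degree p \<le> d \<Longrightarrow> coeff_norm p = (\<Sum>i\<le>d. \<bar>coeff p i\<bar>)"
  unfolding coeff_norm_def by (rule sum.mono_neutral_left) (auto simp: coeff_eq_0)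

lemma abs_poly_le_coeff_norm:
  assumes "\<bar>x\<bar> \<le> 1"
  shows "\<bar>poly p x\<bar> \<le> coeff_norm p"
proof -
  have "\<bar>poly p x\<bar> \<le> (\<Sum>i\<le>degree p. \<bar>coeff p i * x ^ i\<bar>)"
    unfolding poly_altdef by (rule sum_abs)
  also have "\<dots> \<le> coeff_norm p"
    unfolding coeff_norm_def
    by (intro sum_mono) (use assms in \<open>simp add: abs_mult power_abs mult_left_le power_le_one\<close>)
  finally show ?thesis .
qed

lemma coeff_norm_X2_minus_1_power: "coeff_norm ([:-1, 0, 1:] ^ n) \<le> 2 ^ n"
proof (induction n)
  case (Suc n)
  let ?p = "[:-1, 0, 1:] ^ n :: real poly"
  have eq: "[:-1, 0, 1:] * ?p = pCons 0 (pCons 0 ?p) - ?p" by simp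
  have d: "degree ?p \<le> degree ?p + 2" "degree ([:-1, 0, 1:] * ?p) \<le> degree ?p + 2"
    using degree_mult_le[of "[:-1, 0, 1:]" ?p] by simp_all
  have "coeff_norm ([:-1, 0, 1:] ^ Suc n) = (\<Sum>i\<le>degree ?p + 2. \<bar>coeff (pCons 0 (pCons 0 ?p) - ?p) i\<bar>)"
    using coeff_norm_eq[OF d(2)] eq by simp
  also have "\<dots> \<le> (\<Sum>i\<le>degree ?p + 2. \<bar>coeff (pCons 0 (pCons 0 ?p)) i\<bar>) + (\<Sum>i\<le>degree ?p + 2. \<bar>coeff ?p i\<bar>)"
    unfolding sum.distrib[symmetric] coeff_diff by (intro sum_mono abs_triangle_ineq4)
  also have "(\<Sum>i\<le>degree ?p + 2. \<bar>coeff (pCons 0 (pCons 0 ?p)) i\<bar>) = coeff_norm ?p"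
    by (simp add: sum.atMost_Suc_shift coeff_norm_def del: sum.atMost_Suc)
  also have "(\<Sum>i\<le>degree ?p + 2. \<bar>coeff ?p i\<bar>) = coeff_norm ?p"
    by (rule coeff_norm_eq[symmetric]) simp
  finally show ?case using Suc by simp
qed (simp add: coeff_norm_def)

text \<open>The factor is the one that the top power x^d acquires; lower powers acquire smaller
  ones.\<close>

lemma coeff_norm_higher_pderiv:
  assumes "degree p \<le> d" "k \<le> d"
  shows "coeff_norm ((pderiv ^^ k) p) \<le> fact d / fact (d - k) * coeff_norm p"
proof -
  have deg: "degree ((pderiv ^^ k) p) \<le> d - k"
    using assms by (intro degree_le) (simp add: coeff_higher_pderiv coeff_eq_0)
  have "coeff_norm ((pderiv ^^ k) p) = (\<Sum>i\<le>d - k. \<bar>pochhammer (real (Suc i)) k * coeff p (i + k)\<bar>)"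
    unfolding coeff_norm_eq[OF deg] coeff_higher_pderiv ..
  also have "\<dots> \<le> (\<Sum>i\<le>d - k. fact d / fact (d - k) * \<bar>coeff p (i + k)\<bar>)"
  proof (rule sum_mono)
    fix i assume i: "i \<in> {..d - k}"
    have "pochhammer (real (Suc i)) k \<le> pochhammer (real (Suc (d - k))) k"
      unfolding pochhammer_prod by (intro prod_mono) (use i in auto)
    also have "\<dots> = fact d / fact (d - k)"
    proof -
      have "(fact d :: real) = fact (d - k) * pochhammer (real (Suc (d - k))) k"
        using pochhammer_product'[of "1::real" "d - k" k] assms(2)
        by (simp add: pochhammer_fact add.commute)
      then show ?thesis by simp
    qed
    finally have *: "pochhammer (real (Suc i)) k \<le> fact d / fact (d - k)" .
    have "pochhammer (real (Suc i)) k \<ge> 0" by (rule pochhammer_nonneg) simp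
    with * show "\<bar>pochhammer (real (Suc i)) k * coeff p (i + k)\<bar> \<le> fact d / fact (d - k) * \<bar>coeff p (i + k)\<bar>"
      by (simp only: abs_mult abs_of_nonneg) (rule mult_right_mono[OF *], simp)
  qed
  also have "\<dots> = fact d / fact (d - k) * (\<Sum>i\<in>(\<lambda>i. i + k) ` {..d - k}. \<bar>coeff p i\<bar>)"
    by (subst sum.reindex) (auto simp: sum_distrib_left)
  also have "\<dots> \<le> fact d / fact (d - k) * (\<Sum>i\<le>d. \<bar>coeff p i\<bar>)"
    by (intro mult_left_mono sum_mono2) (use assms in auto)
  finally show ?thesis by (simp add: coeff_norm_eq[OF assms(1)])
qed

lemma degree_X2_minus_1_power: "degree ([:-1, 0, 1:] ^ n :: real poly) = 2 * n"
  by (simp add: degree_power_eq)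

lemma higher_pderiv_legendre:
  "(pderiv ^^ m) (legendre_poly n) = smult (1 / (2 ^ n * fact n)) ((pderiv ^^ (m + n)) ([:-1, 0, 1:] ^ n))"
  by (simp add: legendre_poly_def higher_pderiv_smult funpow_add)

lemma abs_legendre_assoc_le:
  assumes "m \<le> n"
  shows "\<bar>legendre_assoc n m \<theta>\<bar> \<le> fact (2 * n) / (fact n * fact (n - m))"
proof -
  have "coeff_norm ((pderiv ^^ (m + n)) ([:-1, 0, 1:] ^ n))
      \<le> fact (2 * n) / fact (2 * n - (m + n)) * coeff_norm ([:-1, 0, 1:] ^ n)"
    using assms by (intro coeff_norm_higher_pderiv) (auto simp: degree_X2_minus_1_power)
  also have "\<dots> \<le> fact (2 * n) / fact (2 * n - (m + n)) * 2 ^ n"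
    by (intro mult_left_mono coeff_norm_X2_minus_1_power) auto
  also have "2 * n - (m + n) = n - m" by simp
  finally have c: "coeff_norm ((pderiv ^^ (m + n)) ([:-1, 0, 1:] ^ n)) \<le> fact (2 * n) / fact (n - m) * 2 ^ n" .
  have "\<bar>legendre_assoc n m \<theta>\<bar> \<le> 1 * \<bar>poly ((pderiv ^^ m) (legendre_poly n)) (cos \<theta>)\<bar>"
    unfolding legendre_assoc_def abs_mult by (intro mult_right_mono) (auto simp: power_abs power_le_one)
  also have "\<dots> = 1 / (2 ^ n * fact n) * \<bar>poly ((pderiv ^^ (m + n)) ([:-1, 0, 1:] ^ n)) (cos \<theta>)\<bar>"
    by (simp add: higher_pderiv_legendre abs_mult)
  also have "\<dots> \<le> 1 / (2 ^ n * fact n) * (fact (2 * n) / fact (n - m) * 2 ^ n)"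
    by (intro mult_left_mono order_trans[OF abs_poly_le_coeff_norm c]) auto
  also have "\<dots> = fact (2 * n) / (fact n * fact (n - m))" by simp
  finally show ?thesis .
qed

text \<open>The squared normalisation times the squared bound of the Legendre function is a product
  of two binomial coefficients of row 2 n, each at most 4^n; the root is taken afterwards.\<close>

lemma abs_sph_harm_le:
  assumes "nat \<bar>m\<bar> \<le> n"
  shows "\<bar>sph_harm n m \<theta> \<phi>\<bar> \<le> real (2 * n + 1) * 4 ^ n"
proof -
  define k where "k = nat \<bar>m\<bar>"
  have k: "k \<le> n" using assms by (simp add: k_def)
  define B where "B = (fact (2 * n) / (fact n * fact (n - k)) :: real)"
  have B0: "B \<ge> 0" by (simp add: B_def)
  have "fact (n - k) / fact (n + k) * B\<^sup>2
      = (fact (2 * n) / (fact n * fact (2 * n - n))) * (fact (2 * n) / (fact (n - k) * fact (2 * n - (n - k))))"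
  proof -
    have e: "2 * n - n = n" "2 * n - (n - k) = n + k" using k by auto
    show ?thesis unfolding e B_def by (simp add: power2_eq_square)
  qed
  also have "\<dots> = real (2 * n choose n) * real (2 * n choose (n - k))"
    by (subst (1 2) binomial_fact) (use k in auto)
  also have "\<dots> \<le> 2 ^ (2 * n) * 2 ^ (2 * n)"
  proof (intro mult_mono)
    have *: "real (2 * n choose j) \<le> 2 ^ (2 * n)" for j
      using of_nat_mono[OF binomial_le_pow2[of "2 * n" j], where 'a = real] by simp
    show "real (2 * n choose n) \<le> 2 ^ (2 * n)" "real (2 * n choose (n - k)) \<le> 2 ^ (2 * n)" by (rule *)+
  qed auto
  also have "\<dots> = (4 ^ n)\<^sup>2" by (simp add: power_mult power2_eq_square)
  finally have 1: "fact (n - k) / fact (n + k) * B\<^sup>2 \<le> (4 ^ n)\<^sup>2" .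
  define N where "N = sqrt ((2 * real n + 1) / (4 * pi) * fact (n - k) / fact (n + k))"
  have "N * B = sqrt ((2 * real n + 1) / (4 * pi)) * sqrt (fact (n - k) / fact (n + k) * B\<^sup>2)"
    using B0 by (simp add: N_def real_sqrt_mult real_sqrt_divide)
  also have "\<dots> \<le> sqrt ((2 * real n + 1) / (4 * pi)) * 4 ^ n"
    using real_sqrt_le_mono[OF 1] by (intro mult_left_mono) auto
  finally have 2: "N * B \<le> sqrt ((2 * real n + 1) / (4 * pi)) * 4 ^ n" .
  have N0: "N \<ge> 0" by (simp add: N_def)
  have "\<bar>sph_harm n m \<theta> \<phi>\<bar> = N * \<bar>legendre_assoc n k \<theta>\<bar> * \<bar>if m = 0 then 1
        else if m > 0 then sqrt 2 * cos (real_of_int m * \<phi>) else sqrt 2 * sin (real_of_int \<bar>m\<bar> * \<phi>)\<bar>"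
    using N0 by (simp only: sph_harm_def k_def[symmetric] N_def[symmetric] abs_mult abs_of_nonneg)
  also have "\<dots> \<le> N * B * sqrt 2"
  proof (intro mult_mono)
    show "\<bar>legendre_assoc n k \<theta>\<bar> \<le> B" unfolding B_def by (rule abs_legendre_assoc_le[OF k])
  qed (use N0 B0 in \<open>auto simp: abs_mult mult_left_le\<close>)
  also have "\<dots> \<le> (sqrt ((2 * real n + 1) / (4 * pi)) * 4 ^ n) * sqrt 2"
    using 2 by (intro mult_right_mono) auto
  also have "\<dots> = sqrt ((2 * real n + 1) / (4 * pi) * 2) * 4 ^ n"
    by (simp only: real_sqrt_mult mult_ac)
  also have "(2 * real n + 1) / (4 * pi) * 2 = (2 * real n + 1) / (2 * pi)"
    by (simp add: field_simps)
  also have "sqrt ((2 * real n + 1) / (2 * pi)) * 4 ^ n \<le> real (2 * n + 1) * 4 ^ n"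
  proof (intro mult_right_mono real_le_lsqrt)
    have "(2 * real n + 1) / (2 * pi) \<le> (2 * real n + 1) / 1"
      using pi_gt3 by (intro divide_left_mono) auto
    also have "\<dots> \<le> (real (2 * n + 1))\<^sup>2" by (simp add: power2_eq_square algebra_simps)
    finally show "(2 * real n + 1) / (2 * pi) \<le> (real (2 * n + 1))\<^sup>2" .
  qed auto
  finally show ?thesis .
qed

section \<open>Orthogonality to polynomials of lower degree\<close>

definition zint :: "real poly \<Rightarrow> real" where
  "zint p = integral {0..pi} (\<lambda>\<theta>. poly p (cos \<theta>) * sin \<theta>)"

lemma zint_integrable: "(\<lambda>\<theta>. poly p (cos \<theta>) * sin \<theta>) integrable_on {0..pi}"
  by (intro integrable_continuous_interval continuous_intros)

lemma zint_pderiv: "zint (pderiv w) = poly w 1 - poly w (- 1)"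
proof -
  have "((\<lambda>\<theta>. poly (pderiv w) (cos \<theta>) * sin \<theta>) has_integral (- poly w (cos pi)) - (- poly w (cos 0))) {0..pi}"
  proof (rule fundamental_theorem_of_calculus)
    fix x
    have "((\<lambda>x. poly w (cos x)) has_real_derivative poly (pderiv w) (cos x) * (- sin x)) (at x)"
      by (rule DERIV_chain2[OF poly_DERIV DERIV_cos])
    from DERIV_minus[OF this]
    have "((\<lambda>x. - poly w (cos x)) has_real_derivative poly (pderiv w) (cos x) * sin x) (at x)"
      by simp
    then show "((\<lambda>x. - poly w (cos x)) has_vector_derivative poly (pderiv w) (cos x) * sin x) (at x within {0..pi})"
      unfolding has_real_derivative_iff_has_vector_derivative by (rule has_vector_derivative_at_within)
  qed auto
  then show ?thesis by (simp add: zint_def integral_unique)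
qed

lemma zint_add: "zint (p + q) = zint p + zint q"
  unfolding zint_def poly_add distrib_right by (rule integral_add) (rule zint_integrable)+

text \<open>The assumption lists the boundary terms of the N successive integrations by
  parts.\<close>

lemma zint_by_parts:
  assumes "\<And>k x. k < N \<Longrightarrow> x = 1 \<or> x = -1 \<Longrightarrow> poly ((pderiv ^^ k) r) x * poly ((pderiv ^^ (N - 1 - k)) p) x = 0"
  shows "zint (r * (pderiv ^^ N) p) = (- 1) ^ N * zint ((pderiv ^^ N) r * p)"
  using assms
proof (induction N arbitrary: r)
  case (Suc N)
  have "zint (r * (pderiv ^^ Suc N) p) + zint (pderiv r * (pderiv ^^ N) p) = zint (pderiv (r * (pderiv ^^ N) p))"
    by (simp add: zint_add[symmetric] pderiv_mult algebra_simps)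
  also have "\<dots> = 0"
    using Suc.prems[of 0 1] Suc.prems[of 0 "-1"] by (auto simp: zint_pderiv)
  finally have "zint (r * (pderiv ^^ Suc N) p) = - zint (pderiv r * (pderiv ^^ N) p)" by simp
  also have "zint (pderiv r * (pderiv ^^ N) p) = (- 1) ^ N * zint ((pderiv ^^ N) (pderiv r) * p)"
  proof (rule Suc.IH)
    fix k and x :: real assume k: "k < N" "x = 1 \<or> x = - 1"
    show "poly ((pderiv ^^ k) (pderiv r)) x * poly ((pderiv ^^ (N - 1 - k)) p) x = 0"
      using Suc.prems[of "Suc k" x] k by (simp add: funpow_Suc_right del: funpow.simps)
  qed
  finally show ?case by (simp add: funpow_Suc_right del: funpow.simps)
qed simp

lemma poly_higher_pderiv_power_eq_0:
  fixes w v :: "real poly"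
  assumes "poly w x = 0" "j < n"
  shows "poly ((pderiv ^^ j) (w ^ n * v)) x = 0"
  using assms(2)
proof (induction j arbitrary: n v)
  case 0
  then show ?case using assms(1) by (simp add: power_0_left)
next
  case (Suc j)
  then obtain n' where n: "n = Suc n'" by (cases n) auto
  have "pderiv (w ^ n * v) = w ^ n' * (smult (of_nat n) (pderiv w) * v + w * pderiv v)"
    by (simp only: n pderiv_mult pderiv_power_Suc) (simp add: algebra_simps del: of_nat_Suc)
  then show ?case using Suc n by (simp add: funpow_Suc_right del: funpow.simps)
qed

text \<open>By Rodrigues' formula m + n derivatives can be moved onto a polynomial of degree i + m +
  k < m + n, which they annihilate. The evenness of i + m makes the powers of the sine a polynomial
  in the cosine.\<close>

lemma zint_legendre_orthogonal:
  assumes mi: "m \<le> i" and ev: "even (i + m)" and n: "i + k < n"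
  shows "zint ([:1, 0, -1:] ^ ((i + m) div 2) * ([:0, 1:] ^ k * (pderiv ^^ m) (legendre_poly n))) = 0"
proof -
  define r :: "real poly" where "r = [:1, 0, -1:] ^ ((i + m) div 2) * [:0, 1:] ^ k"
  define p :: "real poly" where "p = [:-1, 0, 1:] ^ n"
  have deg: "degree r < m + n"
  proof -
    have "degree ([:1, 0, -1:] ^ a :: real poly) \<le> 2 * a" "degree ([:0, 1:] ^ a :: real poly) \<le> a" for a
      using degree_power_le[of "[:1, 0, -1:] :: real poly" a] degree_power_le[of "[:0, 1:] :: real poly" a]
      by simp_all
    then have "degree r \<le> 2 * ((i + m) div 2) + k"
      unfolding r_def by (intro order_trans[OF degree_mult_le] add_mono)
    with ev n show ?thesis by auto
  qed
  have "zint (r * (pderiv ^^ (m + n)) p) = (- 1) ^ (m + n) * zint ((pderiv ^^ (m + n)) r * p)"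
  proof (rule zint_by_parts)
    fix j and x :: real assume j: "j < m + n" and x: "x = 1 \<or> x = -1"
    show "poly ((pderiv ^^ j) r) x * poly ((pderiv ^^ (m + n - 1 - j)) p) x = 0"
    \<comment> \<open>For j < m the boundary term vanishes through the zeros of \<open>r\<close> at
      1 and -1, of order at least (i + m) / 2 >= m; for j >= m at most n - 1 derivatives fall on the
      n-fold zeros of \<open>p\<close>.\<close>
    proof (cases "j < m")
      case True
      then have "poly ((pderiv ^^ j) r) x = 0"
        unfolding r_def using x mi ev by (intro poly_higher_pderiv_power_eq_0) auto
      then show ?thesis by simp
    next
      case False
      then have "poly ((pderiv ^^ (m + n - 1 - j)) (p * 1)) x = 0"
        unfolding p_def using x j by (intro poly_higher_pderiv_power_eq_0) auto
      then show ?thesis by simp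
    qed
  qed
  also have "(pderiv ^^ (m + n)) r = 0"
    using deg by (intro poly_eqI) (simp add: coeff_higher_pderiv coeff_eq_0)
  finally have "zint (r * (pderiv ^^ (m + n)) p) = 0" by (simp add: zint_def)
  moreover have "zint (smult c q) = c * zint q" for c q
    unfolding zint_def by (simp add: mult.assoc)
  moreover have "[:1, 0, -1:] ^ ((i + m) div 2) * ([:0, 1:] ^ k * (pderiv ^^ m) (legendre_poly n))
      = smult (1 / (2 ^ n * fact n)) (r * (pderiv ^^ (m + n)) p)"
    by (simp add: r_def p_def higher_pderiv_legendre mult_ac)
  ultimately show ?thesis by simp
qed

text \<open>The i-th power of a cosine contains only the frequencies i, i - 2, ..., -i. The phases
  \<tau> and \<delta> are carried along so that the product formula closes the induction.\<close>

lemma integral_cos_power_cos: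
  fixes m :: int
  assumes "\<bar>m\<bar> > int i \<or> odd (int i + m)"
  shows "((\<lambda>\<phi>. cos (\<phi> - \<tau>) ^ i * cos (real_of_int m * \<phi> + \<delta>)) has_integral 0) {0..2 * pi}"
  using assms
proof (induction i arbitrary: m \<delta>)
  case 0
  then have m: "m \<noteq> 0" by auto
  have "((\<lambda>\<phi>. cos (real_of_int m * \<phi> + \<delta>)) has_integral
      sin (real_of_int m * (2 * pi) + \<delta>) / real_of_int m - sin (real_of_int m * 0 + \<delta>) / real_of_int m) {0..2 * pi}"
    by (rule fundamental_theorem_of_calculus)
      (use m in \<open>auto simp: has_real_derivative_iff_has_vector_derivative[symmetric] intro!: derivative_eq_intros\<close>)
  moreover have "sin (real_of_int m * (2 * pi) + \<delta>) = sin \<delta>"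
    using sin_int_2pin[of m] cos_int_2pin[of m] by (simp add: sin_add mult_ac)
  ultimately show ?case by simp
next
  case (Suc i)
  have eq: "cos (\<phi> - \<tau>) ^ Suc i * cos (real_of_int m * \<phi> + \<delta>)
    = 1 / 2 * (cos (\<phi> - \<tau>) ^ i * cos (real_of_int (m + 1) * \<phi> + (\<delta> - \<tau>)))
    + 1 / 2 * (cos (\<phi> - \<tau>) ^ i * cos (real_of_int (m - 1) * \<phi> + (\<delta> + \<tau>)))" for \<phi>
  proof -
    have "cos (real_of_int m * \<phi> + \<delta>) * cos (\<phi> - \<tau>)
        = (cos ((real_of_int m * \<phi> + \<delta>) - (\<phi> - \<tau>)) + cos ((real_of_int m * \<phi> + \<delta>) + (\<phi> - \<tau>))) / 2"
      by (rule cos_times_cos)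
    also have "(real_of_int m * \<phi> + \<delta>) - (\<phi> - \<tau>) = real_of_int (m - 1) * \<phi> + (\<delta> + \<tau>)"
      by (simp add: algebra_simps)
    also have "(real_of_int m * \<phi> + \<delta>) + (\<phi> - \<tau>) = real_of_int (m + 1) * \<phi> + (\<delta> - \<tau>)"
      by (simp add: algebra_simps)
    finally have P: "cos (real_of_int m * \<phi> + \<delta>) * cos (\<phi> - \<tau>)
        = (cos (real_of_int (m - 1) * \<phi> + (\<delta> + \<tau>)) + cos (real_of_int (m + 1) * \<phi> + (\<delta> - \<tau>))) / 2" .
    have "cos (\<phi> - \<tau>) ^ Suc i * cos (real_of_int m * \<phi> + \<delta>)
        = cos (\<phi> - \<tau>) ^ i * (cos (real_of_int m * \<phi> + \<delta>) * cos (\<phi> - \<tau>))" by simp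
    then show ?thesis unfolding P by (simp add: algebra_simps add_divide_distrib)
  qed
  have 1: "((\<lambda>\<phi>. cos (\<phi> - \<tau>) ^ i * cos (real_of_int (m + 1) * \<phi> + (\<delta> - \<tau>))) has_integral 0) {0..2 * pi}"
    by (rule Suc.IH) (use Suc.prems in auto)
  have 2: "((\<lambda>\<phi>. cos (\<phi> - \<tau>) ^ i * cos (real_of_int (m - 1) * \<phi> + (\<delta> + \<tau>))) has_integral 0) {0..2 * pi}"
    by (rule Suc.IH) (use Suc.prems in auto)
  show ?case unfolding eq
    using has_integral_add[OF has_integral_mult_right[OF 1, of "1 / 2"] has_integral_mult_right[OF 2, of "1 / 2"]]
    by simp
qed

section \<open>The Gevrey norm\<close>

text \<open>A phase of 0 or -pi / 2 merges cosine and sine harmonics, so one longitude integral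
  serves both.\<close>

lemma sph_harm_form:
  "\<exists>a \<delta>. \<forall>\<theta> \<phi>. sph_harm n m \<theta> \<phi> = a * legendre_assoc n (nat \<bar>m\<bar>) \<theta> * cos (real_of_int \<bar>m\<bar> * \<phi> + \<delta>)"
proof -
  define N where "N = sqrt ((2 * real n + 1) / (4 * pi) * fact (n - nat \<bar>m\<bar>) / fact (n + nat \<bar>m\<bar>))"
  have s: "sph_harm n m \<theta> \<phi> = N * legendre_assoc n (nat \<bar>m\<bar>) \<theta> * (if m = 0 then 1
        else if m > 0 then sqrt 2 * cos (real_of_int m * \<phi>) else sqrt 2 * sin (real_of_int \<bar>m\<bar> * \<phi>))" for \<theta> \<phi>
    by (simp only: sph_harm_def N_def)
  consider "m = 0" | "m > 0" | "m < 0" by linarith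
  then show ?thesis
  proof cases
    case 1
    show ?thesis by (intro exI[of _ N] exI[of _ 0] allI, subst s) (simp add: 1)
  next
    case 2
    show ?thesis by (intro exI[of _ "N * sqrt 2"] exI[of _ 0] allI, subst s) (use 2 in simp)
  next
    case 3
    show ?thesis by (intro exI[of _ "N * sqrt 2"] exI[of _ "- (pi / 2)"] allI, subst s)
      (use 3 in \<open>simp add: cos_diff\<close>)
  qed
qed

lemma continuous_on_sph_harm: "continuous_on A (\<lambda>x. sph_harm n m (fst x) (snd x))"
proof -
  obtain a \<delta> where s: "\<And>\<theta> \<phi>. sph_harm n m \<theta> \<phi> = a * legendre_assoc n (nat \<bar>m\<bar>) \<theta> * cos (real_of_int \<bar>m\<bar> * \<phi> + \<delta>)"
    using sph_harm_form[of n m] by blast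
  show ?thesis unfolding s legendre_assoc_def by (intro continuous_intros)
qed

lemma box_eq: "{0..pi} \<times> {0..2 * pi} = cbox (0, 0) (pi, 2 * pi)"
  by (simp add: cbox_Pair_eq)

text \<open>The integral factors. Either the longitude part vanishes by frequency, or the order is
  at most i and of the same parity, and then the colatitude part vanishes by
  \<open>zint_legendre_orthogonal\<close>.\<close>

lemma monomial_orthogonal:
  assumes ik: "i + k < n" and m: "nat \<bar>m\<bar> \<le> n"
  shows "((\<lambda>x. (sin (fst x) * cos (snd x - \<tau>)) ^ i * cos (fst x) ^ k * sph_harm n m (fst x) (snd x) * sin (fst x))
    has_integral 0) (cbox (0, 0) (pi, 2 * pi))" (is "(?F has_integral 0) _")
proof -
  obtain a \<delta> where s: "\<And>\<theta> \<phi>. sph_harm n m \<theta> \<phi> = a * legendre_assoc n (nat \<bar>m\<bar>) \<theta> * cos (real_of_int \<bar>m\<bar> * \<phi> + \<delta>)"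
    using sph_harm_form[of n m] by blast
  define M where "M = nat \<bar>m\<bar>"
  define f where "f \<theta> = a * (sin \<theta> ^ i * cos \<theta> ^ k * legendre_assoc n M \<theta> * sin \<theta>)" for \<theta>
  define g where "g \<phi> = cos (\<phi> - \<tau>) ^ i * cos (real_of_int \<bar>m\<bar> * \<phi> + \<delta>)" for \<phi>
  have cont: "continuous_on (cbox (0, 0) (pi, 2 * pi)) ?F"
    by (intro continuous_intros continuous_on_sph_harm)
  have F: "?F (\<theta>, \<phi>) = f \<theta> * g \<phi>" for \<theta> \<phi>
    by (simp add: f_def g_def s M_def power_mult_distrib)
  have "integral (cbox (0, 0) (pi, 2 * pi)) ?F = integral (cbox 0 pi) (\<lambda>\<theta>. integral (cbox 0 (2 * pi)) (\<lambda>\<phi>. f \<theta> * g \<phi>))"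
    using integral_prod_continuous[OF cont] unfolding F .
  also have "\<dots> = integral {0..pi} f * integral {0..2 * pi} g" by simp
  also have "\<dots> = 0"
  proof (cases "\<bar>m\<bar> > int i \<or> odd (int i + \<bar>m\<bar>)")
    case True
    then have "(g has_integral 0) {0..2 * pi}"
      unfolding g_def by (intro integral_cos_power_cos) auto
    then show ?thesis by (simp add: integral_unique)
  next
    case False
    then have Mi: "M \<le> i" and ev: "even (i + M)"
      by (auto simp: M_def even_nat_iff)
    have "f \<theta> = a * (poly ([:1, 0, -1:] ^ ((i + M) div 2) * ([:0, 1:] ^ k * (pderiv ^^ M) (legendre_poly n))) (cos \<theta>) * sin \<theta>)" for \<theta>
    proof -
      have "sin \<theta> ^ i * sin \<theta> ^ M = ((sin \<theta>)\<^sup>2) ^ ((i + M) div 2)"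
        using ev by (simp add: power_add[symmetric] power_mult[symmetric])
      also have "(sin \<theta>)\<^sup>2 = poly [:1, 0, -1:] (cos \<theta>)"
        using sin_cos_squared_add[of \<theta>] by (simp add: power2_eq_square)
      finally show ?thesis
        by (simp add: f_def legendre_assoc_def poly_power mult_ac)
    qed
    then have f: "f = (\<lambda>\<theta>. a * (poly ([:1, 0, -1:] ^ ((i + M) div 2) * ([:0, 1:] ^ k * (pderiv ^^ M) (legendre_poly n))) (cos \<theta>) * sin \<theta>))"
      by (rule ext)
    have "integral {0..pi} f = a * zint ([:1, 0, -1:] ^ ((i + M) div 2) * ([:0, 1:] ^ k * (pderiv ^^ M) (legendre_poly n)))"
      unfolding f zint_def by (rule integral_mult_right)
    then show ?thesis using zint_legendre_orthogonal[OF Mi ev ik] by simp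
  qed
  finally have "integral (cbox (0, 0) (pi, 2 * pi)) ?F = 0" .
  moreover have "(?F has_integral integral (cbox (0, 0) (pi, 2 * pi)) ?F) (cbox (0, 0) (pi, 2 * pi))"
    by (rule integrable_integral[OF integrable_continuous[OF cont]])
  ultimately show ?thesis by (simp only:)
qed

definition perturb_trunc :: "(nat \<times> nat) l1 \<Rightarrow> nat \<Rightarrow> real \<Rightarrow> real \<Rightarrow> real" where
  "perturb_trunc Y n \<theta> \<phi> = (\<Sum>(i, j)\<in>{(i, j). i + 2 * j + 1 < n}.
     coef Y (i, j) * (1 / 16) ^ i * (1 / 256) ^ j * ((sin \<theta> * cos \<phi>) ^ i * cos \<theta> ^ (2 * j + 1)))"

lemma finite_low_degree: "finite {(i, j). i + 2 * j + 1 < (n::nat)}"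
  by (rule finite_subset[of _ "{..n} \<times> {..n}"]) auto

text \<open>Every omitted term has degree d = i + 2 j + 1 >= n, and 16^-i 256^-j = 16 *
  16^-d.\<close>

lemma perturb_truncation: "\<bar>perturb (coef Y) \<theta> \<phi> - perturb_trunc Y n \<theta> \<phi>\<bar> \<le> 16 * norm Y * (1 / 16) ^ n"
proof -
  let ?I = "{(i, j). i + 2 * j + 1 < n}"
  define w :: "nat \<times> nat \<Rightarrow> real" where
    "w = (\<lambda>(i, j). if i + 2 * j + 1 < n then 0 else (1 / 16) ^ i * (1 / 256) ^ j)"
  have w: "\<bar>w k\<bar> \<le> 16 * (1 / 16) ^ n" for k
  proof -
    obtain i j where k: "k = (i, j)" by (cases k)
    have "(1 / 16 :: real) ^ i * (1 / 256) ^ j = 16 * (1 / 16) ^ (i + 2 * j + 1)"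
      by (simp add: power_add power_mult power2_eq_square)
    moreover have "(1 / 16 :: real) ^ (i + 2 * j + 1) \<le> (1 / 16) ^ n" if "\<not> i + 2 * j + 1 < n"
      using that by (intro power_decreasing) auto
    ultimately show ?thesis by (auto simp: w_def k)
  qed
  define Z where "Z = wpull w (\<lambda>k. k) Y"
  have Z: "coef Z k = w k * coef Y k" "norm Z \<le> 16 * (1 / 16) ^ n * norm Y" for k
    using coef_wpull[of w, OF w, of "\<lambda>k. k"] norm_wpull[of w, OF w, of "\<lambda>k. k"] by (simp_all add: Z_def)
  define p q where "p = sin \<theta> * cos \<phi>" and "q = (cos \<theta>)\<^sup>2"
  have pq: "\<bar>p\<bar> \<le> 1" "\<bar>q\<bar> \<le> 1" using abs_trig_mult_le(1) cos_sq_le by (auto simp: p_def q_def)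
  define \<xi> where "\<xi> = (\<lambda>(i, j). p ^ i * q ^ j)"
  have \<xi>: "\<bar>\<xi> k\<bar> \<le> 1" for k using character_monomial[OF pq] by (cases k) (auto simp: character_def \<xi>_def)
  define P where "P = (\<Sum>(i, j)\<in>?I. coef Y (i, j) * (p / 16) ^ i * (q / 256) ^ j)"
  have 1: "((\<lambda>k. if k \<in> ?I then (case k of (i, j) \<Rightarrow> coef Y (i, j) * (p / 16) ^ i * (q / 256) ^ j) else 0) has_sum P) UNIV"
    by (rule has_sum_finite_neutralI[OF finite_low_degree]) (auto simp: P_def intro!: sum.cong)
  have "((\<lambda>k. (if k \<in> ?I then (case k of (i, j) \<Rightarrow> coef Y (i, j) * (p / 16) ^ i * (q / 256) ^ j) else 0)
      + coef Z k * \<xi> k) has_sum (P + eval_l1 \<xi> Z)) UNIV"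
    by (rule has_sum_add[OF 1 eval_l1_has_sum(1)[of \<xi>, OF \<xi>]])
  also have "(\<lambda>k. (if k \<in> ?I then (case k of (i, j) \<Rightarrow> coef Y (i, j) * (p / 16) ^ i * (q / 256) ^ j) else 0)
      + coef Z k * \<xi> k) = (\<lambda>(i, j). coef Y (i, j) * (p / 16) ^ i * (q / 256) ^ j)"
    by (auto simp: fun_eq_iff Z \<xi>_def w_def power_divide)
  finally have powser2: "powser2 (coef Y) (p / 16) (q / 256) = P + eval_l1 \<xi> Z"
    unfolding powser2_def by (rule infsumI)
  have "perturb_trunc Y n \<theta> \<phi> = cos \<theta> * P"
    unfolding perturb_trunc_def P_def sum_distrib_left p_def q_def
    by (rule sum.cong) (auto simp: power_divide power_mult)
  moreover have "perturb (coef Y) \<theta> \<phi> = cos \<theta> * (P + eval_l1 \<xi> Z)"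
    using powser2 by (simp add: perturb_def p_def q_def)
  ultimately have "\<bar>perturb (coef Y) \<theta> \<phi> - perturb_trunc Y n \<theta> \<phi>\<bar> = \<bar>cos \<theta>\<bar> * \<bar>eval_l1 \<xi> Z\<bar>"
    by (simp add: algebra_simps abs_mult)
  also have "\<dots> \<le> 1 * norm Z" by (intro mult_mono eval_l1_has_sum(2) \<xi>) auto
  also have "\<dots> \<le> 16 * norm Y * (1 / 16) ^ n" using Z(2) by (simp add: mult_ac)
  finally show ?thesis .
qed

lemma continuous_on_perturb_trunc: "continuous_on A (\<lambda>x. perturb_trunc Y n (fst x) (snd x - \<tau>))"
  unfolding perturb_trunc_def case_prod_unfold by (intro continuous_intros)

lemma continuous_on_perturb: "continuous_on A (\<lambda>x. perturb (coef Y) (fst x) (snd x - \<tau>))"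
proof (rule uniform_limit_theorem)
  show "\<forall>\<^sub>F n in sequentially. continuous_on A (\<lambda>x. perturb_trunc Y n (fst x) (snd x - \<tau>))"
    by (simp add: continuous_on_perturb_trunc)
  show "uniform_limit A (\<lambda>n x. perturb_trunc Y n (fst x) (snd x - \<tau>)) (\<lambda>x. perturb (coef Y) (fst x) (snd x - \<tau>)) sequentially"
  proof (rule uniform_limitI)
    fix e :: real assume "e > 0"
    have "(\<lambda>n. 16 * norm Y * (1 / 16) ^ n) \<longlonglongrightarrow> 16 * norm Y * 0"
      by (intro tendsto_mult tendsto_const LIMSEQ_realpow_zero) auto
    then have "\<forall>\<^sub>F n in sequentially. 16 * norm Y * (1 / 16) ^ n < e"
      using \<open>e > 0\<close> by (auto dest: order_tendstoD(2))
    then show "\<forall>\<^sub>F n in sequentially. \<forall>x\<in>A. dist (perturb_trunc Y n (fst x) (snd x - \<tau>)) (perturb (coef Y) (fst x) (snd x - \<tau>)) < e"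
    proof eventually_elim
      case (elim n)
      then show ?case
        using perturb_truncation[of Y _ _ n] by (auto simp: dist_real_def abs_minus_commute intro: le_less_trans)
    qed
  qed
qed simp

text \<open>A harmonic of degree n does not see the truncation below degree n. The remainder gains
  16^-n, the harmonic costs 4^n, and 32 pi^2 is 16 times the area of the coordinate
  rectangle.\<close>

lemma sph_coeff_perturb_le:
  assumes m: "nat \<bar>m\<bar> \<le> n"
  shows "\<bar>sph_coeff (\<lambda>\<theta> \<phi>. B * perturb (coef Y) \<theta> (\<phi> - \<tau>)) n m\<bar>
    \<le> 32 * pi\<^sup>2 * \<bar>B\<bar> * norm Y * (real (2 * n + 1) * (1 / 4) ^ n)"
proof -
  let ?C = "cbox (0::real, 0::real) (pi, 2 * pi)"
  define K where "K x = sph_harm n m (fst x) (snd x) * sin (fst x)" for x :: "real \<times> real"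
  have K: "\<bar>K x\<bar> \<le> real (2 * n + 1) * 4 ^ n" for x
  proof -
    have "\<bar>K x\<bar> \<le> (real (2 * n + 1) * 4 ^ n) * 1"
      unfolding K_def abs_mult by (intro mult_mono abs_sph_harm_le[OF m]) auto
    then show ?thesis by simp
  qed
  define R where "R x = perturb (coef Y) (fst x) (snd x - \<tau>) - perturb_trunc Y n (fst x) (snd x - \<tau>)" for x :: "real \<times> real"
  have P0: "((\<lambda>x. perturb_trunc Y n (fst x) (snd x - \<tau>) * K x) has_integral 0) ?C"
  proof -
    have "((\<lambda>x. \<Sum>k\<in>{(i, j). i + 2 * j + 1 < n}. case k of (i, j) \<Rightarrow> coef Y (i, j) * (1 / 16) ^ i * (1 / 256) ^ j *
        ((sin (fst x) * cos (snd x - \<tau>)) ^ i * cos (fst x) ^ (2 * j + 1) * sph_harm n m (fst x) (snd x) * sin (fst x)))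
        has_integral (\<Sum>k\<in>{(i, j). i + 2 * j + 1 < n}. 0)) ?C"
    proof (rule has_integral_sum[OF finite_low_degree])
      fix k assume "k \<in> {(i, j). i + 2 * j + 1 < n}"
      then obtain i j where k: "k = (i, j)" "i + (2 * j + 1) < n" by auto
      show "((\<lambda>x. case k of (i, j) \<Rightarrow> coef Y (i, j) * (1 / 16) ^ i * (1 / 256) ^ j *
        ((sin (fst x) * cos (snd x - \<tau>)) ^ i * cos (fst x) ^ (2 * j + 1) * sph_harm n m (fst x) (snd x) * sin (fst x)))
        has_integral 0) ?C"
        using has_integral_mult_right[OF monomial_orthogonal[OF k(2) m, of \<tau>],
            of "coef Y (i, j) * (1 / 16) ^ i * (1 / 256) ^ j"]
        by (simp only: k(1) prod.case mult_zero_right)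
    qed
    moreover have "perturb_trunc Y n (fst x) (snd x - \<tau>) * K x = (\<Sum>k\<in>{(i, j). i + 2 * j + 1 < n}. case k of (i, j) \<Rightarrow>
        coef Y (i, j) * (1 / 16) ^ i * (1 / 256) ^ j *
        ((sin (fst x) * cos (snd x - \<tau>)) ^ i * cos (fst x) ^ (2 * j + 1) * sph_harm n m (fst x) (snd x) * sin (fst x)))" for x
      unfolding perturb_trunc_def sum_distrib_right K_def by (rule sum.cong) auto
    ultimately show ?thesis by simp
  qed
  have cont: "continuous_on ?C (\<lambda>x. B * (R x * K x))"
    unfolding R_def K_def
    by (intro continuous_intros continuous_on_perturb continuous_on_perturb_trunc continuous_on_sph_harm)
  define I where "I = integral ?C (\<lambda>x. B * (R x * K x))"
  have I: "((\<lambda>x. B * (R x * K x)) has_integral I) ?C"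
    unfolding I_def using integrable_continuous[OF cont] by (rule integrable_integral)
  have "((\<lambda>x. B * (perturb_trunc Y n (fst x) (snd x - \<tau>) * K x) + B * (R x * K x)) has_integral B * 0 + I) ?C"
    by (intro has_integral_add has_integral_mult_right P0 I)
  then have "((\<lambda>(\<theta>, \<phi>). B * perturb (coef Y) \<theta> (\<phi> - \<tau>) * sph_harm n m \<theta> \<phi> * sin \<theta>) has_integral I) ?C"
    by (simp add: R_def K_def case_prod_unfold algebra_simps)
  then have "sph_coeff (\<lambda>\<theta> \<phi>. B * perturb (coef Y) \<theta> (\<phi> - \<tau>)) n m = I"
    unfolding sph_coeff_def box_eq by (rule integral_unique)
  moreover have "norm I \<le> (\<bar>B\<bar> * (16 * norm Y * (1 / 16) ^ n * (real (2 * n + 1) * 4 ^ n))) * measure lborel ?C"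
  proof (rule has_integral_bound[OF _ I])
    fix x assume "x \<in> ?C"
    show "norm (B * (R x * K x)) \<le> \<bar>B\<bar> * (16 * norm Y * (1 / 16) ^ n * (real (2 * n + 1) * 4 ^ n))"
      unfolding real_norm_def abs_mult
      by (intro mult_mono K) (auto simp: R_def perturb_truncation)
  qed simp
  moreover have "\<bar>B\<bar> * (16 * norm Y * (1 / 16) ^ n * (real (2 * n + 1) * 4 ^ n)) * measure lborel ?C
      = 32 * pi\<^sup>2 * \<bar>B\<bar> * norm Y * (real (2 * n + 1) * ((1 / 16) ^ n * 4 ^ n))"
    by (simp add: content_Pair power2_eq_square)
  moreover have "(1 / 16 :: real) ^ n * 4 ^ n = (1 / 4) ^ n" by (simp add: power_mult_distrib[symmetric])
  ultimately show ?thesis by (simp only: real_norm_def)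
qed

text \<open>There are at most 2 (n + 1) orders m for each n, and each contributes at most 12 (n +
  1)^6 (1 / 2)^n.\<close>

definition gevrey_const :: real where
  "gevrey_const = (\<Sum>n. 24 * (real (n + 1) ^ 7 * (1 / 2) ^ n))"

text \<open>As sqrt (mu n) <= n + 1, the exponential weight with \<lambda> = 1 / 2 is at most 3 *
  3^n, whereas the squared coefficients decay like 16^-n. The ratio 3 / 16 absorbs all polynomial
  factors.\<close>

lemma gevrey_norm_le:
  assumes A: "A \<ge> 0" and u: "\<And>n m. nat \<bar>m\<bar> \<le> n \<Longrightarrow> \<bar>sph_coeff u n m\<bar> \<le> A * (real (2 * n + 1) * (1 / 4) ^ n)"
  shows "gevrey_norm (1 / 2) u \<le> ereal (A * sqrt gevrey_const)"
proof -
  define I where "I = (SIGMA n:UNIV. {- int n..int n})"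
  define G where "G n = 12 * (real (n + 1) ^ 6 * (1 / 2) ^ n)" for n
  have G0: "G n \<ge> 0" for n by (simp add: G_def)
  have t0: "gevrey_term (1 / 2) u x \<ge> 0" for x
    by (cases x) (simp add: gevrey_term_def)
  have t: "gevrey_term (1 / 2) u (n, m) \<le> A\<^sup>2 * G n" if "m \<in> {- int n..int n}" for n m
  proof -
    have "mu n = real n * (real n + 1) + 1" by (simp add: mu_def eigval_def)
    then have mu: "0 \<le> mu n" "mu n \<le> (real (n + 1))\<^sup>2" by (auto simp: power2_eq_square algebra_simps)
    have "sqrt (mu n) \<le> real (n + 1)" using mu by (intro real_le_lsqrt) auto
    then have "exp (sqrt (mu n)) \<le> exp (real (n + 1))" by simp
    also have "\<dots> = exp 1 ^ (n + 1)" by (metis exp_of_nat_mult mult.right_neutral)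
    also have "\<dots> \<le> 3 ^ (n + 1)" by (intro power_mono exp_le) auto
    finally have ex: "exp (2 * (1 / 2) * sqrt (mu n)) \<le> 3 * 3 ^ n" by simp
    have "\<bar>sph_coeff u n m\<bar> \<le> A * (real (2 * n + 1) * (1 / 4) ^ n)" using that by (intro u) auto
    also have "\<dots> \<le> A * (2 * real (n + 1) * (1 / 4) ^ n)"
      using A by (intro mult_left_mono mult_right_mono) auto
    finally have "\<bar>sph_coeff u n m\<bar>\<^sup>2 \<le> (A * (2 * real (n + 1) * (1 / 4) ^ n))\<^sup>2"
      by (intro power_mono) auto
    moreover have "(mu n)\<^sup>2 \<le> ((real (n + 1))\<^sup>2)\<^sup>2" using mu by (intro power_mono)
    ultimately have "gevrey_term (1 / 2) u (n, m)
        \<le> ((real (n + 1))\<^sup>2)\<^sup>2 * (3 * 3 ^ n) * (A * (2 * real (n + 1) * (1 / 4) ^ n))\<^sup>2"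
      unfolding gevrey_term_def prod.case by (intro mult_mono ex) auto
    also have "\<dots> = A\<^sup>2 * (12 * (real (n + 1) ^ 6 * (3 ^ n * ((1 / 4) ^ n)\<^sup>2)))"
      by (simp add: power_mult_distrib power2_eq_square eval_nat_numeral algebra_simps)
    also have "(3::real) ^ n * ((1 / 4) ^ n)\<^sup>2 = (3 / 16) ^ n"
      by (simp add: power2_eq_square power_mult_distrib[symmetric])
    also have "A\<^sup>2 * (12 * (real (n + 1) ^ 6 * (3 / 16) ^ n)) \<le> A\<^sup>2 * G n"
      unfolding G_def by (intro mult_left_mono power_mono) auto
    finally show ?thesis .
  qed
  have sG: "summable (\<lambda>n. 24 * (real (n + 1) ^ 7 * (1 / 2) ^ n))"
    by (intro summable_mult summable_poly_geometric)
  have GG: "real (2 * n + 1) * G n \<le> 24 * (real (n + 1) ^ 7 * (1 / 2) ^ n)" for n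
  proof -
    have "real (2 * n + 1) * G n \<le> (2 * real (n + 1)) * G n"
      using G0 by (intro mult_right_mono) auto
    also have "\<dots> = 24 * (real (n + 1) ^ 7 * (1 / 2) ^ n)"
      by (simp add: G_def eval_nat_numeral)
    finally show ?thesis .
  qed
  have bd: "sum (gevrey_term (1 / 2) u) F \<le> A\<^sup>2 * gevrey_const" if F: "finite F" "F \<subseteq> I" for F
  proof -
    obtain N where N: "fst ` F \<subseteq> {..<N}"
      using finite_nat_bounded[OF finite_imageI[OF F(1)]] by blast
    have "F \<subseteq> (SIGMA n:{..<N}. {- int n..int n})"
      using N F(2) by (fastforce simp: I_def)
    then have "sum (gevrey_term (1 / 2) u) F \<le> sum (gevrey_term (1 / 2) u) (SIGMA n:{..<N}. {- int n..int n})"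
      by (intro sum_mono2) (auto simp: t0)
    also have "\<dots> = (\<Sum>n<N. \<Sum>m\<in>{- int n..int n}. gevrey_term (1 / 2) u (n, m))"
      by (subst sum.Sigma) auto
    also have "\<dots> \<le> (\<Sum>n<N. \<Sum>m\<in>{- int n..int n}. A\<^sup>2 * G n)"
      by (intro sum_mono t)
    also have "\<dots> = (\<Sum>n<N. A\<^sup>2 * (real (2 * n + 1) * G n))"
      by (intro sum.cong) (auto simp: nat_add_distrib algebra_simps)
    also have "\<dots> = A\<^sup>2 * (\<Sum>n<N. real (2 * n + 1) * G n)"
      by (rule sum_distrib_left[symmetric])
    also have "\<dots> \<le> A\<^sup>2 * (\<Sum>n<N. 24 * (real (n + 1) ^ 7 * (1 / 2) ^ n))"
      by (rule mult_left_mono[OF sum_mono[OF GG]]) simp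
    also have "\<dots> \<le> A\<^sup>2 * gevrey_const"
      unfolding gevrey_const_def by (intro mult_left_mono sum_le_suminf sG) auto
    finally show ?thesis .
  qed
  have sm: "gevrey_term (1 / 2) u summable_on I"
    by (rule nonneg_bdd_above_summable_on) (use t0 bd in \<open>auto intro!: bdd_aboveI2\<close>)
  have "(\<Sum>\<^sub>\<infinity>i\<in>I. gevrey_term (1 / 2) u i) \<le> A\<^sup>2 * gevrey_const"
    by (rule infsum_le_finite_sums[OF sm bd])
  then have "sqrt (\<Sum>\<^sub>\<infinity>i\<in>I. gevrey_term (1 / 2) u i) \<le> sqrt (A\<^sup>2 * gevrey_const)"
    by (rule real_sqrt_le_mono)
  also have "\<dots> = A * sqrt gevrey_const" using A by (simp add: real_sqrt_mult)
  finally show ?thesis using sm by (simp add: gevrey_norm_def I_def Let_def)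
qed

theorem corollary1p4:
  fixes \<gamma> :: real
  assumes "\<gamma> \<noteq> 0"
  shows "\<exists>l>0. \<exists>\<epsilon>\<^sub>0>0. \<exists>\<Psi> :: real \<Rightarrow> real \<Rightarrow> S2_fun.
           (\<forall>\<epsilon>\<in>{0<..\<epsilon>\<^sub>0}.
              travelling_wave (sqrt (3 / pi) * \<gamma>) (\<Psi> \<epsilon>) \<and>
              (\<forall>t. analytic_S2 (\<Psi> \<epsilon> t) \<and> \<not> zonal (\<Psi> \<epsilon> t) \<and> \<not> trivial_S2 (\<Psi> \<epsilon> t))) \<and>
           (\<exists>C. \<forall>\<epsilon>\<in>{0<..\<epsilon>\<^sub>0}. \<forall>t.
              gevrey_norm l (\<lambda>\<theta> \<phi>. 3 * \<gamma> * sph_harm 1 0 \<theta> \<phi> - \<Psi> \<epsilon> t \<theta> \<phi>) \<le> ereal (C * \<epsilon>))"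
proof -
  define c where "c = sqrt (3 / pi) * \<gamma>"
  have c: "c \<noteq> 0" using assms by (simp add: c_def)
  \<comment> \<open>The solutions are chosen for each e separately; the uniform bound 17 is what
    makes \<open>C\<close> independent of e.\<close>
  have "\<exists>Y \<beta>. norm Y \<le> 17 \<and> coef Y (1, 0) = 16 \<and> solves_wave e \<beta> Y" if "e \<in> {0<..1 / 10 ^ 14}" for e
    using wave_coeffs[of e] that by (simp add: solves_wave_def wave_source_def)
  then obtain Y \<beta> where Y: "\<And>e. e \<in> {0<..1 / 10 ^ 14} \<Longrightarrow> norm (Y e) \<le> 17 \<and> coef (Y e) (1, 0) = 16 \<and> solves_wave e (\<beta> e) (Y e)"
    by metis
  define \<Psi> where "\<Psi> e = stream c e (Y e)" for e
  define C where "C = 32 * pi\<^sup>2 * (\<bar>c\<bar> / 2) * 17 * sqrt gevrey_const"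
  have tw: "travelling_wave c (\<Psi> e)" if "e \<in> {0<..1 / 10 ^ 14}" for e
    unfolding \<Psi>_def using Y[OF that] by (blast intro: travelling_wave_stream)
  have nt: "\<not> trivial_S2 (\<Psi> e t)" if "e \<in> {0<..1 / 10 ^ 14}" for e t
    unfolding \<Psi>_def using Y[OF that] that c by (intro not_trivial_stream) auto
  have gv: "gevrey_norm (1 / 2) (\<lambda>\<theta> \<phi>. 3 * \<gamma> * sph_harm 1 0 \<theta> \<phi> - \<Psi> e t \<theta> \<phi>) \<le> ereal (C * e)"
    if e: "e \<in> {0<..1 / 10 ^ 14}" for e t
  proof -
    \<comment> \<open>3 \<gamma> times the harmonic is (3 c / 2) cos \<theta>, the value of
      \<open>stream\<close> without perturbation. Time only shifts the longitude, so the estimate is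
      uniform in t.\<close>
    have eq: "(\<lambda>\<theta> \<phi>. 3 * \<gamma> * sph_harm 1 0 \<theta> \<phi> - \<Psi> e t \<theta> \<phi>)
        = (\<lambda>\<theta> \<phi>. (- c * e / 2) * perturb (coef (Y e)) \<theta> (\<phi> - c * t))"
      by (simp add: fun_eq_iff \<Psi>_def stream_def wave_def sph_harm_1_0[unfolded One_nat_def] c_def field_simps)
    have "gevrey_norm (1 / 2) (\<lambda>\<theta> \<phi>. 3 * \<gamma> * sph_harm 1 0 \<theta> \<phi> - \<Psi> e t \<theta> \<phi>)
        \<le> ereal (32 * pi\<^sup>2 * \<bar>- c * e / 2\<bar> * 17 * sqrt gevrey_const)"
      unfolding eq
    proof (rule gevrey_norm_le)
      fix n m assume "nat \<bar>m\<bar> \<le> n"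
      from sph_coeff_perturb_le[OF this, of "- c * e / 2" "Y e" "c * t"]
      show "\<bar>sph_coeff (\<lambda>\<theta> \<phi>. (- c * e / 2) * perturb (coef (Y e)) \<theta> (\<phi> - c * t)) n m\<bar>
          \<le> 32 * pi\<^sup>2 * \<bar>- c * e / 2\<bar> * 17 * (real (2 * n + 1) * (1 / 4) ^ n)"
        by (rule order_trans) (use Y[OF e] in \<open>intro mult_right_mono mult_left_mono; simp\<close>)
    qed simp
    also have "32 * pi\<^sup>2 * \<bar>- c * e / 2\<bar> * 17 * sqrt gevrey_const = C * e"
      using e by (simp add: C_def abs_mult)
    finally show ?thesis .
  qed
  show ?thesis
    unfolding c_def[symmetric]
  proof (intro exI conjI ballI allI)
    fix e t assume e: "e \<in> {0<..1 / 10 ^ 14 :: real}"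
    show "travelling_wave c (\<Psi> e)" by (rule tw[OF e])
    show "analytic_S2 (\<Psi> e t)" unfolding \<Psi>_def by (rule analytic_stream)
    show "\<not> trivial_S2 (\<Psi> e t)" by (rule nt[OF e])
    then show "\<not> zonal (\<Psi> e t)" by (rule not_zonal_if_not_trivial)
    show "gevrey_norm (1 / 2) (\<lambda>\<theta> \<phi>. 3 * \<gamma> * sph_harm 1 0 \<theta> \<phi> - \<Psi> e t \<theta> \<phi>) \<le> ereal (C * e)"
      by (rule gv[OF e])
  qed auto
qed

end
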